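(* Let $E$ be the countable, measure-preserving, ergodic and hyperfinite equivalence relation on the standard probability space $(X,\mu)$. Then $t([E])=2$; that is, the minimum number of elements generating a dense subgroup of the measurable full group $[E]$ with respect to the uniform topology is $2$.
   Context: $X$ is a standard Borel space and $\mu$ is a non-atomic Borel probability measure on $X$. $\operatorname{Aut}(X,\mu)$ is the group of all measure-preserving automorphisms of $(X,\mu)$, modulo null sets, equipped with the uniform topology, i.e. the topology induced by the metric $d(f,g)=\mu(\{x\in X\mid f(x)\neq g(x)\})$. $E$ is a Borel equivalence relation on $X$. It is countable if every equivalence class is countable; measure-preserving if every Borel automorphism of $X$ whose graph is contained in $E$ preserves $\mu$; ergodic if every $E$-invariant Borel set has measure $0$ or $1$; hyperfinite if, up to a null set, it is an increasing union of a sequence of Borel equivalence relations with finite classes (equivalently, up to a null set, it is the orbit equivalence relation of a single Borel automorphism). A countable, measure-preserving, ergodic, hyperfinite equivalence relation on $(X,\mu)$ is unique up to isomorphism (modulo null sets). The measurable full group of $E$ is $[E]=\{f\in\operatorname{Aut}(X,\mu)\mid (x,f(x))\in E\text{ for almost every }x\in X\}$, a closed subgroup of $\operatorname{Aut}(X,\mu)$ in the uniform topology. $t([E])$ denotes the minimum number of topological generators of $[E]$, i.e. the minimum number of elements which generate a dense subgroup of $[E]$. *)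

theory Defs
  imports
    "HOL-Probability.Probability_Measure"
    "HOL-Algebra.Generated_Groups"
    "HOL-Library.Extended_Nat"
begin

section \<open>Standard Borel spaces and non-atomic measures\<close>

definition standard_borel :: "'a measure \<Rightarrow> bool" where
  "standard_borel M \<longleftrightarrow>
     (\<exists>T. topspace T = space M \<and> completely_metrizable_space T \<and> separable_space T \<and>
          sets M = sigma_sets (space M) {U. openin T U})"

definition non_atomic :: "'a measure \<Rightarrow> bool" where
  "non_atomic M \<longleftrightarrow>
     (\<forall>A\<in>sets M. 0 < emeasure M A \<longrightarrow>
        (\<exists>B\<in>sets M. B \<subseteq> A \<and> 0 < emeasure M B \<and> emeasure M B < emeasure M A))"


section \<open>Borel and measure-preserving automorphisms\<close>

text \<open>Functions are total on the type; only their values on \<open>space M\<close> matter.\<close>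

definition borel_auts :: "'a measure \<Rightarrow> ('a \<Rightarrow> 'a) set" where
  "borel_auts M = {f. bij_betw f (space M) (space M) \<and> f \<in> measurable M M \<and>
                      the_inv_into (space M) f \<in> measurable M M}"

definition mp_auts :: "'a measure \<Rightarrow> ('a \<Rightarrow> 'a) set" where
  "mp_auts M = {f \<in> borel_auts M. distr M M f = M}"

definition ae_eq :: "'a measure \<Rightarrow> (('a \<Rightarrow> 'a) \<times> ('a \<Rightarrow> 'a)) set" where
  "ae_eq M = {(f, g). f \<in> mp_auts M \<and> g \<in> mp_auts M \<and> (AE x in M. f x = g x)}"

text \<open>
  The group of measure-preserving automorphisms modulo null sets. Its elements are classes of
  \<open>ae_eq M\<close>, and the product of the classes of \<open>f\<close> and \<open>g\<close> is the class of \<open>f \<circ> g\<close>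
  (see \<open>aut_group_mult\<close> below).
\<close>

definition aut_group :: "'a measure \<Rightarrow> ('a \<Rightarrow> 'a) set monoid" where
  "aut_group M =
     \<lparr>carrier = mp_auts M // ae_eq M,
      mult = (\<lambda>P Q. \<Union>f\<in>P. \<Union>g\<in>Q. ae_eq M `` {f \<circ> g}),
      one = ae_eq M `` {id}\<rparr>"

text \<open>
  The metric is evaluated at arbitrary representatives. On a standard Borel space the value does not
  depend on the choice (see \<open>uniform_dist_class\<close> below).
\<close>

definition uniform_dist :: "'a measure \<Rightarrow> ('a \<Rightarrow> 'a) set \<Rightarrow> ('a \<Rightarrow> 'a) set \<Rightarrow> real" where
  "uniform_dist M P Q = measure M {x \<in> space M. (SOME f. f \<in> P) x \<noteq> (SOME g. g \<in> Q) x}"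

definition uniform_topology :: "'a measure \<Rightarrow> ('a \<Rightarrow> 'a) set topology" where
  "uniform_topology M = Metric_space.mtopology (carrier (aut_group M)) (uniform_dist M)"


section \<open>Borel equivalence relations\<close>

definition borel_equiv :: "'a measure \<Rightarrow> 'a rel \<Rightarrow> bool" where
  "borel_equiv M E \<longleftrightarrow> equiv (space M) E \<and> E \<in> sets (M \<Otimes>\<^sub>M M)"

definition countable_rel :: "'a measure \<Rightarrow> 'a rel \<Rightarrow> bool" where
  "countable_rel M E \<longleftrightarrow> (\<forall>x\<in>space M. countable (E `` {x}))"

definition measure_preserving_rel :: "'a measure \<Rightarrow> 'a rel \<Rightarrow> bool" where
  "measure_preserving_rel M E \<longleftrightarrow>
     (\<forall>f\<in>borel_auts M. (\<forall>x\<in>space M. (x, f x) \<in> E) \<longrightarrow> distr M M f = M)"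

definition ergodic_rel :: "'a measure \<Rightarrow> 'a rel \<Rightarrow> bool" where
  "ergodic_rel M E \<longleftrightarrow>
     (\<forall>A\<in>sets M. E `` A = A \<longrightarrow> emeasure M A = 0 \<or> emeasure M A = 1)"

definition hyperfinite_everywhere :: "'a measure \<Rightarrow> 'a rel \<Rightarrow> bool" where
  "hyperfinite_everywhere M E \<longleftrightarrow>
     (\<exists>F :: nat \<Rightarrow> 'a rel.
        (\<forall>n. borel_equiv M (F n) \<and> (\<forall>x\<in>space M. finite (F n `` {x}))) \<and>
        incseq F \<and> E = (\<Union>n. F n))"

definition hyperfinite_rel :: "'a measure \<Rightarrow> 'a rel \<Rightarrow> bool" where
  "hyperfinite_rel M E \<longleftrightarrow>
     (\<exists>N\<in>null_sets M. hyperfinite_everywhere (restrict_space M (space M - N))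
                        (Restr E (space M - N)))"


section \<open>The measurable full group\<close>

definition full_group_carrier :: "'a measure \<Rightarrow> 'a rel \<Rightarrow> ('a \<Rightarrow> 'a) set set" where
  "full_group_carrier M E =
     {ae_eq M `` {f} | f. f \<in> mp_auts M \<and> (AE x in M. (x, f x) \<in> E)}"

definition full_group :: "'a measure \<Rightarrow> 'a rel \<Rightarrow> ('a \<Rightarrow> 'a) set monoid" where
  "full_group M E = (aut_group M)\<lparr>carrier := full_group_carrier M E\<rparr>"

definition full_group_topology :: "'a measure \<Rightarrow> 'a rel \<Rightarrow> ('a \<Rightarrow> 'a) set topology" where
  "full_group_topology M E = subtopology (uniform_topology M) (full_group_carrier M E)"


section \<open>Topological generators\<close>

definition topologically_generates ::
    "('g, 'b) monoid_scheme \<Rightarrow> 'g topology \<Rightarrow> 'g set \<Rightarrow> bool" where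
  "topologically_generates G T S \<longleftrightarrow>
     S \<subseteq> carrier G \<and> T closure_of (generate G S) = carrier G"

text \<open>The value is \<open>\<infinity>\<close> if there is no finite set of topological generators.\<close>

definition min_top_generators :: "('g, 'b) monoid_scheme \<Rightarrow> 'g topology \<Rightarrow> enat" where
  "min_top_generators G T =
     Inf {enat (card S) | S. finite S \<and> topologically_generates G T S}"


section \<open>Well-definedness\<close>

lemma mp_autsD:
  assumes "f \<in> mp_auts M"
  shows "bij_betw f (space M) (space M)" "f \<in> measurable M M" "distr M M f = M"
    "the_inv_into (space M) f \<in> measurable M M"
  using assms by (auto simp: mp_auts_def borel_auts_def)

lemma id_in_mp_auts: "id \<in> mp_auts M"
proof -
  have "the_inv_into (space M) id \<in> measurable M M \<longleftrightarrow> id \<in> measurable M M"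
    by (rule measurable_cong) (auto intro: the_inv_into_f_eq)
  then show ?thesis
    by (simp add: mp_auts_def borel_auts_def id_def bij_betw_def)
qed

lemma comp_in_mp_auts:
  assumes f: "f \<in> mp_auts M" and g: "g \<in> mp_auts M"
  shows "f \<circ> g \<in> mp_auts M"
proof -
  note F = mp_autsD[OF f] and G = mp_autsD[OF g]
  have b: "bij_betw (f \<circ> g) (space M) (space M)"
    using F(1) G(1) bij_betw_trans by blast
  have "the_inv_into (space M) (f \<circ> g) \<in> measurable M M \<longleftrightarrow>
      the_inv_into (space M) g \<circ> the_inv_into (space M) f \<in> measurable M M"
  proof (rule measurable_cong)
    fix w assume "w \<in> space M"
    then show "the_inv_into (space M) (f \<circ> g) w =
        (the_inv_into (space M) g \<circ> the_inv_into (space M) f) w"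
      using F(1) G(1) the_inv_into_comp[of f g "space M" w] by (simp add: bij_betw_def)
  qed
  moreover have "the_inv_into (space M) g \<circ> the_inv_into (space M) f \<in> measurable M M"
    using F G by (intro measurable_comp)
  moreover have "distr M M (f \<circ> g) = M"
    using distr_distr[OF F(2) G(2)] F(3) G(3) by simp
  ultimately show ?thesis
    using b F G by (auto simp: mp_auts_def borel_auts_def intro: measurable_comp)
qed

lemma inv_in_mp_auts:
  assumes f: "f \<in> mp_auts M"
  shows "the_inv_into (space M) f \<in> mp_auts M"
proof -
  note F = mp_autsD[OF f]
  let ?i = "the_inv_into (space M) f"
  have b: "bij_betw ?i (space M) (space M)"
    using F(1) by (rule bij_betw_the_inv_into)
  have eq: "?i (f w) = w" if "w \<in> space M" for w
    using F(1) that by (auto simp: bij_betw_def the_inv_into_f_f)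
  have "the_inv_into (space M) ?i \<in> measurable M M \<longleftrightarrow> f \<in> measurable M M"
  proof (rule measurable_cong)
    fix w assume w: "w \<in> space M"
    then have "f w \<in> space M" using F(1) by (auto simp: bij_betw_def)
    then show "the_inv_into (space M) ?i w = f w"
      using b eq[OF w] w by (subst the_inv_into_f_eq[of ?i _ "f w"]) (auto simp: bij_betw_def)
  qed
  moreover have "distr M M ?i = M"
  proof -
    have "distr M M ?i = distr (distr M M f) M ?i" using F(3) by simp
    also have "\<dots> = distr M M (?i \<circ> f)" using F by (intro distr_distr)
    also have "\<dots> = distr M M (\<lambda>x. x)" by (rule distr_cong) (auto simp: eq)
    finally show ?thesis by simp
  qed
  ultimately show ?thesis
    using b F by (auto simp: mp_auts_def borel_auts_def)
qed

lemma equiv_ae_eq: "equiv (mp_auts M) (ae_eq M)"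
proof (rule equivI)
  show "trans (ae_eq M)"
  proof (rule transI)
    fix f g h assume "(f, g) \<in> ae_eq M" "(g, h) \<in> ae_eq M"
    then show "(f, h) \<in> ae_eq M"
      by (auto simp: ae_eq_def elim!: AE_mp)
  qed
  show "sym (ae_eq M)"
    by (auto simp: ae_eq_def sym_def elim!: AE_mp)
qed (auto simp: ae_eq_def refl_on_def)

lemma ae_eq_comp:
  assumes "(f, f') \<in> ae_eq M" "(g, g') \<in> ae_eq M"
  shows "(f \<circ> g, f' \<circ> g') \<in> ae_eq M"
proof -
  from assms have m: "f \<in> mp_auts M" "f' \<in> mp_auts M" "g \<in> mp_auts M" "g' \<in> mp_auts M"
    and e: "AE x in M. f x = f' x" "AE x in M. g x = g' x"
    by (auto simp: ae_eq_def)
  have "AE x in M. f (g x) = f' (g x)"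
    using AE_distrD[OF mp_autsD(2)[OF m(3)], of "\<lambda>x. f x = f' x"]
    unfolding mp_autsD(3)[OF m(3)] using e(1) .
  with e(2) have "AE x in M. f (g x) = f' (g' x)"
    by eventually_elim simp
  with m show ?thesis
    by (simp add: ae_eq_def comp_in_mp_auts)
qed

lemma aut_group_mult:
  assumes "f \<in> mp_auts M" "g \<in> mp_auts M"
  shows "(ae_eq M `` {f}) \<otimes>\<^bsub>aut_group M\<^esub> (ae_eq M `` {g}) = ae_eq M `` {f \<circ> g}"
proof -
  have "congruent2 (ae_eq M) (ae_eq M) (\<lambda>f g. ae_eq M `` {f \<circ> g})"
    by (rule congruent2I') (rule equiv_class_eq[OF equiv_ae_eq ae_eq_comp])
  from UN_equiv_class2[OF equiv_ae_eq equiv_ae_eq this assms] show ?thesis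
    by (simp add: aut_group_def)
qed

lemma carrier_aut_group: "carrier (aut_group M) = {ae_eq M `` {f} | f. f \<in> mp_auts M}"
  by (auto simp: aut_group_def quotient_def)

lemma group_aut_group: "group (aut_group M)"
proof (rule groupI)
  have one: "\<one>\<^bsub>aut_group M\<^esub> = ae_eq M `` {id}"
    by (simp add: aut_group_def)
  show "\<one>\<^bsub>aut_group M\<^esub> \<in> carrier (aut_group M)"
    using id_in_mp_auts one by (auto simp: carrier_aut_group)
  show "P \<otimes>\<^bsub>aut_group M\<^esub> Q \<in> carrier (aut_group M)"
    if "P \<in> carrier (aut_group M)" "Q \<in> carrier (aut_group M)" for P Q
    using that by (auto simp: carrier_aut_group aut_group_mult intro: comp_in_mp_auts)
  show "P \<otimes>\<^bsub>aut_group M\<^esub> Q \<otimes>\<^bsub>aut_group M\<^esub> R = P \<otimes>\<^bsub>aut_group M\<^esub> (Q \<otimes>\<^bsub>aut_group M\<^esub> R)"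
    if "P \<in> carrier (aut_group M)" "Q \<in> carrier (aut_group M)" "R \<in> carrier (aut_group M)"
    for P Q R
    using that by (auto simp: carrier_aut_group aut_group_mult comp_in_mp_auts comp_assoc)
  show "\<one>\<^bsub>aut_group M\<^esub> \<otimes>\<^bsub>aut_group M\<^esub> P = P" if "P \<in> carrier (aut_group M)" for P
    using that by (auto simp: carrier_aut_group aut_group_mult id_in_mp_auts one)
  show "\<exists>Q\<in>carrier (aut_group M). Q \<otimes>\<^bsub>aut_group M\<^esub> P = \<one>\<^bsub>aut_group M\<^esub>"
    if "P \<in> carrier (aut_group M)" for P
  proof -
    from that obtain f where f: "f \<in> mp_auts M" and P: "P = ae_eq M `` {f}"
      by (auto simp: carrier_aut_group)
    let ?i = "the_inv_into (space M) f"
    have i: "?i \<in> mp_auts M" by (rule inv_in_mp_auts[OF f])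
    have "(?i \<circ> f, id) \<in> ae_eq M"
      using mp_autsD(1)[OF f]
      by (auto simp: ae_eq_def comp_in_mp_auts f i id_in_mp_auts bij_betw_def the_inv_into_f_f)
    then have "ae_eq M `` {?i} \<otimes>\<^bsub>aut_group M\<^esub> P = \<one>\<^bsub>aut_group M\<^esub>"
      unfolding P aut_group_mult[OF i f] one by (rule equiv_class_eq[OF equiv_ae_eq])
    then show ?thesis using i by (auto simp: carrier_aut_group)
  qed
qed

lemma sets_noteq:
  assumes M: "standard_borel M" and f[measurable]: "f \<in> measurable M M"
    and g[measurable]: "g \<in> measurable M M"
  shows "{x \<in> space M. f x \<noteq> g x} \<in> sets M"
proof -
  obtain T where T: "topspace T = space M" "completely_metrizable_space T" "separable_space T"
    "sets M = sigma_sets (space M) {U. openin T U}"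
    using M by (auto simp: standard_borel_def)
  then obtain X d where "Metric_space X d" and TX: "T = Metric_space.mtopology X d"
    by (auto simp: completely_metrizable_space_def)
  interpret Metric_space X d by fact
  have X: "X = space M" using T(1) TX by simp
  obtain C where C: "countable C" "C \<subseteq> X" "mtopology closure_of C = X"
    using T(3) TX by (auto simp: separable_space_def)
  have [measurable]: "mball c r \<in> sets M" for c r
    unfolding T(4) TX by (rule sigma_sets.Basic) simp
  let ?B = "\<lambda>c q. {x \<in> space M. f x \<in> mball c (real_of_rat q) \<and> g x \<notin> mball c (real_of_rat q)}"
  have "{x \<in> space M. f x \<noteq> g x} = (\<Union>c\<in>C. \<Union>q. ?B c q)"
  proof (intro equalityI subsetI)
    fix x assume "x \<in> {x \<in> space M. f x \<noteq> g x}"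
    then have x: "x \<in> space M" "f x \<noteq> g x" by auto
    have fg: "f x \<in> X" "g x \<in> X"
      using x measurable_space[OF f] measurable_space[OF g] X by auto
    then have pos: "d (f x) (g x) / 2 > 0" using x by simp
    have "f x \<in> mtopology closure_of C" using C fg by simp
    then obtain c where c: "c \<in> C" "c \<in> mball (f x) (d (f x) (g x) / 2)"
      using pos unfolding metric_closure_of by blast
    then have cX: "c \<in> X" and dc: "d (f x) c < d (f x) (g x) / 2" by auto
    obtain q where q: "d (f x) c < real_of_rat q" "real_of_rat q < d (f x) (g x) / 2"
      using of_rat_dense[OF dc] by blast
    have "d (f x) (g x) \<le> d (f x) c + d c (g x)" using fg cX by (intro triangle)
    then have "x \<in> ?B c q" using x q fg cX by (auto simp: commute)
    then show "x \<in> (\<Union>c\<in>C. \<Union>q. ?B c q)" using c by blast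
  qed auto
  also have "\<dots> \<in> sets M"
  proof -
    have "?B c q \<in> sets M" for c q
    proof -
      have "?B c q = (f -` mball c (real_of_rat q) \<inter> space M) -
          (g -` mball c (real_of_rat q) \<inter> space M)"
        by blast
      then show ?thesis
        by (simp only: measurable_sets[OF f] measurable_sets[OF g] sets.Diff \<open>\<And>c r. mball c r \<in> sets M\<close>)
    qed
    then have "(\<Union>q. ?B c q) \<in> sets M" for c
      by (intro sets.countable_UN) blast
    then show ?thesis
      using C(1) by (rule sets.countable_UN''[rotated])
  qed
  finally show ?thesis .
qed

lemma uniform_dist_class:
  assumes M: "standard_borel M" "finite_measure M" and f: "f \<in> mp_auts M" and g: "g \<in> mp_auts M"
  shows "uniform_dist M (ae_eq M `` {f}) (ae_eq M `` {g}) = measure M {x \<in> space M. f x \<noteq> g x}"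
proof -
  have rep: "(h, SOME h'. h' \<in> ae_eq M `` {h}) \<in> ae_eq M" if "h \<in> mp_auts M" for h
    using someI[of "\<lambda>h'. h' \<in> ae_eq M `` {h}" h] that by (auto simp: ae_eq_def)
  define f' g' where "f' = (SOME h. h \<in> ae_eq M `` {f})" and "g' = (SOME h. h \<in> ae_eq M `` {g})"
  have m: "f' \<in> mp_auts M" "g' \<in> mp_auts M" "AE x in M. f x = f' x" "AE x in M. g x = g' x"
    using rep[OF f] rep[OF g] by (auto simp: ae_eq_def f'_def g'_def)
  have "AE x in M. x \<in> {x \<in> space M. f' x \<noteq> g' x} \<longleftrightarrow> x \<in> {x \<in> space M. f x \<noteq> g x}"
    using m(3,4) by eventually_elim auto
  then have "measure M {x \<in> space M. f' x \<noteq> g' x} = measure M {x \<in> space M. f x \<noteq> g x}"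
    using M m f g by (intro measure_eq_AE) (auto intro!: sets_noteq mp_autsD(2))
  then show ?thesis by (simp add: uniform_dist_def f'_def g'_def)
qed

lemma Metric_space_uniform_dist:
  assumes M: "standard_borel M" "finite_measure M"
  shows "Metric_space (carrier (aut_group M)) (uniform_dist M)"
proof
  interpret finite_measure M by fact
  show "0 \<le> uniform_dist M P Q" for P Q by (simp add: uniform_dist_def)
  show "uniform_dist M P Q = uniform_dist M Q P" for P Q
    by (simp add: uniform_dist_def eq_commute)
  have S: "{x \<in> space M. f x \<noteq> g x} \<in> sets M" if "f \<in> mp_auts M" "g \<in> mp_auts M" for f g
    using that M by (intro sets_noteq) (auto intro: mp_autsD)
  show "uniform_dist M P Q = 0 \<longleftrightarrow> P = Q"
    if PQ: "P \<in> carrier (aut_group M)" "Q \<in> carrier (aut_group M)" for P Q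
  proof -
    obtain f g where fg: "f \<in> mp_auts M" "g \<in> mp_auts M"
      and P: "P = ae_eq M `` {f}" and Q: "Q = ae_eq M `` {g}"
      using PQ by (auto simp: carrier_aut_group)
    have "uniform_dist M P Q = 0 \<longleftrightarrow> emeasure M {x \<in> space M. f x \<noteq> g x} = 0"
      using fg by (simp add: P Q uniform_dist_class[OF M] emeasure_eq_measure)
    also have "\<dots> \<longleftrightarrow> (AE x in M. f x = g x)"
      using AE_iff_measurable[OF S[OF fg], of "\<lambda>x. f x = g x"] by simp
    also have "\<dots> \<longleftrightarrow> (f, g) \<in> ae_eq M" using fg by (simp add: ae_eq_def)
    also have "\<dots> \<longleftrightarrow> P = Q"
      unfolding P Q using fg eq_equiv_class_iff[OF equiv_ae_eq, of f M g] by simp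
    finally show ?thesis .
  qed
  show "uniform_dist M P R \<le> uniform_dist M P Q + uniform_dist M Q R"
    if PQR: "P \<in> carrier (aut_group M)" "Q \<in> carrier (aut_group M)" "R \<in> carrier (aut_group M)"
    for P Q R
  proof -
    obtain f g h where m: "f \<in> mp_auts M" "g \<in> mp_auts M" "h \<in> mp_auts M"
      and e: "P = ae_eq M `` {f}" "Q = ae_eq M `` {g}" "R = ae_eq M `` {h}"
      using PQR by (auto simp: carrier_aut_group)
    have "measure M {x \<in> space M. f x \<noteq> h x} \<le>
        measure M ({x \<in> space M. f x \<noteq> g x} \<union> {x \<in> space M. g x \<noteq> h x})"
      using m by (intro finite_measure_mono sets.Un S) auto
    also have "\<dots> \<le> measure M {x \<in> space M. f x \<noteq> g x} + measure M {x \<in> space M. g x \<noteq> h x}"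
      using m by (intro measure_Un_le S)
    finally show ?thesis using m by (simp add: e uniform_dist_class[OF M])
  qed
qed

end

theory Submission
  imports Defs "HOL-Probability.Distribution_Functions" "HOL-Combinatorics.Permutations"
    "HOL-Number_Theory.Cong" "HOL-Computational_Algebra.Primes"
begin

text \<open>
  As in Dye's theorem, an increasing sequence of towers \<open>B, T B, \<dots>, T\<^bsup>h-1\<^esup> B\<close> for one automorphism \<open>T\<close> in the
  full group is built such that every element of the full group is approximated by permutations of the
  levels of these towers: hyperfiniteness reduces an element to finitely many patterns on finite classes,
  and ergodicity allows sets of equal measure to be matched.

  The second generator \<open>U\<close> is a product with disjoint supports, one factor for each tower; the factor of the
  \<open>n\<close>-th tower is a cycle of \<open>q n\<close> consecutive levels, where the numbers \<open>q n\<close> are pairwise coprime. By the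
  Chinese remainder theorem each factor is a limit of powers of \<open>U\<close>. Its conjugates by powers of \<open>T\<close> are the
  cycles of \<open>q n\<close> consecutive levels, and these generate all permutations of the levels up to an error on two
  levels.

  A single element generates an abelian group, whose closure is abelian, whereas the full group is not.
\<close>

section \<open>Souslin schemes\<close>

text \<open>Two obstacles shape the proof. \<open>ergodic_rel\<close> speaks of exactly invariant
  Borel sets and the finite relations are merely Borel, so saturations and the minima of classes are
  a priori only described by analytic sets. Analytic sets are therefore shown to be measurable up to
  null sets, and disjoint ones to be separated by Borel sets. The heights of the towers must grow
  fast because the supports of all later factors of \<open>U\<close> have to be negligible compared
  with one level of the present tower. The bases can then be trimmed to make the supports disjoint
  at small cost, and the tail of factors not controlled by a given power of \<open>U\<close> is
  small. Conjugation by \<open>T\<close> shifts a permutation of levels only if the top level is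
  fixed, since \<open>T\<close> carries that level out of the tower; a cycle of
  \<open>q n < h n\<close> levels leaves this room. The error on two levels is a matter of parity:
  the sorting uses three-cycles only, which are even, so the order of the last two levels cannot be
  prescribed.\<close>

definition prefix_list :: "(nat \<Rightarrow> nat) \<Rightarrow> nat \<Rightarrow> nat list" where
  "prefix_list \<sigma> n = map \<sigma> [0..<n]"

lemma prefix_list_simps [simp]:
  "prefix_list \<sigma> 0 = []" "length (prefix_list \<sigma> n) = n"
  "m < n \<Longrightarrow> prefix_list \<sigma> n ! m = \<sigma> m"
  "m \<le> n \<Longrightarrow> take m (prefix_list \<sigma> n) = prefix_list \<sigma> m"
  "map f (prefix_list \<sigma> n) = prefix_list (f \<circ> \<sigma>) n"
  by (auto simp: prefix_list_def take_map)

lemma prefix_list_Suc: "prefix_list \<sigma> (Suc n) = prefix_list \<sigma> n @ [\<sigma> n]"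
  by (simp add: prefix_list_def)

lemma prefix_list_Suc': "prefix_list \<sigma> (Suc n) = \<sigma> 0 # prefix_list (\<sigma> \<circ> Suc) n"
  by (simp add: prefix_list_def map_upt_Suc del: upt_Suc)

text \<open>Souslin's operation A. Borel sets of the square are brought into this form because it
  survives projection to a coordinate.\<close>

definition souslin :: "(nat list \<Rightarrow> 'z set) \<Rightarrow> 'z set" where
  "souslin R = {z. \<exists>\<sigma>. \<forall>n. z \<in> R (prefix_list \<sigma> n)}"

definition souslin_class :: "'z set set \<Rightarrow> 'z set set" where
  "souslin_class K = {souslin R | R. range R \<subseteq> K}"

lemma souslin_classI: "(\<And>s. R s \<in> K) \<Longrightarrow> souslin R \<in> souslin_class K"
  by (auto simp: souslin_class_def)

lemma souslin_class_base: "A \<in> K \<Longrightarrow> A \<in> souslin_class K"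
  using souslin_classI[of "\<lambda>_. A" K] by (simp add: souslin_def)

text \<open>The first entry of a branch selects a member of the union, and the remaining entries
  form a branch of its scheme. \<open>\<Omega>\<close> stands at the empty sequence, where nothing
  has been selected yet.\<close>

lemma souslin_class_UN:
  assumes "\<Omega> \<in> K" "\<And>A. A \<in> K \<Longrightarrow> A \<subseteq> \<Omega>" and B: "\<And>i::nat. B i \<in> souslin_class K"
  shows "(\<Union>i. B i) \<in> souslin_class K"
proof -
  obtain R where R: "\<And>i. B i = souslin (R i)" "\<And>i s. R i s \<in> K"
    using B unfolding souslin_class_def mem_Collect_eq by (metis range_subsetD)
  define R' where "R' s = (case s of [] \<Rightarrow> \<Omega> | i # s' \<Rightarrow> R i s')" for s
  have "(\<Union>i. B i) = souslin R'"
  proof (intro equalityI subsetI)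
    fix z assume "z \<in> (\<Union>i. B i)"
    then obtain i \<sigma> where z: "\<And>n. z \<in> R i (prefix_list \<sigma> n)"
      by (auto simp: R(1) souslin_def)
    have "z \<in> R' (prefix_list (case_nat i \<sigma>) n)" for n
    proof (cases n)
      case 0
      then show ?thesis using z[of 0] R(2) assms(2) by (fastforce simp: R'_def)
    next
      case (Suc m)
      then show ?thesis using z[of m] by (simp add: prefix_list_Suc' R'_def comp_def)
    qed
    then show "z \<in> souslin R'" by (auto simp: souslin_def)
  next
    fix z assume "z \<in> souslin R'"
    then obtain \<sigma> where z: "\<And>n. z \<in> R' (prefix_list \<sigma> n)" by (auto simp: souslin_def)
    have "z \<in> R (\<sigma> 0) (prefix_list (\<sigma> \<circ> Suc) n)" for n
      using z[of "Suc n"] by (simp add: prefix_list_Suc' R'_def)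
    then show "z \<in> (\<Union>i. B i)" by (auto simp: R(1) souslin_def)
  qed
  moreover have "R' s \<in> K" for s
    using R(2) assms(1) by (auto simp: R'_def split: list.split)
  ultimately show ?thesis by (auto intro: souslin_classI)
qed

text \<open>A countable sequence of branches is coded into a single one through \<^const>\<open>prod_encode\<close>;
  an initial segment of the code determines initial segments of finitely many of the branches.\<close>

lemma souslin_class_INT:
  assumes "\<Omega> \<in> K" "\<And>A. A \<in> K \<Longrightarrow> A \<subseteq> \<Omega>"
    and INT: "\<And>C. (\<And>i::nat. C i \<in> K) \<Longrightarrow> (\<Inter>i. C i) \<in> K"
    and B: "\<And>i::nat. B i \<in> souslin_class K"
  shows "(\<Inter>i. B i) \<in> souslin_class K"
proof -
  obtain R where R: "\<And>i. B i = souslin (R i)" "\<And>i s. R i s \<in> K"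
    using B unfolding souslin_class_def mem_Collect_eq by (metis range_subsetD)
  define G where "G s q = (case prod_decode q of (i, n) \<Rightarrow>
      if \<forall>j<n. prod_encode (i, j) < length s then R i (map (\<lambda>j. s ! prod_encode (i, j)) [0..<n])
      else \<Omega>)" for s q
  define R' where "R' s = (\<Inter>q. G s q)" for s
  have "(\<Inter>i. B i) = souslin R'"
  proof (intro equalityI subsetI)
    fix z assume "z \<in> (\<Inter>i. B i)"
    then have "\<forall>i. \<exists>\<sigma>. \<forall>n. z \<in> R i (prefix_list \<sigma> n)" by (auto simp: R(1) souslin_def)
    then obtain \<sigma> where z: "\<And>i n. z \<in> R i (prefix_list (\<sigma> i) n)" by metis
    have z\<Omega>: "z \<in> \<Omega>" using z[of 0 0] R(2) assms(2) by blast
    let ?\<tau> = "\<lambda>m. case prod_decode m of (i, j) \<Rightarrow> \<sigma> i j"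
    have "z \<in> G (prefix_list ?\<tau> N) q" for N q
    proof -
      obtain i n where q: "prod_decode q = (i, n)" by fastforce
      show ?thesis
      proof (cases "\<forall>j<n. prod_encode (i, j) < N")
        case True
        then have "map (\<lambda>j. prefix_list ?\<tau> N ! prod_encode (i, j)) [0..<n] = prefix_list (\<sigma> i) n"
          by (auto simp: prefix_list_def)
        with True z[of i n] show ?thesis by (simp add: G_def q)
      qed (use z\<Omega> in \<open>auto simp: G_def q\<close>)
    qed
    then show "z \<in> souslin R'" by (auto simp: souslin_def R'_def)
  next
    fix z assume "z \<in> souslin R'"
    then obtain \<tau> where z: "\<And>N q. z \<in> G (prefix_list \<tau> N) q" by (auto simp: souslin_def R'_def)
    have "z \<in> R i (prefix_list (\<lambda>j. \<tau> (prod_encode (i, j))) n)" for i n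
    proof -
      define N where "N = Suc (Max (insert 0 ((\<lambda>j. prod_encode (i, j)) ` {..<n})))"
      have N: "\<forall>j<n. prod_encode (i, j) < N"
        by (auto simp: N_def intro!: le_imp_less_Suc Max_ge)
      then have "map (\<lambda>j. prefix_list \<tau> N ! prod_encode (i, j)) [0..<n] =
          prefix_list (\<lambda>j. \<tau> (prod_encode (i, j))) n"
        by (auto simp: prefix_list_def)
      then show ?thesis using z[of N "prod_encode (i, n)"] N by (simp add: G_def)
    qed
    then show "z \<in> (\<Inter>i. B i)" by (auto simp: R(1) souslin_def)
  qed
  moreover have "R' s \<in> K" for s
    unfolding R'_def by (rule INT) (use R(2) assms(1) in \<open>auto simp: G_def split: prod.split\<close>)
  ultimately show ?thesis by (auto intro: souslin_classI)
qed

text \<open>A Souslin class is closed under countable unions and intersections but in general not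
  under complements, so the induction carries every set together with its complement.\<close>

lemma sigma_sets_souslin:
  assumes "\<Omega> \<in> K" "\<And>A. A \<in> K \<Longrightarrow> A \<subseteq> \<Omega>"
    and INT: "\<And>C. (\<And>i::nat. C i \<in> K) \<Longrightarrow> (\<Inter>i. C i) \<in> K"
    and compl: "\<And>A. A \<in> K \<Longrightarrow> \<Omega> - A \<in> souslin_class K"
    and B: "B \<in> sigma_sets \<Omega> K"
  shows "B \<in> souslin_class K"
proof -
  have "B \<in> souslin_class K \<and> \<Omega> - B \<in> souslin_class K"
    using B
  proof induction
    case (Basic a)
    then show ?case using compl souslin_class_base by auto
  next
    case Empty
    then show ?case using compl[OF assms(1)] souslin_class_base[OF assms(1)] by simp
  next
    case (Compl a)
    have "a \<subseteq> \<Omega>" by (rule sigma_sets_into_sp[OF _ Compl.hyps]) (use assms(2) in blast)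
    then show ?case using Compl.IH by (simp add: double_diff)
  next
    case (Union a)
    have eq: "\<Omega> - (\<Union>i. a i) = (\<Inter>i. \<Omega> - a i)" by auto
    have "(\<Union>i. a i) \<in> souslin_class K"
      by (rule souslin_class_UN[OF assms(1,2)]) (use Union.IH in auto)
    moreover have "(\<Inter>i. \<Omega> - a i) \<in> souslin_class K"
      by (rule souslin_class_INT[OF assms(1,2) INT]) (use Union.IH in auto)
    ultimately show ?case unfolding eq by blast
  qed
  then show ?thesis by simp
qed

text \<open>A countable intersection of measurable supersets whose measures tend to their infimum
  attains it. If \<open>H - H'\<close> had positive measure, \<open>H \<inter> H'\<close> would be a
  superset of smaller measure.\<close>

lemma (in prob_space) measurable_hull:
  obtains H where "H \<in> sets M" "A \<inter> space M \<subseteq> H"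
    "\<And>H'. H' \<in> sets M \<Longrightarrow> A \<inter> space M \<subseteq> H' \<Longrightarrow> emeasure M (H - H') = 0"
proof -
  let ?C = "{H \<in> sets M. A \<inter> space M \<subseteq> H}"
  define c where "c = (INF H\<in>?C. emeasure M H)"
  have ne: "?C \<noteq> {}" by auto
  have "\<exists>f. (\<forall>n::nat. f n \<in> emeasure M ` ?C) \<and> decseq f \<and> c = (INF n. f n)"
    unfolding c_def using ennreal_Inf_countable_INF[of "emeasure M ` ?C"] ne by (auto simp: image_subset_iff)
  then obtain f where f: "\<And>n::nat. f n \<in> emeasure M ` ?C" "c = (INF n. f n)" by blast
  then obtain H where H: "\<And>n. H n \<in> ?C" "\<And>n. f n = emeasure M (H n)"
    by (auto simp: image_iff) (metis (no_types, lifting))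
  show thesis
  proof (rule that[of "\<Inter>n. H n"])
    show "(\<Inter>n. H n) \<in> sets M" "A \<inter> space M \<subseteq> (\<Inter>n. H n)" using H(1) by auto
    fix H' assume H': "H' \<in> sets M" "A \<inter> space M \<subseteq> H'"
    let ?I = "\<Inter>n. H n"
    have I: "?I \<in> sets M" "A \<inter> space M \<subseteq> ?I" using H(1) by auto
    have "emeasure M ?I \<le> c"
      unfolding f(2) H(2) using H(1) by (intro INF_greatest emeasure_mono) auto
    also have "c \<le> emeasure M (?I \<inter> H')"
      unfolding c_def using I H' by (intro INF_lower) auto
    finally have *: "emeasure M ?I \<le> emeasure M (?I \<inter> H')" .
    have "emeasure M (?I - H') = emeasure M ?I - emeasure M (?I \<inter> H')"
      using I H' by (subst emeasure_Diff[symmetric]) (auto intro!: arg_cong[where f="emeasure M"])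
    then show "emeasure M (?I - H') = 0" using * by (simp add: diff_eq_0_iff_ennreal less_top[symmetric])
  qed
qed

text \<open>Take a measurable hull \<open>H s\<close> of the part of the Souslin set coming from the branches through \<open>s\<close>. Off a null set
  every point of \<open>H s\<close> lies in \<open>H (s @ [k])\<close> for some \<open>k\<close>, which yields a branch.\<close>

lemma (in prob_space) souslin_sandwich:
  assumes R: "\<And>s. R s \<in> sets M"
  obtains L H where "L \<in> sets M" "H \<in> sets M" "L \<subseteq> souslin R" "souslin R \<subseteq> H" "H - L \<in> null_sets M"
proof -
  define S where "S s = {x. \<exists>\<sigma>. prefix_list \<sigma> (length s) = s \<and> (\<forall>n. x \<in> R (prefix_list \<sigma> n))}" for s
  have SR: "S s \<subseteq> R s" for s by (auto simp: S_def) metis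
  have SS: "S s = (\<Union>k. S (s @ [k]))" for s
  proof (intro equalityI subsetI)
    fix x assume "x \<in> S s"
    then obtain \<sigma> where "prefix_list \<sigma> (length s) = s" "\<forall>n. x \<in> R (prefix_list \<sigma> n)" by (auto simp: S_def)
    then have "x \<in> S (s @ [\<sigma> (length s)])"
      by (auto simp: S_def prefix_list_Suc intro!: exI[of _ \<sigma>])
    then show "x \<in> (\<Union>k. S (s @ [k]))" by blast
  qed (auto simp: S_def prefix_list_Suc)
  have "\<exists>H. H \<in> sets M \<and> S s \<subseteq> H \<and> H \<subseteq> R s \<and>
     (\<forall>H'\<in>sets M. S s \<subseteq> H' \<longrightarrow> emeasure M (H - H') = 0)" for s
  proof -
    have sp: "S s \<inter> space M = S s" using SR[of s] sets.sets_into_space[OF R] by blast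
    obtain H where H: "H \<in> sets M" "S s \<subseteq> H"
      "\<And>H'. H' \<in> sets M \<Longrightarrow> S s \<subseteq> H' \<Longrightarrow> emeasure M (H - H') = 0"
      using measurable_hull[of "S s"] unfolding sp by metis
    \<comment> \<open>Cutting the hull down to \<open>R s\<close> preserves its minimality and
      ensures that a branch through the hulls is a branch through \<open>R\<close>.\<close>
    have "emeasure M (H \<inter> R s - H') = 0" if "H' \<in> sets M" "S s \<subseteq> H'" for H'
      using H(3)[OF that] H(1) R that
      by (metis (no_types, lifting) Diff_mono emeasure_mono inf_le1 le_zero_eq order_refl sets.Diff)
    with H R SR[of s] show ?thesis by (intro exI[of _ "H \<inter> R s"]) auto
  qed
  then obtain H where H: "\<And>s. H s \<in> sets M" "\<And>s. S s \<subseteq> H s" "\<And>s. H s \<subseteq> R s"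
    "\<And>s H'. H' \<in> sets M \<Longrightarrow> S s \<subseteq> H' \<Longrightarrow> emeasure M (H s - H') = 0"
    by metis
  define Q where "Q = (\<Union>s. H s - (\<Union>k. H (s @ [k])))"
  have Q: "Q \<in> null_sets M"
    unfolding Q_def
  proof (rule null_sets_UN')
    fix s
    have "(\<Union>k. H (s @ [k])) \<in> sets M" using H(1) by auto
    moreover have "S s \<subseteq> (\<Union>k. H (s @ [k]))" by (subst SS) (use H(2) in blast)
    ultimately show "H s - (\<Union>k. H (s @ [k])) \<in> null_sets M"
      using H(1,4) by (auto simp: null_sets_def)
  qed auto
  have S0: "S [] = souslin R" by (auto simp: S_def souslin_def)
  have "H [] - Q \<subseteq> souslin R"
  proof
    fix x assume x: "x \<in> H [] - Q"
    have "\<exists>f. f 0 = ([]::nat list) \<and> (\<forall>n. x \<in> H (f n)) \<and> (\<forall>n. \<exists>k. f (Suc n) = f n @ [k])"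
    proof -
      have "\<exists>f. \<forall>n. (x \<in> H (f n) \<and> (n = 0 \<longrightarrow> f n = ([]::nat list))) \<and> (\<exists>k. f (Suc n) = f n @ [k])"
      proof (rule dependent_nat_choice)
        show "\<exists>s. x \<in> H s \<and> (0 = (0::nat) \<longrightarrow> s = [])" using x by auto
        fix s :: "nat list" and n :: nat
        assume "x \<in> H s \<and> (n = 0 \<longrightarrow> s = [])"
        then have "x \<in> (\<Union>k. H (s @ [k]))" using x unfolding Q_def by blast
        then show "\<exists>y. (x \<in> H y \<and> (Suc n = 0 \<longrightarrow> y = [])) \<and> (\<exists>k. y = s @ [k])" by auto
      qed
      then show ?thesis by metis
    qed
    then obtain f where f: "f 0 = []" "\<And>n. x \<in> H (f n)" and "\<forall>n. \<exists>k. f (Suc n) = f n @ [k]"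
      by blast
    then obtain k where k: "\<And>n. f (Suc n) = f n @ [k n]" by metis
    have "f n = prefix_list k n" for n by (induction n) (auto simp: f(1) k prefix_list_Suc)
    then have "\<forall>n. x \<in> R (prefix_list k n)" using f(2) H(3) by (metis subsetD)
    then show "x \<in> souslin R" by (auto simp: souslin_def)
  qed
  moreover have "H [] - (H [] - Q) \<in> null_sets M"
    using Q H(1) by (metis Diff_Diff_Int null_set_Int1 null_setsD2 null_set_Int2 inf_commute)
  ultimately show thesis
    using that[of "H [] - Q" "H []"] H(1,2) Q S0 by (metis null_setsD2 sets.Diff)
qed

section \<open>Analytic sets in a Polish probability space\<close>

locale polish_prob = prob_space M + Metric_space "space M" d for M :: "'a measure" and d +
  assumes complete: mcomplete
    and separable: "separable_space mtopology"
    and sets_eq: "sets M = sigma_sets (space M) {U. openin mtopology U}"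
begin

lemma open_sets: "openin mtopology U \<Longrightarrow> U \<in> sets M"
  unfolding sets_eq by (rule sigma_sets.Basic) simp

lemma closed_sets: "closedin mtopology C \<Longrightarrow> C \<in> sets M"
proof -
  assume C: "closedin mtopology C"
  then have "space M - (space M - C) \<in> sets M"
    by (intro sets.Diff sets.top open_sets) (simp add: closedin_def)
  then show "C \<in> sets M" using closedin_subset[OF C] by (simp add: double_diff)
qed

lemma dense_seq:
  obtains c :: "nat \<Rightarrow> 'a"
  where "\<And>n. c n \<in> space M" "\<And>x e. x \<in> space M \<Longrightarrow> 0 < e \<Longrightarrow> \<exists>n. d (c n) x < e"
proof -
  obtain C where C: "countable C" "C \<subseteq> space M" "mtopology closure_of C = space M"
    using separable by (auto simp: separable_space_def)
  have "C \<noteq> {}" using C(3) not_empty by auto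
  then have r: "range (from_nat_into C) = C" using C(1) by (rule range_from_nat_into)
  show thesis
  proof (rule that[of "from_nat_into C"])
    show "from_nat_into C n \<in> space M" for n using C(2) r by blast
    fix x e assume "x \<in> space M" "0 < (e::real)"
    then obtain y where "y \<in> C" "d x y < e" using C(3) unfolding metric_closure_of by auto
    then show "\<exists>n. d (from_nat_into C n) x < e" using r by (metis commute imageE)
  qed
qed

text \<open>The closed rectangles are the class to which \<open>sigma_sets_souslin\<close> is
  applied: they are stable under countable intersections, and their complements are countable unions
  of closed rectangles.\<close>

definition rects :: "('a \<times> 'a) set set" where
  "rects = {C \<times> D | C D. closedin mtopology C \<and> closedin mtopology D}"

lemma rects_top: "space M \<times> space M \<in> rects"
  unfolding rects_def using closedin_topspace[of mtopology] by auto

lemma rects_sub: "A \<in> rects \<Longrightarrow> A \<subseteq> space M \<times> space M"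
  unfolding rects_def using closedin_subset[of mtopology] by fastforce

lemma rects_INT: assumes "\<And>i::nat. C i \<in> rects" shows "(\<Inter>i. C i) \<in> rects"
proof -
  obtain A B where AB: "\<And>i. C i = A i \<times> B i" "\<And>i. closedin mtopology (A i)" "\<And>i. closedin mtopology (B i)"
    using assms unfolding rects_def mem_Collect_eq by metis
  have "(\<Inter>i. C i) = (\<Inter>i. A i) \<times> (\<Inter>i. B i)" by (auto simp: AB(1))
  moreover have "closedin mtopology (\<Inter>i. A i)" "closedin mtopology (\<Inter>i. B i)"
    using AB by (auto intro!: closedin_Inter)
  ultimately show ?thesis unfolding rects_def by blast
qed

lemma open_UN_closed:
  assumes "openin mtopology U"
  obtains C :: "nat \<Rightarrow> 'a set" where "\<And>n. closedin mtopology (C n)" "U = (\<Union>n. C n)"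
  using open_imp_fsigma_in[OF metrizable_space_mtopology assms] unfolding fsigma_in_ascending by blast

text \<open>A point leaves \<open>C \<times> D\<close> through one of its two coordinates, and open
  sets of a metric space are countable unions of closed sets. Even indices enumerate the first
  alternative, odd indices the second.\<close>

lemma rects_compl: assumes "A \<in> rects" shows "space M \<times> space M - A \<in> souslin_class rects"
proof -
  obtain C D where A: "A = C \<times> D" "closedin mtopology C" "closedin mtopology D"
    using assms unfolding rects_def by blast
  obtain C' where C': "\<And>n::nat. closedin mtopology (C' n)" "space M - C = (\<Union>n. C' n)"
    by (rule open_UN_closed[of "space M - C"]) (use A(2) in \<open>auto simp: closedin_def\<close>)
  obtain D' where D': "\<And>n::nat. closedin mtopology (D' n)" "space M - D = (\<Union>n. D' n)"
    by (rule open_UN_closed[of "space M - D"]) (use A(3) in \<open>auto simp: closedin_def\<close>)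
  define B where "B n = (if even n then C' (n div 2) \<times> space M else space M \<times> D' (n div 2))" for n
  have cl: "closedin mtopology (space M)" using closedin_topspace[of mtopology] by simp
  have "B n \<in> rects" for n unfolding B_def rects_def using C'(1) D'(1) cl by auto
  then have "(\<Union>n. B n) \<in> souslin_class rects"
    by (intro souslin_class_UN[OF rects_top rects_sub] souslin_class_base)
  moreover have "space M \<times> space M - A = (\<Union>n. B n)"
  proof
    show "space M \<times> space M - A \<subseteq> (\<Union>n. B n)"
    proof
      fix z assume z: "z \<in> space M \<times> space M - A"
      then have "fst z \<in> space M - C \<or> snd z \<in> space M - D" using A(1) by (cases z) auto
      then consider n where "fst z \<in> C' n" | n where "snd z \<in> D' n"
        unfolding C'(2) D'(2) by blast
      then show "z \<in> (\<Union>n. B n)"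
      proof cases
        case (1 n)
        then have "z \<in> B (2 * n)" using z by (cases z) (auto simp: B_def)
        then show ?thesis by blast
      next
        case (2 n)
        then have "z \<in> B (Suc (2 * n))" using z by (cases z) (auto simp: B_def)
        then show ?thesis by blast
      qed
    qed
    show "(\<Union>n. B n) \<subseteq> space M \<times> space M - A"
      using C'(2) D'(2) by (auto simp: B_def A(1) split: if_splits)
  qed
  ultimately show ?thesis by simp
qed

lemma sets_sigma_closed: "sets M = sigma_sets (space M) {C. closedin mtopology C}"
proof -
  have "sigma_sets (space M) {U. openin mtopology U} \<subseteq> sigma_sets (space M) {C. closedin mtopology C}"
  proof (rule sigma_sets_mono, safe)
    fix U assume U: "openin mtopology U"
    then have "space M - (space M - U) \<in> sigma_sets (space M) {C. closedin mtopology C}"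
      by (intro sigma_sets.Compl sigma_sets.Basic) (auto intro: openin_closedin_eq[THEN iffD1, THEN conjunct2])
    then show "U \<in> sigma_sets (space M) {C. closedin mtopology C}"
      using openin_subset[OF U] by (simp add: double_diff)
  qed
  moreover have "sigma_sets (space M) {C. closedin mtopology C} \<subseteq> sets M"
    by (rule sets.sigma_sets_subset) (auto intro: closed_sets)
  ultimately show ?thesis using sets_eq by blast
qed

lemma pair_sets_rects: "sets (M \<Otimes>\<^sub>M M) \<subseteq> sigma_sets (space M \<times> space M) rects"
proof -
  let ?S = "sigma_sets (space M \<times> space M) rects"
  have cl: "closedin mtopology (space M)" using closedin_topspace[of mtopology] by simp
  interpret S: sigma_algebra "space M \<times> space M" ?S
    by (rule sigma_algebra_sigma_sets) (use rects_sub in auto)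
  have 1: "a \<times> space M \<in> ?S" if "a \<in> sets M" for a
    using that unfolding sets_sigma_closed
  proof induction
    case (Basic a) then show ?case using cl by (intro sigma_sets.Basic) (auto simp: rects_def)
  next
    case (Compl a)
    have "(space M - a) \<times> space M = space M \<times> space M - a \<times> space M" by auto
    then show ?case using Compl by (simp add: S.compl_sets)
  next
    case (Union a)
    have "(\<Union>i. a i) \<times> space M = (\<Union>i. a i \<times> space M)" by auto
    then show ?case using Union S.countable_nat_UN[of "\<lambda>i. a i \<times> space M"] by auto
  qed (simp add: S.empty_sets)
  have 2: "space M \<times> a \<in> ?S" if "a \<in> sets M" for a
    using that unfolding sets_sigma_closed
  proof induction
    case (Basic a) then show ?case using cl by (intro sigma_sets.Basic) (auto simp: rects_def)
  next
    case (Compl a)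
    have "space M \<times> (space M - a) = space M \<times> space M - space M \<times> a" by auto
    then show ?case using Compl by (simp add: S.compl_sets)
  next
    case (Union a)
    have "space M \<times> (\<Union>i. a i) = (\<Union>i. space M \<times> a i)" by auto
    then show ?case using Union S.countable_nat_UN[of "\<lambda>i. space M \<times> a i"] by auto
  qed (simp add: S.empty_sets)
  have "a \<times> b \<in> ?S" if "a \<in> sets M" "b \<in> sets M" for a b
  proof -
    have "a \<times> b = (a \<times> space M) \<inter> (space M \<times> b)"
      using that sets.sets_into_space by blast
    then show ?thesis using 1[OF that(1)] 2[OF that(2)] by (simp add: S.Int)
  qed
  then show ?thesis
    unfolding sets_pair_measure by (intro S.sigma_sets_subset) auto
qed

text \<open>The diameters of the closed sets of a scheme may be assumed to tend to zero along every branch: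
  a branch additionally records, at each step, a small ball containing the point.\<close>

lemma regular_scheme:
  assumes "B \<in> sets (M \<Otimes>\<^sub>M M)"
  obtains R C D where
    "B = souslin R" "\<And>s. R s = C s \<times> D s"
    "\<And>s. closedin mtopology (C s)" "\<And>s. closedin mtopology (D s)"
    "\<And>s k. C (s @ [k]) \<subseteq> C s" "\<And>s k. D (s @ [k]) \<subseteq> D s"
    "\<And>s. s \<noteq> [] \<Longrightarrow> \<exists>a. C s \<subseteq> mcball a (1 / length s)"
    "\<And>s. s \<noteq> [] \<Longrightarrow> \<exists>a. D s \<subseteq> mcball a (1 / length s)"
proof -
  have "B \<in> souslin_class rects"
    using sigma_sets_souslin[OF rects_top rects_sub rects_INT rects_compl] pair_sets_rects assms by blast
  then obtain Q where Q: "B = souslin Q" "\<And>s. Q s \<in> rects" unfolding souslin_class_def by blast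
  then obtain QC QD where Q': "\<And>s. Q s = QC s \<times> QD s" "\<And>s. closedin mtopology (QC s)"
     "\<And>s. closedin mtopology (QD s)"
    unfolding rects_def mem_Collect_eq by metis
  obtain c where c: "\<And>n::nat. c n \<in> space M" "\<And>x e. x \<in> space M \<Longrightarrow> 0 < e \<Longrightarrow> \<exists>n. d (c n) x < e"
    by (rule dense_seq) blast
  \<comment> \<open>An entry of a new branch codes three numbers: the entry of the old branch, and
    the centre of a small ball for each of the two coordinates.\<close>
  define f g h where "f = fst \<circ> prod_decode" and "g = fst \<circ> prod_decode \<circ> snd \<circ> prod_decode"
    and "h = snd \<circ> prod_decode \<circ> snd \<circ> prod_decode"
  \<comment> \<open>Intersecting over all initial segments makes the sets decrease along every
    branch.\<close>
  define C where "C s = (\<Inter>m\<in>{..length s}. QC (take m (map f s))) \<inter>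
      (\<Inter>m\<in>{..<length s}. mcball (c (g (s ! m))) (1 / Suc m))" for s
  define D where "D s = (\<Inter>m\<in>{..length s}. QD (take m (map f s))) \<inter>
      (\<Inter>m\<in>{..<length s}. mcball (c (h (s ! m))) (1 / Suc m))" for s
  have Cball: "C s \<subseteq> mcball (c (g (s ! (length s - 1)))) (1 / length s)" if "s \<noteq> []" for s
  proof -
    have "C s \<subseteq> mcball (c (g (s ! (length s - 1)))) (1 / Suc (length s - 1))"
      unfolding C_def using that by (intro le_infI2 INF_lower) (auto simp del: of_nat_Suc)
    then show ?thesis using that by (simp del: of_nat_Suc)
  qed
  have Dball: "D s \<subseteq> mcball (c (h (s ! (length s - 1)))) (1 / length s)" if "s \<noteq> []" for s
  proof -
    have "D s \<subseteq> mcball (c (h (s ! (length s - 1)))) (1 / Suc (length s - 1))"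
      unfolding D_def using that by (intro le_infI2 INF_lower) (auto simp del: of_nat_Suc)
    then show ?thesis using that by (simp del: of_nat_Suc)
  qed
  have cl: "closedin mtopology ((\<Inter>m\<in>{..length s}. A m) \<inter> (\<Inter>m\<in>{..<length s}. B m))"
    if "\<And>m. closedin mtopology (A m)" "\<And>m. closedin mtopology (B m)" for A B and s :: "nat list"
  proof (cases "s = []")
    case False
    then show ?thesis using that by (intro closedin_Int closedin_Inter) (auto simp: lessThan_empty_iff)
  qed (use that in simp)
  have BQ: "B = souslin (\<lambda>s. C s \<times> D s)"
  proof (intro equalityI subsetI)
    fix z assume "z \<in> B"
    then obtain \<sigma> where \<sigma>: "\<And>n. z \<in> Q (prefix_list \<sigma> n)" by (auto simp: Q(1) souslin_def)
    obtain x y where z: "z = (x, y)" by fastforce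
    have xy: "x \<in> space M" "y \<in> space M"
      using rects_sub[OF Q(2)] \<sigma>[of 0] unfolding z by auto
    have "\<forall>m::nat. \<exists>i. d (c i) x < 1 / Suc m" "\<forall>m::nat. \<exists>i. d (c i) y < 1 / Suc m"
      using c(2) xy by auto
    then obtain p q where pq: "\<And>m::nat. d (c (p m)) x < 1 / Suc m" "\<And>m::nat. d (c (q m)) y < 1 / Suc m"
      by metis
    define \<tau> where "\<tau> m = prod_encode (\<sigma> m, prod_encode (p m, q m))" for m
    have \<tau>: "f \<circ> \<tau> = \<sigma>" "g (\<tau> m) = p m" "h (\<tau> m) = q m" for m
      by (auto simp: f_def g_def h_def \<tau>_def)
    have "z \<in> C (prefix_list \<tau> n) \<times> D (prefix_list \<tau> n)" for n
      using \<sigma> pq xy c(1) by (auto simp: C_def D_def \<tau> z Q'(1) less_imp_le simp del: of_nat_Suc)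
    then show "z \<in> souslin (\<lambda>s. C s \<times> D s)" by (auto simp: souslin_def)
  next
    fix z assume "z \<in> souslin (\<lambda>s. C s \<times> D s)"
    then obtain \<tau> where \<tau>: "\<And>n. z \<in> C (prefix_list \<tau> n) \<times> D (prefix_list \<tau> n)"
      by (auto simp: souslin_def)
    have "z \<in> Q (prefix_list (f \<circ> \<tau>) n)" for n
      using \<tau>[of n] by (auto simp: C_def D_def Q'(1) dest!: bspec[of _ _ n])
    then show "z \<in> B" by (auto simp: Q(1) souslin_def)
  qed
  have mono: "C (s @ [k]) \<subseteq> C s" "D (s @ [k]) \<subseteq> D s" for s k
  proof -
    have "take m (map f (s @ [k])) = take m (map f s)" if "m \<le> length s" for m using that by simp
    moreover have "(s @ [k]) ! m = s ! m" if "m < length s" for m using that by (simp add: nth_append)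
    ultimately show "C (s @ [k]) \<subseteq> C s" "D (s @ [k]) \<subseteq> D s"
      unfolding C_def D_def by (intro Int_mono INF_superset_mono; simp)+
  qed
  show thesis
  proof (rule that[OF BQ, of C D])
    show "closedin mtopology (C s)" "closedin mtopology (D s)" for s
      unfolding C_def D_def by (rule cl; simp add: Q')+
    show "\<exists>a. C s \<subseteq> mcball a (1 / length s)" "\<exists>a. D s \<subseteq> mcball a (1 / length s)" if "s \<noteq> []" for s
      using Cball[OF that] Dball[OF that] by blast+
  qed (use mono in auto)
qed

text \<open>Cantor's intersection theorem; here completeness of the metric enters.\<close>

lemma branch_point:
  assumes cl: "\<And>n. closedin mtopology (C n)" and dec: "\<And>n. C (Suc n) \<subseteq> C n" and ne: "\<And>n. C n \<noteq> {}"
    and b: "\<And>n. n \<noteq> 0 \<Longrightarrow> \<exists>a. C n \<subseteq> mcball a (1 / real n)"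
  shows "\<exists>x. \<forall>n. x \<in> C n"
proof -
  have "\<exists>n a. C n \<subseteq> mcball a e" if "0 < e" for e
  proof -
    obtain m where m: "inverse (real (Suc m)) < e" using reals_Archimedean[OF \<open>0 < e\<close>] by blast
    define n where "n = Suc m"
    have "n \<noteq> 0" "1 / real n < e" using m by (auto simp: n_def inverse_eq_divide simp del: of_nat_Suc)
    then show ?thesis using b[of n] mcball_subset_concentric[of "1 / real n" e] by (meson less_imp_le subset_trans)
  qed
  then have "\<Inter> (range C) \<noteq> {}"
    using complete[unfolded mcomplete_nest] cl ne decseq_SucI[of C, OF dec] by blast
  then show ?thesis by auto
qed

text \<open>Along a branch with nonempty second factors \<open>branch_point\<close> supplies a
  second coordinate. Hence projecting a scheme amounts to emptying the nodes whose second factor is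
  empty, and the projection is a Souslin set over closed sets.\<close>

lemma projection_sandwich:
  assumes "B \<in> sets (M \<Otimes>\<^sub>M M)"
  obtains L H where "L \<in> sets M" "H \<in> sets M" "L \<subseteq> fst ` B" "fst ` B \<subseteq> H" "H - L \<in> null_sets M"
proof -
  obtain R C D where R: "B = souslin R" "\<And>s. R s = C s \<times> D s"
    "\<And>s. closedin mtopology (C s)" "\<And>s. closedin mtopology (D s)"
    "\<And>s k. C (s @ [k]) \<subseteq> C s" "\<And>s k. D (s @ [k]) \<subseteq> D s"
    "\<And>s. s \<noteq> [] \<Longrightarrow> \<exists>a. D s \<subseteq> mcball a (1 / length s)"
    using regular_scheme[OF assms] by metis
  define C' where "C' s = (if D s = {} then {} else C s)" for s
  have "fst ` B = souslin C'"
  proof (intro equalityI subsetI)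
    fix x assume "x \<in> souslin C'"
    then obtain \<sigma> where \<sigma>: "\<And>n. x \<in> C' (prefix_list \<sigma> n)" by (auto simp: souslin_def)
    have "\<exists>y. \<forall>n. y \<in> D (prefix_list \<sigma> n)"
    proof (rule branch_point)
      show "D (prefix_list \<sigma> n) \<noteq> {}" for n using \<sigma>[of n] by (auto simp: C'_def split: if_splits)
      show "\<exists>a. D (prefix_list \<sigma> n) \<subseteq> mcball a (1 / real n)" if "n \<noteq> 0" for n
        using R(7)[of "prefix_list \<sigma> n"] that by (auto simp: prefix_list_def)
    qed (use R in \<open>auto simp: prefix_list_Suc\<close>)
    then obtain y where "\<And>n. y \<in> D (prefix_list \<sigma> n)" by blast
    moreover have "x \<in> C (prefix_list \<sigma> n)" for n using \<sigma>[of n] by (auto simp: C'_def split: if_splits)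
    ultimately have "(x, y) \<in> B" by (auto simp: R(1,2) souslin_def)
    then show "x \<in> fst ` B" by force
  next
    fix x assume "x \<in> fst ` B"
    then obtain y where "(x, y) \<in> B" by auto
    then obtain \<sigma> where "\<And>n. (x, y) \<in> C (prefix_list \<sigma> n) \<times> D (prefix_list \<sigma> n)"
      by (auto simp: R(1,2) souslin_def)
    then have "x \<in> C' (prefix_list \<sigma> n)" for n by (auto simp: C'_def)
    then show "x \<in> souslin C'" by (auto simp: souslin_def)
  qed
  moreover have "C' s \<in> sets M" for s using R(3) by (auto simp: C'_def closed_sets)
  ultimately show thesis using souslin_sandwich[of C'] that by metis
qed

text \<open>If the two projections could not be separated, some pair of children could not either,
  and so on along two branches. The branches end in points of \<open>A\<close> and \<open>B\<close>,
  whose first coordinates differ; once the diameters are small, the closed set \<open>C\<close>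
  around the first of them is a separating set after all.\<close>

lemma lusin_separation:
  assumes A: "A \<in> sets (M \<Otimes>\<^sub>M M)" and B: "B \<in> sets (M \<Otimes>\<^sub>M M)" and AB: "fst ` A \<inter> fst ` B = {}"
  shows "\<exists>W\<in>sets M. fst ` A \<subseteq> W \<and> W \<inter> fst ` B = {}"
proof (rule ccontr)
  assume neg: "\<not> ?thesis"
  define sep where "sep P Q \<longleftrightarrow> (\<exists>W\<in>sets M. P \<subseteq> W \<and> W \<inter> Q = {})" for P Q
  obtain R C D where R: "A = souslin R" "\<And>s. R s = C s \<times> D s"
    "\<And>s. closedin mtopology (C s)" "\<And>s. closedin mtopology (D s)"
    "\<And>s k. C (s @ [k]) \<subseteq> C s" "\<And>s k. D (s @ [k]) \<subseteq> D s"
    "\<And>s. s \<noteq> [] \<Longrightarrow> \<exists>a. C s \<subseteq> mcball a (1 / length s)"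
    "\<And>s. s \<noteq> [] \<Longrightarrow> \<exists>a. D s \<subseteq> mcball a (1 / length s)"
    using regular_scheme[OF A] by metis
  obtain R' C' D' where R': "B = souslin R'" "\<And>s. R' s = C' s \<times> D' s"
    "\<And>s. closedin mtopology (C' s)" "\<And>s. closedin mtopology (D' s)"
    "\<And>s k. C' (s @ [k]) \<subseteq> C' s" "\<And>s k. D' (s @ [k]) \<subseteq> D' s"
    "\<And>s. s \<noteq> [] \<Longrightarrow> \<exists>a. C' s \<subseteq> mcball a (1 / length s)"
    "\<And>s. s \<noteq> [] \<Longrightarrow> \<exists>a. D' s \<subseteq> mcball a (1 / length s)"
    using regular_scheme[OF B] by metis
  define P where "P s = {x. \<exists>y \<sigma>. prefix_list \<sigma> (length s) = s \<and> (\<forall>n. (x, y) \<in> R (prefix_list \<sigma> n))}" for s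
  define Q where "Q s = {x. \<exists>y \<sigma>. prefix_list \<sigma> (length s) = s \<and> (\<forall>n. (x, y) \<in> R' (prefix_list \<sigma> n))}" for s
  have PP: "P s = (\<Union>k. P (s @ [k]))" for s
  proof (intro equalityI subsetI)
    fix x assume "x \<in> P s"
    then obtain y \<sigma> where "prefix_list \<sigma> (length s) = s" "\<forall>n. (x, y) \<in> R (prefix_list \<sigma> n)" by (auto simp: P_def)
    then have "x \<in> P (s @ [\<sigma> (length s)])" unfolding P_def
      by (auto simp: prefix_list_Suc)
    then show "x \<in> (\<Union>k. P (s @ [k]))" by blast
  qed (auto simp: P_def prefix_list_Suc)
  have QQ: "Q s = (\<Union>k. Q (s @ [k]))" for s
  proof (intro equalityI subsetI)
    fix x assume "x \<in> Q s"
    then obtain y \<sigma> where "prefix_list \<sigma> (length s) = s" "\<forall>n. (x, y) \<in> R' (prefix_list \<sigma> n)" by (auto simp: Q_def)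
    then have "x \<in> Q (s @ [\<sigma> (length s)])" unfolding Q_def
      by (auto simp: prefix_list_Suc)
    then show "x \<in> (\<Union>k. Q (s @ [k]))" by blast
  qed (auto simp: Q_def prefix_list_Suc)
  have PR: "P s \<subseteq> C s" "P s \<noteq> {} \<Longrightarrow> D s \<noteq> {}" for s
    unfolding P_def R(2) by (auto, metis, metis emptyE)
  have QR: "Q s \<subseteq> C' s" "Q s \<noteq> {} \<Longrightarrow> D' s \<noteq> {}" for s
    unfolding Q_def R'(2) by (auto, metis, metis emptyE)
  have step: "\<exists>k l. \<not> sep (P (s @ [k])) (Q (t @ [l]))" if "\<not> sep (P s) (Q t)" for s t
  proof (rule ccontr)
    assume "\<nexists>k l. \<not> sep (P (s @ [k])) (Q (t @ [l]))"
    then have "\<forall>k l. \<exists>W. W \<in> sets M \<and> P (s @ [k]) \<subseteq> W \<and> W \<inter> Q (t @ [l]) = {}"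
      by (simp add: sep_def Bex_def conj_ac)
    then obtain W where W: "\<And>k l. W k l \<in> sets M" "\<And>k l. P (s @ [k]) \<subseteq> W k l"
      "\<And>k l. W k l \<inter> Q (t @ [l]) = {}" by metis
    \<comment> \<open>Separating sets for all pairs of children assemble into one for the
      parents.\<close>
    have "(\<Union>k. \<Inter>l. W k l) \<in> sets M" using W(1) by auto
    moreover have "P s \<subseteq> (\<Union>k. \<Inter>l. W k l)" by (subst PP) (use W(2) in blast)
    moreover have "(\<Union>k. \<Inter>l. W k l) \<inter> Q t = {}" by (subst QQ) (use W(3) in blast)
    ultimately show False using that unfolding sep_def by blast
  qed
  have P0: "P [] = fst ` A"
    by (auto simp: P_def R(1) souslin_def image_iff Bex_def) metis+
  have Q0: "Q [] = fst ` B"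
    by (auto simp: Q_def R'(1) souslin_def image_iff Bex_def) metis+
  have "\<exists>f. \<forall>n. (\<not> sep (P (fst (f n))) (Q (snd (f n))) \<and> (n = 0 \<longrightarrow> f n = ([]::nat list, []::nat list))) \<and>
     (\<exists>k l. f (Suc n) = (fst (f n) @ [k], snd (f n) @ [l]))"
  proof (rule dependent_nat_choice)
    show "\<exists>st. \<not> sep (P (fst st)) (Q (snd st)) \<and> (0 = (0::nat) \<longrightarrow> st = ([], []))"
      using neg P0 Q0 unfolding sep_def by (intro exI[of _ "([], [])"]) auto
    fix st :: "nat list \<times> nat list" and n :: nat
    assume "\<not> sep (P (fst st)) (Q (snd st)) \<and> (n = 0 \<longrightarrow> st = ([], []))"
    then obtain k l where "\<not> sep (P (fst st @ [k])) (Q (snd st @ [l]))" using step by blast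
    then show "\<exists>y. (\<not> sep (P (fst y)) (Q (snd y)) \<and> (Suc n = 0 \<longrightarrow> y = ([], []))) \<and>
        (\<exists>k l. y = (fst st @ [k], snd st @ [l]))"
      by (intro exI[of _ "(fst st @ [k], snd st @ [l])"]) auto
  qed
  then obtain f where f: "f 0 = ([], [])" "\<And>n. \<not> sep (P (fst (f n))) (Q (snd (f n)))"
    "\<forall>n. \<exists>k l. f (Suc n) = (fst (f n) @ [k], snd (f n) @ [l])" by blast
  then obtain \<sigma> \<tau> where \<sigma>\<tau>: "\<And>n. f (Suc n) = (fst (f n) @ [\<sigma> n], snd (f n) @ [\<tau> n])" by metis
  have fn: "f n = (prefix_list \<sigma> n, prefix_list \<tau> n)" for n
    by (induction n) (auto simp: f(1) \<sigma>\<tau> prefix_list_Suc)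
  have ns: "\<not> sep (P (prefix_list \<sigma> n)) (Q (prefix_list \<tau> n))" for n using f(2)[of n] by (simp add: fn)
  have ne: "P (prefix_list \<sigma> n) \<noteq> {}" "Q (prefix_list \<tau> n) \<noteq> {}" for n
  proof -
    have "sep {} (Q (prefix_list \<tau> n))" unfolding sep_def by blast
    then show "P (prefix_list \<sigma> n) \<noteq> {}" using ns[of n] by auto
    have "P (prefix_list \<sigma> n) \<subseteq> space M" using PR(1) R(3) closedin_subset[of mtopology] by (metis subset_trans topspace_mtopology)
    then have "sep (P (prefix_list \<sigma> n)) {}" unfolding sep_def by blast
    then show "Q (prefix_list \<tau> n) \<noteq> {}" using ns[of n] by auto
  qed
  have nonempty: "prefix_list \<rho> n \<noteq> []" if "n \<noteq> 0" for \<rho> n using that by (auto simp: prefix_list_def)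
  have "\<exists>x. \<forall>n. x \<in> C (prefix_list \<sigma> n)"
  proof (rule branch_point[of "\<lambda>n. C (prefix_list \<sigma> n)"])
    show "closedin mtopology (C (prefix_list \<sigma> n))" for n by (rule R(3))
    show "C (prefix_list \<sigma> (Suc n)) \<subseteq> C (prefix_list \<sigma> n)" for n
      unfolding prefix_list_Suc by (rule R(5))
    show "C (prefix_list \<sigma> n) \<noteq> {}" for n
      using ne(1)[of n] PR(1)[of "prefix_list \<sigma> n"] by blast
    show "\<exists>a. C (prefix_list \<sigma> n) \<subseteq> mcball a (1 / real n)" if "n \<noteq> 0" for n
      using R(7)[OF nonempty[OF that, of \<sigma>]] by simp
  qed
  then obtain x where x: "\<And>n. x \<in> C (prefix_list \<sigma> n)" by blast
  have "\<exists>x. \<forall>n. x \<in> D (prefix_list \<sigma> n)"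
  proof (rule branch_point[of "\<lambda>n. D (prefix_list \<sigma> n)"])
    show "closedin mtopology (D (prefix_list \<sigma> n))" for n by (rule R(4))
    show "D (prefix_list \<sigma> (Suc n)) \<subseteq> D (prefix_list \<sigma> n)" for n
      unfolding prefix_list_Suc by (rule R(6))
    show "D (prefix_list \<sigma> n) \<noteq> {}" for n
      using ne(1)[of n] PR(2)[of "prefix_list \<sigma> n"] by blast
    show "\<exists>a. D (prefix_list \<sigma> n) \<subseteq> mcball a (1 / real n)" if "n \<noteq> 0" for n
      using R(8)[OF nonempty[OF that, of \<sigma>]] by simp
  qed
  then obtain y where y: "\<And>n. y \<in> D (prefix_list \<sigma> n)" by blast
  have "\<exists>x. \<forall>n. x \<in> C' (prefix_list \<tau> n)"
  proof (rule branch_point[of "\<lambda>n. C' (prefix_list \<tau> n)"])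
    show "closedin mtopology (C' (prefix_list \<tau> n))" for n by (rule R'(3))
    show "C' (prefix_list \<tau> (Suc n)) \<subseteq> C' (prefix_list \<tau> n)" for n
      unfolding prefix_list_Suc by (rule R'(5))
    show "C' (prefix_list \<tau> n) \<noteq> {}" for n
      using ne(2)[of n] QR(1)[of "prefix_list \<tau> n"] by blast
    show "\<exists>a. C' (prefix_list \<tau> n) \<subseteq> mcball a (1 / real n)" if "n \<noteq> 0" for n
      using R'(7)[OF nonempty[OF that, of \<tau>]] by simp
  qed
  then obtain x' where x': "\<And>n. x' \<in> C' (prefix_list \<tau> n)" by blast
  have "\<exists>x. \<forall>n. x \<in> D' (prefix_list \<tau> n)"
  proof (rule branch_point[of "\<lambda>n. D' (prefix_list \<tau> n)"])
    show "closedin mtopology (D' (prefix_list \<tau> n))" for n by (rule R'(4))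
    show "D' (prefix_list \<tau> (Suc n)) \<subseteq> D' (prefix_list \<tau> n)" for n
      unfolding prefix_list_Suc by (rule R'(6))
    show "D' (prefix_list \<tau> n) \<noteq> {}" for n
      using ne(2)[of n] QR(2)[of "prefix_list \<tau> n"] by blast
    show "\<exists>a. D' (prefix_list \<tau> n) \<subseteq> mcball a (1 / real n)" if "n \<noteq> 0" for n
      using R'(8)[OF nonempty[OF that, of \<tau>]] by simp
  qed
  then obtain y' where y': "\<And>n. y' \<in> D' (prefix_list \<tau> n)" by blast
  have "\<forall>n. (x, y) \<in> R (prefix_list \<sigma> n)" "\<forall>n. (x', y') \<in> R' (prefix_list \<tau> n)"
    using x y x' y' R(2) R'(2) by auto
  then have "(x, y) \<in> A" "(x', y') \<in> B" unfolding R(1) R'(1) souslin_def by blast+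
  then have xx: "x \<noteq> x'" using AB by force
  have xM: "x \<in> space M" "x' \<in> space M"
    using x[of 0] x'[of 0] R(3) R'(3) closedin_subset[of mtopology] by (auto simp: subset_iff)
  \<comment> \<open>If the two balls of radius \<open>1 / n\<close> met, the path from
    \<open>x\<close> to \<open>x'\<close> through both centres and the common point would consist of
    four segments of length at most \<open>1 / n\<close>.\<close>
  then have "0 < d x x' / 4" using xx by simp
  then obtain m where m: "inverse (real (Suc m)) < d x x' / 4" using reals_Archimedean by blast
  define n where "n = Suc m"
  have n: "n \<noteq> 0" "1 / real n < d x x' / 4"
    using m by (auto simp: n_def inverse_eq_divide simp del: of_nat_Suc)
  obtain a where a: "C (prefix_list \<sigma> n) \<subseteq> mcball a (1 / n)"
    using R(7)[OF nonempty[OF n(1)]] by (auto simp: )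
  obtain b where b: "C' (prefix_list \<tau> n) \<subseteq> mcball b (1 / n)"
    using R'(7)[OF nonempty[OF n(1)]] by (auto simp: )
  have "C (prefix_list \<sigma> n) \<inter> C' (prefix_list \<tau> n) = {}"
  proof (rule ccontr)
    assume "C (prefix_list \<sigma> n) \<inter> C' (prefix_list \<tau> n) \<noteq> {}"
    then obtain w where w: "w \<in> mcball a (1/n)" "w \<in> mcball b (1/n)" using a b by blast
    have 1: "x \<in> mcball a (1/n)" "x' \<in> mcball b (1/n)" using x[of n] x'[of n] a b by blast+
    have "d x x' \<le> d x w + d w x'" "d x w \<le> d x a + d a w" "d w x' \<le> d w b + d b x'"
      using w 1 by (auto intro!: triangle)
    then show False using w 1 n(2) commute[of x a] commute[of w b] by auto
  qed
  then have "sep (P (prefix_list \<sigma> n)) (Q (prefix_list \<tau> n))"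
    unfolding sep_def using PR(1) QR(1) R(3) closed_sets by (intro bexI[of _ "C (prefix_list \<sigma> n)"]) blast+
  then show False using ns by blast
qed

text \<open>Ergodicity concerns Borel sets that are exactly invariant, whereas the saturation of a Borel set is only
  analytic; alternating saturation and Lusin separation produces invariant Borel sets.\<close>

lemma invariant_separation:
  assumes E: "equiv (space M) E" "E \<in> sets (M \<Otimes>\<^sub>M M)"
    and A: "A \<in> sets M" and B: "B \<in> sets M" and AB: "E `` A \<inter> B = {}"
  shows "\<exists>W\<in>sets M. E `` W = W \<and> A \<subseteq> W \<and> W \<inter> B = {}"
proof -
  have sat: "E \<inter> (space M \<times> W) \<in> sets (M \<Otimes>\<^sub>M M)" if "W \<in> sets M" for W
    using that E(2) by auto
  have sym: "(x, y) \<in> E \<longleftrightarrow> (y, x) \<in> E" for x y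
    using E(1) by (meson equivE symE)
  have tr: "(x, y) \<in> E \<Longrightarrow> (y, z) \<in> E \<Longrightarrow> (x, z) \<in> E" for x y z
    using E(1) by (meson equivE transE)
  have Esub: "E \<subseteq> space M \<times> space M" using sets.sets_into_space[OF E(2)] by (simp add: space_pair_measure)
  have proj: "E `` W = fst ` (E \<inter> (space M \<times> W))" if "W \<in> sets M" for W
  proof (intro equalityI subsetI)
    fix x assume "x \<in> E `` W"
    then obtain w where "w \<in> W" "(x, w) \<in> E" using sym by blast
    moreover have "x \<in> space M" using \<open>(x, w) \<in> E\<close> Esub by blast
    ultimately show "x \<in> fst ` (E \<inter> (space M \<times> W))" using sets.sets_into_space[OF that] Esub by force
  qed (use sym in auto)
  \<comment> \<open>The saturations of \<open>W\<close> and \<open>B\<close> are projections of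
    Borel sets, and they are disjoint since \<open>E\<close> is an equivalence relation. A Borel set
    that misses the saturation of \<open>B\<close> has a saturation that misses \<open>B\<close>, so
    the step can be repeated.\<close>
  have step: "\<exists>W'. (W' \<in> sets M \<and> E `` W' \<inter> B = {}) \<and> E `` W \<subseteq> W'"
    if W: "W \<in> sets M \<and> E `` W \<inter> B = {}" for W
  proof -
    have "E `` W \<inter> E `` B = {}"
    proof (rule ccontr)
      assume "E `` W \<inter> E `` B \<noteq> {}"
      then obtain w b z where "w \<in> W" "b \<in> B" "(w, z) \<in> E" "(b, z) \<in> E" by auto
      then have "(w, b) \<in> E" using sym tr by blast
      then show False using W \<open>w \<in> W\<close> \<open>b \<in> B\<close> by blast
    qed
    then obtain W' where W': "W' \<in> sets M" "E `` W \<subseteq> W'" "W' \<inter> E `` B = {}"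
      using lusin_separation[OF sat sat, of W B] W B by (metis proj)
    have "E `` W' \<inter> B = {}" using W'(3) sym by blast
    with W' show ?thesis by blast
  qed
  have "\<exists>f. \<forall>n. ((f n \<in> sets M \<and> E `` f n \<inter> B = {}) \<and> (n = 0 \<longrightarrow> f n = A)) \<and> E `` f n \<subseteq> f (Suc n)"
  proof (rule dependent_nat_choice)
    show "\<exists>W. (W \<in> sets M \<and> E `` W \<inter> B = {}) \<and> (0 = (0::nat) \<longrightarrow> W = A)" using A AB by auto
    fix W :: "'a set" and n :: nat assume "(W \<in> sets M \<and> E `` W \<inter> B = {}) \<and> (n = 0 \<longrightarrow> W = A)"
    then obtain W' where "(W' \<in> sets M \<and> E `` W' \<inter> B = {}) \<and> E `` W \<subseteq> W'" using step by meson
    then show "\<exists>W'. ((W' \<in> sets M \<and> E `` W' \<inter> B = {}) \<and> (Suc n = 0 \<longrightarrow> W' = A)) \<and> E `` W \<subseteq> W'" by auto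
  qed
  then obtain f where f: "\<And>n::nat. f n \<in> sets M" "\<And>n. E `` f n \<inter> B = {}" "f 0 = A"
    "\<And>n. E `` f n \<subseteq> f (Suc n)" by blast
  have fsub: "f n \<subseteq> E `` f n" for n
    using E(1) sets.sets_into_space[OF f(1)[of n]] unfolding equiv_def refl_on_def by blast
  have "E `` (\<Union>n. f n) = (\<Union>n. f n)"
  proof -
    have "E `` (\<Union>n. f n) = (\<Union>n. E `` f n)" by (simp add: Image_UN)
    moreover have "(\<Union>n. E `` f n) \<subseteq> (\<Union>n. f n)" using f(4) by blast
    moreover have "(\<Union>n. f n) \<subseteq> (\<Union>n. E `` f n)" using fsub by blast
    ultimately show ?thesis by simp
  qed
  moreover have "(\<Union>n. f n) \<inter> B = {}" using f(2) fsub by blast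
  ultimately show ?thesis using f(1,3) by (intro bexI[of _ "\<Union>n. f n"]) auto
qed

end

lemma standard_borel_polish:
  assumes "standard_borel M" "prob_space M"
  obtains d where "polish_prob M d"
proof -
  obtain T where T: "topspace T = space M" "completely_metrizable_space T" "separable_space T"
    "sets M = sigma_sets (space M) {U. openin T U}"
    using assms(1) by (auto simp: standard_borel_def)
  then obtain X d where X: "Metric_space X d" "Metric_space.mcomplete X d" "T = Metric_space.mtopology X d"
    unfolding completely_metrizable_space_def by blast
  interpret Metric_space X d by (rule X(1))
  have "X = space M" using T(1) X(3) by simp
  then show thesis
    using that[of d] assms(2) X T unfolding polish_prob_def polish_prob_axioms_def by auto
qed

section \<open>Finite Borel equivalence relations up to null sets\<close>

text \<open>Listing \<open>C\<close> by increasing values of \<open>\<phi>\<close> turns the rule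
  "next larger value, and from the largest back to the smallest" into addition of 1 modulo
  \<open>m\<close>. The list starts at the minimum, which will represent the class in the
  transversal.\<close>

lemma cyclic_successor:
  fixes \<phi> :: "'a \<Rightarrow> real"
  assumes C: "finite C" "C \<noteq> {}" "inj_on \<phi> C"
    and s: "\<And>x. x \<in> C \<Longrightarrow> s x = (if {y \<in> C. \<phi> x < \<phi> y} \<noteq> {} then arg_min_on \<phi> {y \<in> C. \<phi> x < \<phi> y}
      else arg_min_on \<phi> C)"
  shows "\<exists>e m. 0 < m \<and> bij_betw e {..<m} C \<and> (\<forall>i<m. s (e i) = e (Suc i mod m)) \<and>
    (\<forall>y\<in>C. \<phi> (e 0) \<le> \<phi> y)"
proof -
  define L m e where "L = sorted_list_of_set (\<phi> ` C)" and "m = length L"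
    and "e i = inv_into C \<phi> (L ! i)" for i
  have L: "set L = \<phi> ` C" "sorted_wrt (<) L" "distinct L"
    using C(1) by (auto simp: L_def strict_sorted_iff)
  have m0: "0 < m" using L(1) C(2) by (auto simp: m_def)
  have eC: "e i \<in> C" "\<phi> (e i) = L ! i" if "i < m" for i
    using that L(1) nth_mem[of i L] unfolding e_def m_def
    by (auto intro: inv_into_into f_inv_into_f)
  have mono: "\<phi> (e i) < \<phi> (e j) \<longleftrightarrow> i < j" if "i < m" "j < m" for i j
    using that eC sorted_wrt_nth_less[OF L(2), of i j] sorted_wrt_nth_less[OF L(2), of j i]
    by (cases i j rule: linorder_cases) (auto simp: m_def)
  have surj: "\<exists>i<m. e i = x" if "x \<in> C" for x
  proof -
    have "\<phi> x \<in> set L" using that L(1) by simp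
    then obtain i where "i < m" "L ! i = \<phi> x" by (auto simp: in_set_conv_nth m_def)
    then show ?thesis using C(3) that by (auto simp: e_def)
  qed
  have bij: "bij_betw e {..<m} C"
  proof (rule bij_betw_imageI)
    show "inj_on e {..<m}"
      by (rule inj_onI) (metis lessThan_iff less_irrefl linorder_cases mono)
    show "e ` {..<m} = C" using eC surj by (auto, metis image_eqI lessThan_iff)
  qed
  have am: "arg_min_on \<phi> S = e k"
    if "S \<subseteq> C" "k < m" "e k \<in> S" "\<And>j. j < m \<Longrightarrow> e j \<in> S \<Longrightarrow> k \<le> j" for S k
  proof -
    have fin: "finite S" "S \<noteq> {}" using that C(1) finite_subset by auto
    have a: "arg_min_on \<phi> S \<in> S" "\<not> (\<exists>x\<in>S. \<phi> x < \<phi> (arg_min_on \<phi> S))"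
      using arg_min_if_finite[OF fin, of \<phi>] by auto
    have "arg_min_on \<phi> S \<in> C" using a(1) that(1) by blast
    then obtain j where j: "j < m" "arg_min_on \<phi> S = e j" using surj[of "arg_min_on \<phi> S"] by auto
    then have "k \<le> j" using a(1) that(4) by auto
    moreover have "\<not> k < j" using a(2) that(2,3) j mono by auto
    ultimately show ?thesis using j by simp
  qed
  have step: "s (e i) = e (Suc i mod m)" if i: "i < m" for i
  proof (cases "Suc i < m")
    case True
    have "arg_min_on \<phi> {y \<in> C. \<phi> (e i) < \<phi> y} = e (Suc i)"
      by (rule am) (use True i eC mono in auto)
    moreover have "e (Suc i) \<in> {y \<in> C. \<phi> (e i) < \<phi> y}" using True i eC mono by auto
    ultimately show ?thesis using s[OF eC(1)[OF i]] True by auto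
  next
    case False
    then have mi: "m = Suc i" using i by simp
    have "{y \<in> C. \<phi> (e i) < \<phi> y} = {}"
    proof -
      have "\<not> \<phi> (e i) < \<phi> y" if "y \<in> C" for y
        using surj[OF that] mono[OF i] mi by (metis less_Suc_eq_le not_le)
      then show ?thesis by blast
    qed
    moreover have "arg_min_on \<phi> C = e 0" by (rule am) (use m0 eC in auto)
    ultimately show ?thesis using s[OF eC(1)[OF i]] mi by simp
  qed
  have "\<phi> (e 0) \<le> \<phi> y" if "y \<in> C" for y
    using surj[OF that] mono[OF _ m0] by (metis not_le not_less0)
  then show ?thesis using m0 bij step by blast
qed

text \<open>HOL-Algebra claims the notation \<open>inv\<close> for inverses in a group.\<close>

abbreviation inv_fun :: "('a \<Rightarrow> 'b) \<Rightarrow> 'b \<Rightarrow> 'a" where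
  "inv_fun f \<equiv> inv_into UNIV f"

text \<open>The representatives are bijections of the whole type which fix the points outside the space.\<close>

definition full_auts :: "'a measure \<Rightarrow> 'a rel \<Rightarrow> ('a \<Rightarrow> 'a) set" where
  "full_auts M E = {f. bij f \<and> f \<in> measurable M M \<and> inv_fun f \<in> measurable M M \<and>
     (\<forall>x\<in>space M. (x, f x) \<in> E) \<and> (\<forall>x. x \<notin> space M \<longrightarrow> f x = x)}"

lemma sets_pair_restrict_subset:
  assumes "X \<in> sets M"
  shows "sets (restrict_space M X \<Otimes>\<^sub>M restrict_space M X) \<subseteq> sets (M \<Otimes>\<^sub>M M)"
proof
  have sp: "space (restrict_space M X) = X"
    using sets.sets_into_space[OF assms] by (auto simp: space_restrict_space)
  fix F assume "F \<in> sets (restrict_space M X \<Otimes>\<^sub>M restrict_space M X)"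
  then have "F \<in> sigma_sets (X \<times> X) {a \<times> b |a b. a \<in> sets (restrict_space M X) \<and> b \<in> sets (restrict_space M X)}"
    by (simp add: sets_pair_measure sp)
  then show "F \<in> sets (M \<Otimes>\<^sub>M M)"
  proof induction
    case (Basic a)
    moreover have "sets (restrict_space M X) \<subseteq> sets M" using assms by (auto simp: sets_restrict_space_iff)
    ultimately show ?case by auto
  next
    case (Compl a)
    then show ?case using assms by (intro sets.Diff pair_measureI) auto
  qed auto
qed

section \<open>Measurable linear order, sets of prescribed measure, sections\<close>

context polish_prob
begin

lemma std: "standard_borel M"
  unfolding standard_borel_def
  using complete separable sets_eq
  by (intro exI[of _ mtopology]) (auto simp: completely_metrizable_space_def intro: Metric_space_axioms)

text \<open>The membership pattern of a point in a countable base is read as a ternary expansion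
  with digits 0 and 1. In base 3 the digit at the first difference outweighs all later ones, whose
  sum is at most half of it; this gives injectivity. The full geometric sum 3/2 is rounded up to
  2.\<close>

lemma real_injection:
  obtains \<phi> :: "'a \<Rightarrow> real" and V :: "nat \<Rightarrow> 'a set" where
    "\<phi> \<in> borel_measurable M" "\<And>x. 0 \<le> \<phi> x" "\<And>x. \<phi> x \<le> 2" "inj_on \<phi> (space M)"
    "\<And>n. V n \<in> sets M" "sets M = sigma_sets (space M) (range V)"
proof -
  obtain c where c: "\<And>n::nat. c n \<in> space M" "\<And>x e. x \<in> space M \<Longrightarrow> 0 < e \<Longrightarrow> \<exists>n. d (c n) x < e"
    by (rule dense_seq) blast
  define V where "V n = mball (c (fst (prod_decode n))) (1 / Suc (snd (prod_decode n)))" for n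
  have near: "\<exists>n. x \<in> V n \<and> V n \<subseteq> mball x e" if x: "x \<in> space M" "0 < e" for x e
  proof -
    obtain m where m: "inverse (real (Suc m)) < e / 2" using reals_Archimedean[of "e/2"] x by auto
    obtain i where i: "d (c i) x < 1 / Suc m" using c(2)[OF x(1), of "1 / Suc m"] by auto
    have V: "V (prod_encode (i, m)) = mball (c i) (1 / Suc m)" by (simp add: V_def)
    have "mball (c i) (1 / Suc m) \<subseteq> mball x e"
    proof
      fix y assume y: "y \<in> mball (c i) (1 / Suc m)"
      have "d x y \<le> d x (c i) + d (c i) y" using x y c(1) by (intro triangle) auto
      also have "\<dots> < e" using i y m commute[of x "c i"] by (simp add: inverse_eq_divide)
      finally show "y \<in> mball x e" using x y by auto
    qed
    then show ?thesis using V i x c(1) by (intro exI[of _ "prod_encode (i, m)"]) (auto simp del: of_nat_Suc)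
  qed
  have V: "V n \<in> sets M" for n unfolding V_def by (rule open_sets) auto
  have "sigma_sets (space M) {U. openin mtopology U} \<subseteq> sigma_sets (space M) (range V)"
  proof (rule sigma_sets_mono, safe)
    fix U assume U: "openin mtopology U"
    define I where "I = {n. V n \<subseteq> U}"
    have "U = (\<Union>n\<in>I. V n)"
    proof (intro equalityI subsetI)
      fix x assume x: "x \<in> U"
      then obtain e where "0 < e" "mball x e \<subseteq> U" using U unfolding openin_mtopology by blast
      moreover have "x \<in> space M" using U x unfolding openin_mtopology by blast
      ultimately show "x \<in> (\<Union>n\<in>I. V n)" using near[of x e] unfolding I_def by blast
    qed (auto simp: I_def)
    moreover have "(\<Union>n\<in>I. V n) \<in> sigma_sets (space M) (range V)"
    proof (cases "I = {}")
      case False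
      then show ?thesis
        by (intro sigma_sets_UNION) (auto intro: countable_subset[of _ "range V"])
    qed (simp add: sigma_sets.Empty)
    ultimately show "U \<in> sigma_sets (space M) (range V)" by simp
  qed
  moreover have "sigma_sets (space M) (range V) \<subseteq> sets M"
    by (rule sets.sigma_sets_subset) (use V in auto)
  ultimately have sV: "sets M = sigma_sets (space M) (range V)" using sets_eq by blast
  define g where "g x n = indicator (V n) x * (1/3::real) ^ n" for x n
  define \<phi> where "\<phi> x = (\<Sum>n. g x n)" for x
  have geo: "summable (\<lambda>n. (1/3::real) ^ n)" "(\<Sum>n. (1/3::real) ^ n) = 3/2"
    by (simp_all add: suminf_geometric)
  have g01: "0 \<le> g x n" "g x n \<le> (1/3) ^ n" for x n by (auto simp: g_def indicator_def)
  have sm: "summable (g x)" for x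
    by (rule summable_comparison_test'[OF geo(1), of 0]) (use g01 in auto)
  have "0 \<le> \<phi> x" for x unfolding \<phi>_def by (rule suminf_nonneg[OF sm g01(1)])
  moreover have "\<phi> x \<le> 2" for x
    unfolding \<phi>_def using suminf_le[OF g01(2) sm geo(1), of x] geo(2) by simp
  moreover have "\<phi> \<in> borel_measurable M"
    unfolding \<phi>_def g_def using V by measurable
  moreover have lt: "\<phi> y < \<phi> x" if n: "x \<in> V n" "y \<notin> V n" "\<And>m. m < n \<Longrightarrow> x \<in> V m \<longleftrightarrow> y \<in> V m" for x y n
  proof -
    have split: "\<phi> z = (\<Sum>k. g z (k + Suc n)) + g z n + sum (g z) {..<n}" for z
      unfolding \<phi>_def using suminf_split_initial_segment[OF sm, of z "Suc n"] by simp
    have "sum (g x) {..<n} = sum (g y) {..<n}"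
      by (rule sum.cong) (use n(3) in \<open>auto simp: g_def indicator_def\<close>)
    moreover have "g x n = (1/3) ^ n" "g y n = 0" using n by (auto simp: g_def)
    moreover have "(\<Sum>k. g y (k + Suc n)) \<le> (\<Sum>k. (1/3) ^ Suc n * (1/3::real) ^ k)"
    proof (rule suminf_le)
      show "g y (k + Suc n) \<le> (1/3) ^ Suc n * (1/3) ^ k" for k
        using g01(2)[of y "k + Suc n"] by (simp add: power_add mult.commute)
      show "summable (\<lambda>k. g y (k + Suc n))" using sm summable_iff_shift[of "g y" "Suc n"] by auto
    qed (intro summable_mult geo)
    moreover have "(\<Sum>k. (1/3) ^ Suc n * (1/3::real) ^ k) = (1/3) ^ n / 2"
      by (subst suminf_mult[OF geo(1)]) (simp add: geo(2))
    moreover have "0 \<le> (\<Sum>k. g x (k + Suc n))"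
      by (rule suminf_nonneg) (use g01(1) sm summable_iff_shift[of "g x" "Suc n"] in auto)
    moreover have "0 < (1/3::real) ^ n" by simp
    ultimately show ?thesis unfolding split[of x] split[of y] by linarith
  qed
  moreover have "inj_on \<phi> (space M)"
  proof (rule inj_onI, rule ccontr)
    fix x y assume xy: "x \<in> space M" "y \<in> space M" "\<phi> x = \<phi> y" "x \<noteq> y"
    then have "0 < d x y" by simp
    then obtain n0 where "x \<in> V n0" "V n0 \<subseteq> mball x (d x y)" using near xy(1) by blast
    then have ex: "\<exists>n. (x \<in> V n) \<noteq> (y \<in> V n)" by auto
    define n where "n = (LEAST n. (x \<in> V n) \<noteq> (y \<in> V n))"
    have n: "(x \<in> V n) \<noteq> (y \<in> V n)" unfolding n_def by (rule LeastI_ex[OF ex])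
    have nm: "x \<in> V m \<longleftrightarrow> y \<in> V m" if "m < n" for m using not_less_Least[of m] that unfolding n_def by blast
    show False using lt[of x n y] lt[of y n x] n nm xy(3) by auto
  qed
  ultimately show thesis using that[of \<phi> V] V sV by blast
qed

text \<open>The measure on \<open>A\<close> is moved to the line by an injective
  \<open>\<phi>\<close>. A point mass of the image would sit on a single point of \<open>A\<close>,
  which non-atomicity excludes, so the distribution function is continuous and the intermediate
  value theorem gives a cut \<open>\<phi> x \<le> q\<close>.\<close>

lemma nonatomic_cut:
  assumes na: "non_atomic M" and A: "A \<in> sets M" and c: "0 \<le> c" "c \<le> measure M A"
  shows "\<exists>C\<in>sets M. C \<subseteq> A \<and> measure M C = c"
proof -
  obtain \<phi> :: "'a \<Rightarrow> real" where \<phi>[measurable]: "\<phi> \<in> borel_measurable M" and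
    b: "\<And>x. 0 \<le> \<phi> x" "\<And>x. \<phi> x \<le> 2" and inj: "inj_on \<phi> (space M)"
    by (rule real_injection) blast
  note A[measurable]
  define R where "R = restrict_space M A"
  have AM: "A \<subseteq> space M" by (rule sets.sets_into_space[OF A])
  have sR: "space R = A" using AM by (auto simp: R_def space_restrict_space)
  have \<phi>R[measurable]: "\<phi> \<in> borel_measurable R" unfolding R_def by (rule measurable_restrict_space1[OF \<phi>])
  have fR: "finite_measure R" unfolding R_def by (rule finite_measure_restrict_space[OF finite_measure_axioms]) (use A in auto)
  define N where "N = distr R borel \<phi>"
  interpret N: finite_borel_measure N
    unfolding N_def finite_borel_measure_def finite_borel_measure_axioms_def
    using finite_measure.finite_measure_distr[OF fR \<phi>R] by simp
  have mN: "measure N S = measure M {x \<in> A. \<phi> x \<in> S}" if "S \<in> sets borel" for S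
  proof -
    have "measure N S = measure R (\<phi> -` S \<inter> space R)" unfolding N_def by (rule measure_distr) (use that in auto)
    also have "\<phi> -` S \<inter> space R = {x \<in> A. \<phi> x \<in> S}" using sR by auto
    also have "measure R \<dots> = measure M \<dots>" unfolding R_def
      by (rule measure_restrict_space) (use A AM in auto)
    finally show ?thesis .
  qed
  have cont: "isCont (cdf N) q" for q
    unfolding N.isCont_cdf
  proof -
    let ?S = "{x \<in> A. \<phi> x \<in> {q}}"
    have S: "?S \<in> sets M" using AM A by measurable
    have "emeasure M ?S = 0"
    proof (rule ccontr)
      assume "emeasure M ?S \<noteq> 0"
      then obtain B where B: "B \<in> sets M" "B \<subseteq> ?S" "0 < emeasure M B" "emeasure M B < emeasure M ?S"
        using na[unfolded non_atomic_def, rule_format, OF S] by (auto simp: zero_less_iff_neq_zero)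
      have "x = y" if "x \<in> ?S" "y \<in> ?S" for x y using that AM inj by (auto simp: inj_on_def)
      then have "B = {} \<or> B = ?S" using B(2) by blast
      then show False using B by auto
    qed
    moreover have "measure N {q} = measure M ?S" by (rule mN) simp
    ultimately show "measure N {q} = 0" by (simp add: measure_def)
  qed
  have "\<not> \<phi> x \<le> -1" for x using b(1)[of x] by linarith
  then have "cdf N (-1) = 0" unfolding cdf_def by (subst mN) auto
  moreover have "cdf N 2 = measure M A" unfolding cdf_def using b(2) by (subst mN) auto
  ultimately obtain q where "cdf N q = c"
    using IVT[of "cdf N" "-1" c 2] c cont by auto
  then have "measure M {x \<in> A. \<phi> x \<in> {..q}} = c" unfolding cdf_def by (subst (asm) mN) auto
  moreover have "{x \<in> A. \<phi> x \<in> {..q}} \<in> sets M" using AM A by measurable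
  ultimately show ?thesis by (intro bexI[of _ "{x \<in> A. \<phi> x \<in> {..q}}"]) auto
qed

text \<open>Removing a null set on which a projection fails to be measurable changes the projection, so the removal is
  iterated. The limit behaves well because a decreasing sequence of nonempty finite sections has nonempty
  intersection.\<close>

lemma finite_section_null_set:
  fixes U :: "nat \<Rightarrow> 'a set" and H :: "nat \<Rightarrow> ('a \<times> 'a) set"
  assumes U: "\<And>i. U i \<in> sets M" and H: "\<And>n. H n \<in> sets (M \<Otimes>\<^sub>M M)"
    and fin: "\<And>n x. finite (H n `` {x})" and N0: "N0 \<in> null_sets M"
  shows "\<exists>N\<in>null_sets M. N0 \<subseteq> N \<and> (\<forall>n i. {x \<in> space M - N. \<exists>y\<in>U i - N. (x, y) \<in> H n} \<in> sets M)"
proof -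
  have step: "\<exists>N'. N' \<in> null_sets M \<and> N \<subseteq> N' \<and> (\<forall>n i. {x \<in> space M - N'. \<exists>y\<in>U i - N. (x, y) \<in> H n} \<in> sets M)"
    if N: "N \<in> null_sets M" for N
  proof -
    define B where "B n i = H n \<inter> (space M \<times> (U i - N))" for n i
    have B: "B n i \<in> sets (M \<Otimes>\<^sub>M M)" for n i
      unfolding B_def using H U null_setsD2[OF N] by auto
    have "\<exists>L K. L \<in> sets M \<and> K \<in> sets M \<and> L \<subseteq> fst ` B n i \<and> fst ` B n i \<subseteq> K \<and> K - L \<in> null_sets M" for n i
      using projection_sandwich[OF B[of n i]] by metis
    then obtain L K where LK: "\<And>n i. L n i \<in> sets M" "\<And>n i. K n i \<in> sets M" "\<And>n i. L n i \<subseteq> fst ` B n i"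
      "\<And>n i. fst ` B n i \<subseteq> K n i" "\<And>n i. K n i - L n i \<in> null_sets M" by metis
    \<comment> \<open>Off the differences of the upper and lower bounds, the projection coincides
      with the measurable \<open>L n i\<close>.\<close>
    define N' where "N' = N \<union> (\<Union>n. \<Union>i. K n i - L n i)"
    have N': "N' \<in> null_sets M" unfolding N'_def by (intro null_sets.Un null_sets_UN N LK)
    have "{x \<in> space M - N'. \<exists>y\<in>U i - N. (x, y) \<in> H n} = L n i - N'" for n i
    proof -
      have "{x \<in> space M - N'. \<exists>y\<in>U i - N. (x, y) \<in> H n} = fst ` B n i - N'"
        unfolding B_def by force
      also have "\<dots> = L n i - N'" using LK(3)[of n i] LK(4)[of n i] unfolding N'_def by blast
      finally show ?thesis .
    qed
    then show ?thesis using N' LK(1) null_setsD2[OF N'] unfolding N'_def by (intro exI[of _ N']) (auto simp: N'_def)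
  qed
  have "\<exists>f. \<forall>k. (f k \<in> null_sets M \<and> (k = 0 \<longrightarrow> f k = N0)) \<and>
     (f k \<subseteq> f (Suc k) \<and> (\<forall>n i. {x \<in> space M - f (Suc k). \<exists>y\<in>U i - f k. (x, y) \<in> H n} \<in> sets M))"
  proof (rule dependent_nat_choice)
    show "\<exists>x. x \<in> null_sets M \<and> (0 = (0::nat) \<longrightarrow> x = N0)" using N0 by auto
    fix N :: "'a set" and k :: nat assume "N \<in> null_sets M \<and> (k = 0 \<longrightarrow> N = N0)"
    then show "\<exists>y. (y \<in> null_sets M \<and> (Suc k = 0 \<longrightarrow> y = N0)) \<and>
       (N \<subseteq> y \<and> (\<forall>n i. {x \<in> space M - y. \<exists>ya\<in>U i - N. (x, ya) \<in> H n} \<in> sets M))"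
      using step[of N] by auto
  qed
  then obtain f where f': "\<forall>k. (f k \<in> null_sets M \<and> (k = 0 \<longrightarrow> f k = N0)) \<and>
     (f k \<subseteq> f (Suc k) \<and> (\<forall>n i. {x \<in> space M - f (Suc k). \<exists>y\<in>U i - f k. (x, y) \<in> H n} \<in> sets M))"
    by (rule exE)
  then have f: "f k \<in> null_sets M" "f 0 = N0" "f k \<subseteq> f (Suc k)"
    "{x \<in> space M - f (Suc k). \<exists>y\<in>U i - f k. (x, y) \<in> H n} \<in> sets M" for k n i
    by simp_all
  have mono: "f j \<subseteq> f k" if "j \<le> k" for j k using lift_Suc_mono_le[of f, OF f(3) that] .
  define N where "N = (\<Union>k. f k)"
  have N: "N \<in> null_sets M" unfolding N_def using f(1) by auto
  have "{x \<in> space M - N. \<exists>y\<in>U i - N. (x, y) \<in> H n} =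
      (\<Inter>k. {x \<in> space M - f (Suc k). \<exists>y\<in>U i - f k. (x, y) \<in> H n}) - N" for n i
  proof (intro equalityI subsetI)
    fix x assume x: "x \<in> (\<Inter>k. {x \<in> space M - f (Suc k). \<exists>y\<in>U i - f k. (x, y) \<in> H n}) - N"
    then have "\<forall>k. \<exists>y. y \<in> U i - f k \<and> (x, y) \<in> H n" by blast
    then obtain y where y: "\<And>k. y k \<in> U i - f k" "\<And>k. (x, y k) \<in> H n" by metis
    have "range y \<subseteq> H n `` {x}" using y(2) by auto
    then have "finite (range y)" using fin finite_subset by blast
    then obtain k0 where k0: "infinite {k. y k = y k0}" using pigeonhole_infinite[of "UNIV::nat set" y] by auto
    have "y k0 \<notin> f j" for j
    proof -
      obtain k where "j \<le> k" "y k = y k0" using k0 by (metis (mono_tags) infinite_nat_iff_unbounded_le mem_Collect_eq)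
      then show ?thesis using y(1)[of k] mono by auto
    qed
    then show "x \<in> {x \<in> space M - N. \<exists>y\<in>U i - N. (x, y) \<in> H n}" using x y[of k0] by (auto simp: N_def)
  next
    fix x assume "x \<in> {x \<in> space M - N. \<exists>y\<in>U i - N. (x, y) \<in> H n}"
    then show "x \<in> (\<Inter>k. {x \<in> space M - f (Suc k). \<exists>y\<in>U i - f k. (x, y) \<in> H n}) - N"
      unfolding N_def by blast
  qed
  moreover have "(\<Inter>k. {x \<in> space M - f (Suc k). \<exists>y\<in>U i - f k. (x, y) \<in> H n}) - N \<in> sets M" for n i
    using f(4) null_setsD2[OF N] by auto
  ultimately have "\<forall>n i. {x \<in> space M - N. \<exists>y\<in>U i - N. (x, y) \<in> H n} \<in> sets M" by simp
  then show ?thesis using N f(2) unfolding N_def by (intro bexI[of _ "\<Union>k. f k"]) auto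
qed

end

section \<open>Cyclic permutations and transversals of the finite relations\<close>

locale hyperfinite_setting = polish_prob M d for M :: "'a measure" and d +
  fixes E :: "'a rel"
  assumes na: "non_atomic M" and bE: "borel_equiv M E" and mpE: "measure_preserving_rel M E"
    and ergE: "ergodic_rel M E" and hypE: "hyperfinite_rel M E"
begin

lemma E_equiv: "equiv (space M) E" and E_sets: "E \<in> sets (M \<Otimes>\<^sub>M M)"
  using bE by (auto simp: borel_equiv_def)

lemma E_refl: "x \<in> space M \<Longrightarrow> (x, x) \<in> E"
  using E_equiv by (meson equivE refl_onD)

lemma E_sym: "(x, y) \<in> E \<Longrightarrow> (y, x) \<in> E"
  using E_equiv by (meson equivE symE)

lemma E_trans: "(x, y) \<in> E \<Longrightarrow> (y, z) \<in> E \<Longrightarrow> (x, z) \<in> E"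
  using E_equiv by (meson equivE transE)

text \<open>\<open>\<sigma> n\<close> permutes every class of the \<open>n\<close>-th finite relation cyclically, and \<open>Y n\<close> is a transversal, consisting of
  the minima of the classes with respect to a measurable linear order.\<close>

lemma hyperfinite_structure:
  obtains N :: "'a set" and \<sigma> :: "nat \<Rightarrow> 'a \<Rightarrow> 'a" and Y :: "nat \<Rightarrow> 'a set" where
    "N \<in> null_sets M" "\<And>n. \<sigma> n \<in> full_auts M E" "\<And>n. Y n \<in> sets M"
    "\<And>n a b y y'. y \<in> Y n \<Longrightarrow> y' \<in> Y n \<Longrightarrow> (\<sigma> n ^^ a) y = (\<sigma> n ^^ b) y' \<Longrightarrow> y = y'"
    "\<And>x w. x \<in> space M - N \<Longrightarrow> w \<in> space M - N \<Longrightarrow> (x, w) \<in> E \<Longrightarrow>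
       \<exists>n0. \<forall>n\<ge>n0. \<exists>y\<in>Y n. \<exists>a b. x = (\<sigma> n ^^ a) y \<and> w = (\<sigma> n ^^ b) y"
proof -
  obtain N0 where N0: "N0 \<in> null_sets M" and hf:
    "hyperfinite_everywhere (restrict_space M (space M - N0)) (Restr E (space M - N0))"
    using hypE unfolding hyperfinite_rel_def by blast
  from hf[unfolded hyperfinite_everywhere_def] obtain F :: "nat \<Rightarrow> 'a rel" where
    F: "(\<forall>n. borel_equiv (restrict_space M (space M - N0)) (F n) \<and>
         (\<forall>x\<in>space (restrict_space M (space M - N0)). finite (F n `` {x}))) \<and>
       incseq F \<and> Restr E (space M - N0) = (\<Union>n. F n)"
    by (rule exE)
  have F1: "borel_equiv (restrict_space M (space M - N0)) (F n)"
    and F2: "x \<in> space (restrict_space M (space M - N0)) \<Longrightarrow> finite (F n `` {x})"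
    and F3: "incseq F" "Restr E (space M - N0) = (\<Union>n. F n)" for n x
    using F by simp_all
  have sp: "space (restrict_space M (space M - N0)) = space M - N0" by (auto simp: space_restrict_space)
  have Feq: "equiv (space M - N0) (F n)" for n using F1[of n] by (simp add: borel_equiv_def sp)
  have F0: "space M - N0 \<in> sets M" using null_setsD2[OF N0] by auto
  have Fm: "F n \<in> sets (M \<Otimes>\<^sub>M M)" for n
    using F1[of n] sets_pair_restrict_subset[OF F0] by (auto simp: borel_equiv_def)
  have Fsub: "F n \<subseteq> (space M - N0) \<times> (space M - N0)" for n using F3(2) by auto
  have Ffin: "finite (F n `` {x})" for n x
  proof (cases "x \<in> space M - N0")
    case False
    then have "F n `` {x} = {}" using Fsub[of n] by auto
    then show ?thesis by simp
  qed (use F2 sp in auto)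
  obtain \<phi> :: "'a \<Rightarrow> real" and V :: "nat \<Rightarrow> 'a set" where \<phi>[measurable]: "\<phi> \<in> borel_measurable M" and
    \<phi>b: "\<And>x. 0 \<le> \<phi> x" "\<And>x. \<phi> x \<le> 2" and inj: "inj_on \<phi> (space M)" and
    V: "\<And>n. V n \<in> sets M" and sV: "sets M = sigma_sets (space M) (range V)"
    by (rule real_injection) blast
  \<comment> \<open>The code \<open>b\<close> selects membership in \<open>V j\<close>, membership
    in its complement, or no condition, so that one countable family of tests serves all
    measurability arguments below.\<close>
  define VV where "VV j b = (if b = (0::nat) then V j else if b = 1 then space M - V j else space M)" for j b
  have VVm: "VV j b \<in> sets M" for j b using V by (auto simp: VV_def)
  define U where "U = (\<lambda>(p::rat, q::rat, j::nat, b::nat).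
      {x \<in> space M. of_rat p < \<phi> x \<and> \<phi> x \<le> of_rat q} \<inter> VV j b)"
  have Um: "U u \<in> sets M" for u
    unfolding U_def by (cases u) (auto intro!: sets.Int VVm)
  obtain N where N': "N \<in> null_sets M" "N0 \<subseteq> N \<and>
    (\<forall>n i. {x \<in> space M - N. \<exists>y\<in>U (from_nat i) - N. (x, y) \<in> F n} \<in> sets M)"
    using finite_section_null_set[of "\<lambda>i. U (from_nat i)" F N0, OF Um Fm Ffin N0] by (rule bexE)
  note N = N'(1) N'(2)[THEN conjunct1] N'(2)[THEN conjunct2, THEN spec, THEN spec]
  define X where "X = space M - N"
  have Xm[measurable]: "X \<in> sets M" using null_setsD2[OF N(1)] by (auto simp: X_def)
  have XM: "X \<subseteq> space M" by (auto simp: X_def)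
  \<comment> \<open>Classes are cut down to the conull set \<open>X\<close>, on which the
    existential tests \<open>S\<close> are measurable.\<close>
  define cls where "cls n x = {y \<in> X. (x, y) \<in> F n}" for n x
  define S where "S n p q j b = {x \<in> X. \<exists>y\<in>cls n x. of_rat p < \<phi> y \<and> \<phi> y \<le> of_rat q \<and> y \<in> VV j b}"
    for n j b and p q :: rat
  have Sm: "S n p q j b \<in> sets M" for n p q j b
  proof -
    have "S n p q j b = {x \<in> space M - N. \<exists>y\<in>U (from_nat (to_nat (p, q, j, b))) - N. (x, y) \<in> F n}"
      by (auto simp: S_def cls_def X_def U_def)
    then show ?thesis by (simp only: N(3))
  qed
  have clsfin: "finite (cls n x)" for n x
    using Ffin[of n x] by (rule finite_subset[rotated]) (auto simp: cls_def)
  have clsX: "cls n x \<subseteq> X" for n x by (auto simp: cls_def)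
  have X0: "X \<subseteq> space M - N0" using N(2) by (auto simp: X_def)
  have clsself: "x \<in> cls n x" if "x \<in> X" for n x
    using Feq[of n] that X0 unfolding cls_def equiv_def refl_on_def by auto
  have clseq: "cls n y = cls n x" if "y \<in> cls n x" for n x y
  proof -
    have "(x, y) \<in> F n" using that by (auto simp: cls_def)
    then have "F n `` {x} = F n `` {y}" by (rule equiv_class_eq[OF Feq])
    then show ?thesis unfolding cls_def by auto
  qed
  \<comment> \<open>The threshold is a function so that one argument yields both the successor of a
    point (\<open>c = \<phi>\<close>) and the minimum of its class (\<open>c = -1\<close>, below all
    values of \<open>\<phi>\<close>).\<close>
  define above where "above n c x = {y \<in> cls n x. c x < \<phi> y}" for n x and c :: "'a \<Rightarrow> real"
  define nxt where "nxt n c x = arg_min_on \<phi> (above n c x)" for n x and c :: "'a \<Rightarrow> real"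
  have abfin: "finite (above n c x)" for n c x using clsfin by (auto simp: above_def)
  have nxt: "nxt n c x \<in> above n c x" "y \<in> above n c x \<Longrightarrow> \<phi> (nxt n c x) \<le> \<phi> y"
    if "above n c x \<noteq> {}" for n c x y
    using arg_min_if_finite[OF abfin that, of \<phi>] unfolding nxt_def by force+
  have ab_ne: "{x \<in> X. above n c x \<noteq> {}} \<in> sets M" if [measurable]: "c \<in> borel_measurable M" for n c
  proof -
    \<comment> \<open>A rational between \<open>c x\<close> and \<open>\<phi> y\<close> replaces the
      moving threshold by a constant. The upper bound 2 excludes nothing because
      \<open>\<phi>\<close> is at most 2, and the code 2 imposes no condition of membership.\<close>
    have "{x \<in> X. above n c x \<noteq> {}} = (\<Union>p::rat. {x \<in> X. c x \<le> of_rat p} \<inter> S n p 2 0 2)"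
    proof (intro equalityI subsetI)
      fix x assume "x \<in> {x \<in> X. above n c x \<noteq> {}}"
      then obtain y where y: "x \<in> X" "y \<in> cls n x" "c x < \<phi> y" by (auto simp: above_def)
      obtain p where "c x < of_rat p" "of_rat p < \<phi> y" using of_rat_dense[OF y(3)] by blast
      then show "x \<in> (\<Union>p::rat. {x \<in> X. c x \<le> of_rat p} \<inter> S n p 2 0 2)"
        using y clsX[of n x] XM \<phi>b(2)[of y] by (auto simp: S_def VV_def intro!: exI[of _ p] bexI[of _ y])
    next
      fix x assume "x \<in> (\<Union>p::rat. {x \<in> X. c x \<le> of_rat p} \<inter> S n p 2 0 2)"
      then show "x \<in> {x \<in> X. above n c x \<noteq> {}}" by (fastforce simp: S_def above_def)
    qed
    moreover have "{x \<in> X. c x \<le> of_rat p} \<in> sets M" for p :: rat using XM Xm by measurable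
    ultimately show ?thesis using Sm by auto
  qed
  have gap: "{x \<in> X. \<exists>y\<in>cls n x. c x < \<phi> y \<and> \<phi> y \<le> of_rat p} \<in> sets M"
    if [measurable]: "c \<in> borel_measurable M" for n c and p :: rat
  proof -
    have "{x \<in> X. \<exists>y\<in>cls n x. c x < \<phi> y \<and> \<phi> y \<le> of_rat p} =
        (\<Union>p'::rat. {x \<in> X. c x \<le> of_rat p'} \<inter> S n p' p 0 2)"
    proof (intro equalityI subsetI)
      fix x assume "x \<in> {x \<in> X. \<exists>y\<in>cls n x. c x < \<phi> y \<and> \<phi> y \<le> of_rat p}"
      then obtain y where y: "x \<in> X" "y \<in> cls n x" "c x < \<phi> y" "\<phi> y \<le> of_rat p" by auto
      obtain p' where "c x < of_rat p'" "of_rat p' < \<phi> y" using of_rat_dense[OF y(3)] by blast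
      then show "x \<in> (\<Union>p'::rat. {x \<in> X. c x \<le> of_rat p'} \<inter> S n p' p 0 2)"
        using y clsX[of n x] XM by (auto simp: S_def VV_def intro!: exI[of _ p'] bexI[of _ y])
    next
      fix x assume "x \<in> (\<Union>p'::rat. {x \<in> X. c x \<le> of_rat p'} \<inter> S n p' p 0 2)"
      then obtain p' y where "x \<in> X" "c x \<le> of_rat p'" "y \<in> cls n x" "of_rat p' < \<phi> y" "\<phi> y \<le> of_rat p"
        by (auto simp: S_def)
      then show "x \<in> {x \<in> X. \<exists>y\<in>cls n x. c x < \<phi> y \<and> \<phi> y \<le> of_rat p}" by (auto intro!: bexI[of _ y])
    qed
    moreover have "{x \<in> X. c x \<le> of_rat p'} \<in> sets M" for p' :: rat using XM Xm by measurable
    ultimately show ?thesis using Sm by auto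
  qed
  have nxtV: "{x \<in> X. above n c x \<noteq> {} \<and> nxt n c x \<in> V j} \<in> sets M"
    if [measurable]: "c \<in> borel_measurable M" for n c j
  proof -
    \<comment> \<open>The window from \<open>p\<close> to \<open>q\<close> is chosen to contain the
      value of the next point and of no other point of the class. Conversely, the conditions force
      the next point into the window, and no class point of the window lies outside
      \<open>V j\<close>.\<close>
    let ?T = "\<lambda>p q::rat. ({x \<in> X. c x \<le> of_rat p} \<inter> S n p q j 0) -
        ({x \<in> X. \<exists>y\<in>cls n x. c x < \<phi> y \<and> \<phi> y \<le> of_rat p} \<union> S n p q j 1)"
    have "{x \<in> X. above n c x \<noteq> {} \<and> nxt n c x \<in> V j} = (\<Union>p. \<Union>q. ?T p q)"
    proof (intro equalityI subsetI)
      fix x assume "x \<in> {x \<in> X. above n c x \<noteq> {} \<and> nxt n c x \<in> V j}"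
      then have x: "x \<in> X" "above n c x \<noteq> {}" "nxt n c x \<in> V j" by auto
      define l where "l = nxt n c x"
      have l: "l \<in> cls n x" "c x < \<phi> l" "l \<in> V j" and lm: "\<And>y. y \<in> cls n x \<Longrightarrow> c x < \<phi> y \<Longrightarrow> \<phi> l \<le> \<phi> y"
        using nxt[OF x(2)] x(3) by (auto simp: above_def l_def)
      obtain p where p: "c x < of_rat p" "of_rat p < \<phi> l" using of_rat_dense[OF l(2)] by blast
      \<comment> \<open>The extra value \<open>\<phi> l + 1\<close> keeps the minimum defined when
        no point of the class lies above \<open>l\<close>.\<close>
      define Z where "Z = insert (\<phi> l + 1) (\<phi> ` {y \<in> cls n x. \<phi> l < \<phi> y})"
      have Z: "finite Z" "Z \<noteq> {}" using clsfin by (auto simp: Z_def)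
      have "\<phi> l < Min Z" using Z by (subst Min_gr_iff) (auto simp: Z_def)
      then obtain q where q: "\<phi> l < of_rat q" "of_rat q < Min Z" using of_rat_dense by blast
      have uniq: "y = l" if y: "y \<in> cls n x" "of_rat p < \<phi> y" "\<phi> y \<le> of_rat q" for y
      proof -
        have "\<phi> l \<le> \<phi> y" using lm y p by force
        moreover have "\<not> \<phi> l < \<phi> y"
        proof
          assume "\<phi> l < \<phi> y"
          then have "Min Z \<le> \<phi> y" using y Z by (intro Min_le) (auto simp: Z_def)
          then show False using q y by simp
        qed
        ultimately have "\<phi> y = \<phi> l" by simp
        then show ?thesis using inj y(1) l(1) clsX[of n x] XM by (meson inj_onD subsetD)
      qed
      have "\<exists>y\<in>cls n x. of_rat p < \<phi> y \<and> \<phi> y \<le> of_rat q \<and> y \<in> VV j 0"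
        by (rule bexI[OF _ l(1)]) (use l p q in \<open>auto simp: VV_def\<close>)
      then have 1: "x \<in> S n p q j 0" using x(1) by (simp add: S_def)
      have 2: "x \<notin> {x \<in> X. \<exists>y\<in>cls n x. c x < \<phi> y \<and> \<phi> y \<le> of_rat p}"
        using lm p(2) by force
      have 3: "x \<notin> S n p q j 1" using uniq l(3) by (auto simp: S_def VV_def)
      have "x \<in> ?T p q" using x(1) p(1) 1 2 3 by auto
      then show "x \<in> (\<Union>p. \<Union>q. ?T p q)" by blast
    next
      fix x assume "x \<in> (\<Union>p. \<Union>q. ?T p q)"
      then obtain p q where x: "x \<in> ?T p q" by blast
      then obtain y where y: "x \<in> X" "c x \<le> of_rat p" "y \<in> cls n x" "of_rat p < \<phi> y" "\<phi> y \<le> of_rat q" "y \<in> V j"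
        by (auto simp: S_def VV_def)
      have ya: "y \<in> above n c x" using y by (auto simp: above_def)
      then have ne: "above n c x \<noteq> {}" by blast
      have n1: "nxt n c x \<in> cls n x" "c x < \<phi> (nxt n c x)" "\<phi> (nxt n c x) \<le> \<phi> y"
        using nxt[OF ne] ya by (auto simp: above_def)
      then have n2: "of_rat p < \<phi> (nxt n c x)" "\<phi> (nxt n c x) \<le> of_rat q" using x y by (auto simp: not_le[symmetric])
      have "nxt n c x \<in> space M" using n1(1) clsX XM by blast
      then have "nxt n c x \<in> V j" using x n1(1) n2 y(1) by (auto simp: S_def VV_def)
      then show "x \<in> {x \<in> X. above n c x \<noteq> {} \<and> nxt n c x \<in> V j}" using ne y by blast
    qed
    moreover have "{x \<in> X. c x \<le> of_rat p} \<in> sets M" for p :: rat using XM Xm by measurable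
    then have "?T p q \<in> sets M" for p q using Sm gap[OF that] by auto
    then have "(\<Union>p. \<Union>q. ?T p q) \<in> sets M" by (intro sets.countable_UN'' countableI_type)
    ultimately show ?thesis by simp
  qed
  define \<sigma> where "\<sigma> n x = (if x \<in> X then (if above n \<phi> x \<noteq> {} then nxt n \<phi> x else nxt n (\<lambda>_. -1) x) else x)" for n x
  have ab1: "above n (\<lambda>_. -1) x = cls n x" for n x
    unfolding above_def using \<phi>b(1) by (auto intro: less_le_trans[of "-1" 0])
  have cyc: "\<exists>e m. 0 < m \<and> bij_betw e {..<m} (cls n x) \<and> (\<forall>i<m. \<sigma> n (e i) = e (Suc i mod m)) \<and>
    (\<forall>y\<in>cls n x. \<phi> (e 0) \<le> \<phi> y)" if x: "x \<in> X" for n x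
  proof (rule cyclic_successor[OF clsfin])
    show "cls n x \<noteq> {}" using clsself[OF x] by blast
    show "inj_on \<phi> (cls n x)" using inj clsX XM by (meson inj_on_subset)
    fix z assume z: "z \<in> cls n x"
    then have "z \<in> X" using clsX by blast
    then show "\<sigma> n z = (if {y \<in> cls n x. \<phi> z < \<phi> y} \<noteq> {} then arg_min_on \<phi> {y \<in> cls n x. \<phi> z < \<phi> y}
      else arg_min_on \<phi> (cls n x))"
      using clseq[OF z] ab1[of n z] by (auto simp: \<sigma>_def nxt_def above_def)
  qed
  have \<sigma>pow: "(\<sigma> n ^^ j) (e i) = e ((i + j) mod m)"
    if "i < m" "\<And>i. i < m \<Longrightarrow> \<sigma> n (e i) = e (Suc i mod m)" for n e m i j
  proof (induction j)
    case (Suc j)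
    have "(i + j) mod m < m" using that(1) by simp
    then show ?case using Suc that(2) by (simp add: mod_Suc_eq)
  qed (use that in simp)
  have \<sigma>cls: "\<sigma> n x \<in> cls n x" if "x \<in> X" for n x
    using nxt(1)[of n \<phi> x] nxt(1)[of n "\<lambda>_. -1" x] clsself[OF that, of n] ab1[of n x] that
    by (auto simp: \<sigma>_def above_def)
  have powcls: "(\<sigma> n ^^ j) x \<in> cls n x" if "x \<in> X" for n j x
  proof (induction j)
    case (Suc j)
    then have "(\<sigma> n ^^ j) x \<in> X" using clsX by blast
    from \<sigma>cls[OF this, of n] clseq[OF Suc] show ?case by simp
  qed (use clsself[OF that] in simp)
  have per: "\<exists>m. (\<sigma> n ^^ Suc m) x = x" if x: "x \<in> X" for n x
  proof -
    obtain e m where em: "0 < m" "bij_betw e {..<m} (cls n x)" "\<And>i. i < m \<Longrightarrow> \<sigma> n (e i) = e (Suc i mod m)"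
      using cyc[OF x] by blast
    obtain i where i: "i < m" "x = e i" using clsself[OF x, of n] em(2) unfolding bij_betw_def by auto
    have "(\<sigma> n ^^ m) x = x" using \<sigma>pow[of i m n e m, OF i(1) em(3)] i by simp
    then show ?thesis using em(1) by (metis Suc_pred)
  qed
  have trans: "\<exists>j. y = (\<sigma> n ^^ j) x" if x: "x \<in> X" "y \<in> cls n x" for n x y
  proof -
    obtain e m where em: "0 < m" "bij_betw e {..<m} (cls n x)" "\<And>i. i < m \<Longrightarrow> \<sigma> n (e i) = e (Suc i mod m)"
      using cyc[OF x(1)] by blast
    obtain i where i: "i < m" "x = e i" using clsself[OF x(1), of n] em(2) unfolding bij_betw_def by auto
    obtain k where k: "k < m" "y = e k" using x(2) em(2) unfolding bij_betw_def by auto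
    have "(\<sigma> n ^^ (k + (m - i))) x = y" using \<sigma>pow[of i m n e "k + (m - i)", OF i(1) em(3)] i k by simp
    then show ?thesis by metis
  qed
  have notX: "(\<sigma> n ^^ j) x = x" if "x \<notin> X" for n j x
    by (induction j) (use that in \<open>auto simp: \<sigma>_def\<close>)
  have per': "\<exists>m. (\<sigma> n ^^ Suc m) x = x" for n x
    using per[of x n] notX by (cases "x \<in> X") (auto simp del: funpow.simps)
  have bij: "bij (\<sigma> n)" for n
  proof (rule bijI)
    show "surj (\<sigma> n)"
    proof (unfold surj_def, rule allI)
      fix x
      obtain m where "(\<sigma> n ^^ Suc m) x = x" using per'[of n x] by blast
      then show "\<exists>y. x = \<sigma> n y" by (intro exI[of _ "(\<sigma> n ^^ m) x"]) simp
    qed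
    show "inj (\<sigma> n)"
    proof (rule injI)
      fix x y assume xy: "\<sigma> n x = \<sigma> n y"
      obtain m k where mk: "(\<sigma> n ^^ Suc m) x = x" "(\<sigma> n ^^ Suc k) y = y" using per' by metis
      have eq: "(\<sigma> n ^^ Suc j) x = (\<sigma> n ^^ Suc j) y" for j
        using xy by (simp add: funpow_Suc_right del: funpow.simps)
      \<comment> \<open>Both points return after a common multiple of their periods, so equal images
        force equal points.\<close>
      have fx: "(\<sigma> n ^^ (Suc m * j)) x = x" "(\<sigma> n ^^ (Suc k * j)) y = y" for j
        by (induction j) (simp_all only: mult_0_right mult_Suc_right funpow_add o_apply mk funpow_0)
      have "x = (\<sigma> n ^^ (Suc m * Suc k)) x" by (rule fx(1)[symmetric])
      also have "\<dots> = (\<sigma> n ^^ (Suc m * Suc k)) y" using eq[of "k + m * Suc k"] by (simp only: mult_Suc add_Suc)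
      also have "\<dots> = y" using fx(2)[of "Suc m"] by (simp only: mult.commute)
      finally show "x = y" .
    qed
  qed
  have \<sigma>M: "\<sigma> n x \<in> space M \<longleftrightarrow> x \<in> space M" for n x
  proof (cases "x \<in> X")
    case True
    then show ?thesis using \<sigma>cls[of x n] clsX[of n x] XM by blast
  qed (simp add: \<sigma>_def)
  have \<sigma>m[measurable]: "\<sigma> n \<in> measurable M M" for n
  proof (rule measurable_sigma_sets[OF sV])
    show "range V \<subseteq> Pow (space M)" using V sets.sets_into_space by auto
    show "\<sigma> n \<in> space M \<rightarrow> space M" using \<sigma>M by auto
    fix A assume "A \<in> range V"
    then obtain j where A: "A = V j" by auto
    have ne: "above n (\<lambda>_. -1) x \<noteq> {}" if "x \<in> X" for x using ab1 clsself[OF that] by (metis empty_iff)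
    have "\<sigma> n x \<in> V j \<and> x \<in> space M \<longleftrightarrow> x \<in> {x \<in> X. above n \<phi> x \<noteq> {} \<and> nxt n \<phi> x \<in> V j} \<union>
       ({x \<in> X. above n (\<lambda>_. -1) x \<noteq> {} \<and> nxt n (\<lambda>_. -1) x \<in> V j} - {x \<in> X. above n \<phi> x \<noteq> {}}) \<union> (V j - X)" for x
    proof (cases "x \<in> X")
      case True
      then have "x \<in> space M" using XM by blast
      then show ?thesis using ne[OF True] True by (cases "above n \<phi> x = {}") (simp_all add: \<sigma>_def)
    next
      case False
      then show ?thesis using sets.sets_into_space[OF V[of j]] by (auto simp: \<sigma>_def)
    qed
    then have "\<sigma> n -` V j \<inter> space M = {x \<in> X. above n \<phi> x \<noteq> {} \<and> nxt n \<phi> x \<in> V j} \<union>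
       ({x \<in> X. above n (\<lambda>_. -1) x \<noteq> {} \<and> nxt n (\<lambda>_. -1) x \<in> V j} - {x \<in> X. above n \<phi> x \<noteq> {}}) \<union> (V j - X)"
      unfolding set_eq_iff Int_iff vimage_eq by blast
    then show "\<sigma> n -` A \<inter> space M \<in> sets M"
      unfolding A using nxtV[OF \<phi>] nxtV[of "\<lambda>_. -1"] ab_ne[OF \<phi>] V by auto
  qed
  have powm[measurable]: "(\<sigma> n ^^ j) \<in> measurable M M" for n j by (induction j) auto
  have invm: "inv_fun (\<sigma> n) \<in> measurable M M" for n
  proof (rule measurableI)
    fix x assume "x \<in> space M"
    then show "inv_fun (\<sigma> n) x \<in> space M" using \<sigma>M[of n "inv_fun (\<sigma> n) x"] bij[of n] by (simp add: bij_is_surj surj_f_inv_f)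
  next
    fix A assume A: "A \<in> sets M"
    \<comment> \<open>On the points with period \<open>Suc m\<close> the inverse is the
      \<open>m\<close>-th power; countably many such sets cover the space.\<close>
    have "inv_fun (\<sigma> n) -` A \<inter> space M =
        (\<Union>m. {x \<in> space M. (\<sigma> n ^^ Suc m) x = x} \<inter> ((\<sigma> n ^^ m) -` A \<inter> space M))"
    proof -
      have "inv_fun (\<sigma> n) x = (\<sigma> n ^^ m) x" if "(\<sigma> n ^^ Suc m) x = x" for x m
        by (rule inv_f_eq[OF bij_is_inj[OF bij]]) (use that in simp)
      then show ?thesis using per'[of n] by (auto; metis)
    qed
    moreover have "{x \<in> space M. (\<sigma> n ^^ Suc m) x = x} \<in> sets M" for m
    proof -
      have "{x \<in> space M. (\<sigma> n ^^ Suc m) x = x} = space M - {x \<in> space M. (\<sigma> n ^^ Suc m) x \<noteq> x}" by auto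
      then show ?thesis using sets_noteq[OF std powm[of "Suc m" n] measurable_ident] by simp
    qed
    ultimately show "inv_fun (\<sigma> n) -` A \<inter> space M \<in> sets M"
      using A measurable_sets[OF powm A] by (auto simp del: funpow.simps)
  qed
  have FE: "F n \<subseteq> E" for n using F3(2) by auto
  have \<sigma>full: "\<sigma> n \<in> full_auts M E" for n
    unfolding full_auts_def
  proof (intro CollectI conjI ballI allI impI)
    show "(x, \<sigma> n x) \<in> E" if "x \<in> space M" for x
    proof (cases "x \<in> X")
      case True
      then have "(x, \<sigma> n x) \<in> F n" using \<sigma>cls[of x n] by (simp add: cls_def)
      then show ?thesis using FE[of n] by blast
    qed (use E_refl[OF that] in \<open>simp add: \<sigma>_def\<close>)
    show "\<sigma> n x = x" if "x \<notin> space M" for x using that XM by (auto simp: \<sigma>_def)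
  qed (use bij \<sigma>m invm in auto)
  define Y where "Y n = {x \<in> X. \<forall>j. \<phi> x \<le> \<phi> ((\<sigma> n ^^ j) x)}" for n
  have Ym: "Y n \<in> sets M" for n
  proof -
    have "Y n = X \<inter> (\<Inter>j. {x \<in> space M. \<phi> x \<le> \<phi> ((\<sigma> n ^^ j) x)})" using XM by (auto simp: Y_def)
    also have "\<dots> \<in> sets M" by (intro sets.Int Xm sets.countable_INT) (auto simp del: funpow.simps)
    finally show ?thesis .
  qed
  have transv: "y = y'" if y: "y \<in> Y n" "y' \<in> Y n" "(\<sigma> n ^^ a) y = (\<sigma> n ^^ b) y'" for n a b y y'
  proof -
    have X: "y \<in> X" "y' \<in> X" using y by (auto simp: Y_def)
    have "cls n y = cls n y'" using clseq[OF powcls[OF X(1), of a n]] clseq[OF powcls[OF X(2), of b n]] y(3) by simp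
    then have c: "y' \<in> cls n y" "y \<in> cls n y'" using clsself X by auto
    obtain j k where jk: "y' = (\<sigma> n ^^ j) y" "y = (\<sigma> n ^^ k) y'"
      using trans[OF X(1) c(1)] trans[OF X(2) c(2)] by blast
    have "\<phi> y \<le> \<phi> ((\<sigma> n ^^ j) y)" "\<phi> y' \<le> \<phi> ((\<sigma> n ^^ k) y')"
      using y(1,2) by (simp_all add: Y_def)
    then have "\<phi> y \<le> \<phi> y'" "\<phi> y' \<le> \<phi> y" by (simp_all only: jk[symmetric])
    then show ?thesis using inj X XM by (meson inj_onD order_antisym subsetD)
  qed
  have cover: "\<exists>n0. \<forall>n\<ge>n0. \<exists>y\<in>Y n. \<exists>a b. x = (\<sigma> n ^^ a) y \<and> w = (\<sigma> n ^^ b) y"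
    if xw: "x \<in> space M - N" "w \<in> space M - N" "(x, w) \<in> E" for x w
  proof -
    have X: "x \<in> X" "w \<in> X" using xw by (auto simp: X_def)
    then have "(x, w) \<in> Restr E (space M - N0)" using xw(3) X0 by auto
    then have "(x, w) \<in> (\<Union>n. F n)" by (simp only: F3(2))
    then obtain n0 where n0: "(x, w) \<in> F n0" by blast
    show ?thesis
    proof (intro exI[of _ n0] allI impI)
      fix n assume "n0 \<le> n"
      then have w: "w \<in> cls n x" using n0 F3(1) X by (auto simp: cls_def dest: incseqD)
      obtain e :: "nat \<Rightarrow> 'a" and m where em: "0 < m" "bij_betw e {..<m} (cls n x)" "\<forall>y\<in>cls n x. \<phi> (e 0) \<le> \<phi> y"
        using cyc[OF X(1), of n] by blast
      have e0: "e 0 \<in> cls n x" using em(1,2) unfolding bij_betw_def by auto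
      then have e0X: "e 0 \<in> X" using clsX by blast
      have "e 0 \<in> Y n" using e0X em(3) powcls[OF e0X] clseq[OF e0] by (auto simp: Y_def)
      moreover have "x \<in> cls n (e 0)" "w \<in> cls n (e 0)" using clseq[OF e0] clsself[OF X(1)] w by auto
      ultimately show "\<exists>y\<in>Y n. \<exists>a b. x = (\<sigma> n ^^ a) y \<and> w = (\<sigma> n ^^ b) y"
        using trans[OF e0X] by blast
    qed
  qed
  show thesis by (rule that[OF N(1) \<sigma>full Ym transv cover])
qed

end

section \<open>The full group\<close>

text \<open>The blocks \<open>\<theta> l ` Z l\<close> are permuted as prescribed by \<open>p\<close>, and points are moved along the maps \<open>\<theta>\<close>. This is only
  meaningful if the blocks are disjoint: otherwise \<open>SOME\<close> chooses between them.\<close>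

definition blk :: "('i \<Rightarrow> 'a \<Rightarrow> 'a) \<Rightarrow> ('i \<Rightarrow> 'a set) \<Rightarrow> 'i set \<Rightarrow> ('i \<Rightarrow> 'i) \<Rightarrow> 'a \<Rightarrow> 'a" where
  "blk \<theta> Z J p x = (if \<exists>l\<in>J. x \<in> \<theta> l ` Z l
     then (let l = (SOME l. l \<in> J \<and> x \<in> \<theta> l ` Z l) in \<theta> (p l) (inv_fun (\<theta> l) x)) else x)"

lemma blk_out: "(\<And>l. l \<in> J \<Longrightarrow> x \<notin> \<theta> l ` Z l) \<Longrightarrow> blk \<theta> Z J p x = x"
  by (auto simp: blk_def)

section \<open>Everywhere defined representatives of the full group\<close>

context hyperfinite_setting
begin

abbreviation "FG \<equiv> full_auts M E"

lemma FG_D: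
  assumes "f \<in> FG"
  shows "bij f" "f \<in> measurable M M" "inv_fun f \<in> measurable M M"
    "x \<in> space M \<Longrightarrow> (x, f x) \<in> E" "x \<notin> space M \<Longrightarrow> f x = x"
  using assms by (auto simp: full_auts_def)

lemma FG_inv_f [simp]: "f \<in> FG \<Longrightarrow> inv_fun f (f x) = x"
  by (simp add: FG_D(1) bij_is_inj)

lemma FG_f_inv [simp]: "f \<in> FG \<Longrightarrow> f (inv_fun f x) = x"
  by (simp add: FG_D(1) bij_is_surj surj_f_inv_f)

lemma FG_eq [simp]: "f \<in> FG \<Longrightarrow> f x = f y \<longleftrightarrow> x = y"
  by (metis FG_inv_f)

lemma FG_space [simp]: assumes "f \<in> FG" shows "f x \<in> space M \<longleftrightarrow> x \<in> space M"
proof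
  assume fx: "f x \<in> space M"
  show "x \<in> space M"
  proof (rule ccontr)
    assume "x \<notin> space M"
    then show False using FG_D(5)[OF assms, of x] fx by simp
  qed
next
  assume "x \<in> space M" then show "f x \<in> space M" by (rule measurable_space[OF FG_D(2)[OF assms]])
qed

lemma FG_id: "id \<in> FG"
  by (auto simp: full_auts_def E_refl intro: measurable_ident)

lemma FG_inv: assumes f: "f \<in> FG" shows "inv_fun f \<in> FG"
  unfolding full_auts_def
proof (intro CollectI conjI ballI allI impI)
  show "bij (inv_fun f)" using FG_D(1)[OF f] by (rule bij_imp_bij_inv)
  show "inv_fun f \<in> measurable M M" by (rule FG_D(3)[OF f])
  show "inv_fun (inv_fun f) \<in> measurable M M" using FG_D(1,2)[OF f] by (simp add: inv_inv_eq)
  fix x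
  show "(x, inv_fun f x) \<in> E" if "x \<in> space M"
  proof -
    have "inv_fun f x \<in> space M" using that FG_space[OF f, of "inv_fun f x"] f by simp
    then show ?thesis using FG_D(4)[OF f, of "inv_fun f x"] f E_sym by simp
  qed
  show "inv_fun f x = x" if "x \<notin> space M" using FG_D(5)[OF f that] f by (metis FG_inv_f)
qed

lemma FG_comp: assumes f: "f \<in> FG" and g: "g \<in> FG" shows "f \<circ> g \<in> FG"
  unfolding full_auts_def
proof (intro CollectI conjI ballI allI impI)
  show "bij (f \<circ> g)" using FG_D(1) f g bij_comp by blast
  show "f \<circ> g \<in> measurable M M" using FG_D(2) f g measurable_comp by blast
  have "inv_fun (f \<circ> g) = inv_fun g \<circ> inv_fun f" using FG_D(1) f g by (simp add: o_inv_distrib)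
  then show "inv_fun (f \<circ> g) \<in> measurable M M" using FG_D(3) f g measurable_comp by metis
  fix x
  show "(x, (f \<circ> g) x) \<in> E" if "x \<in> space M"
    using FG_D(4)[OF g that] FG_D(4)[OF f, of "g x"] g that E_trans by simp
  show "(f \<circ> g) x = x" if "x \<notin> space M" using FG_D(5)[OF g that] FG_D(5)[OF f that] by simp
qed

lemma FG_pow: "f \<in> FG \<Longrightarrow> f ^^ n \<in> FG"
  by (induction n) (auto simp: FG_id FG_comp id_def[symmetric])

lemma FG_image_vimage: "f \<in> FG \<Longrightarrow> f ` A = inv_fun f -` A"
  by (force simp: image_iff)

lemma FG_image_sets [intro]: assumes "f \<in> FG" "A \<in> sets M" shows "f ` A \<in> sets M"
proof -
  have "f ` A = inv_fun f -` A \<inter> space M"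
    using assms sets.sets_into_space[OF assms(2)] FG_space[OF FG_inv[OF assms(1)]]
    by (auto simp: FG_image_vimage)
  then show ?thesis using measurable_sets[OF FG_D(3)[OF assms(1)] assms(2)] by simp
qed

lemma FG_vimage_sets [intro]: assumes "f \<in> FG" "A \<in> sets M" shows "f -` A \<in> sets M"
proof -
  have "f -` A = inv_fun f ` A" using FG_image_vimage[OF FG_inv[OF assms(1)], of A] FG_D(1)[OF assms(1)]
    by (simp add: inv_inv_eq)
  then show ?thesis using assms FG_inv by auto
qed

text \<open>Elements of \<open>FG\<close> have their graph in \<open>E\<close> at every point of the
  space, not only almost everywhere, which is the form in which
  \<open>measure_preserving_rel\<close> can be applied.\<close>

lemma FG_mp: assumes f: "f \<in> FG" shows "f \<in> mp_auts M"
proof -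
  have b: "bij_betw f (space M) (space M)"
    unfolding bij_betw_def using f by (auto intro!: inj_onI image_eqI[of _ f "inv_fun f _"] simp: FG_space[OF FG_inv])
  have "the_inv_into (space M) f \<in> measurable M M \<longleftrightarrow> inv_fun f \<in> measurable M M"
    by (rule measurable_cong, rule the_inv_into_f_eq) (use b f in \<open>auto simp: bij_betw_def FG_space[OF FG_inv]\<close>)
  then have "f \<in> borel_auts M" using b FG_D[OF f] by (simp add: borel_auts_def)
  then show ?thesis using mpE FG_D(4)[OF f] by (auto simp: mp_auts_def measure_preserving_rel_def)
qed

lemma FG_emeasure: assumes f: "f \<in> FG" and A: "A \<in> sets M" shows "emeasure M (f ` A) = emeasure M A"
proof -
  have g: "inv_fun f \<in> FG" by (rule FG_inv[OF f])
  have "emeasure M A = emeasure (distr M M (inv_fun f)) A" using mp_autsD(3)[OF FG_mp[OF g]] by simp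
  also have "\<dots> = emeasure M (inv_fun f -` A \<inter> space M)" by (rule emeasure_distr[OF FG_D(2)[OF g] A])
  also have "inv_fun f -` A \<inter> space M = f ` A"
    using sets.sets_into_space[OF FG_image_sets[OF f A]] by (auto simp: FG_image_vimage[OF f])
  finally show ?thesis by simp
qed

lemma FG_measure: "f \<in> FG \<Longrightarrow> A \<in> sets M \<Longrightarrow> measure M (f ` A) = measure M A"
  by (simp add: measure_def FG_emeasure)

lemma FG_measure_vimage: assumes "f \<in> FG" "A \<in> sets M" shows "measure M (f -` A) = measure M A"
  using FG_measure[OF FG_inv[OF assms(1)] assms(2)] FG_image_vimage[OF FG_inv[OF assms(1)], of A] FG_D(1)[OF assms(1)]
  by (simp add: inv_inv_eq)

lemma FG_null_vimage: "f \<in> FG \<Longrightarrow> A \<in> null_sets M \<Longrightarrow> f -` A \<in> null_sets M"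
  using FG_measure_vimage[of f A] by (auto simp: null_sets_def emeasure_eq_measure)

text \<open>Preimages under \<open>h\<close> and under its inverse split over the countably many
  pieces, where they are preimages and images under elements of \<open>FG\<close>. All later
  elements of \<open>FG\<close> built by cases are obtained in this way.\<close>

lemma glue:
  assumes b: "bij h" and out: "\<And>x. x \<notin> space M \<Longrightarrow> h x = x" and I: "countable I"
    and A: "\<And>i. i \<in> I \<Longrightarrow> A i \<in> sets M" and g: "\<And>i. i \<in> I \<Longrightarrow> g i \<in> FG"
    and cov: "\<And>x. x \<in> space M \<Longrightarrow> \<exists>i\<in>I. x \<in> A i" and h: "\<And>i x. i \<in> I \<Longrightarrow> x \<in> A i \<Longrightarrow> h x = g i x"
  shows "h \<in> FG"
  unfolding full_auts_def
proof (intro CollectI conjI ballI allI impI)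
  have AM: "A i \<subseteq> space M" if "i \<in> I" for i using A[OF that] by (rule sets.sets_into_space)
  show hE: "(x, h x) \<in> E" if "x \<in> space M" for x using cov[OF that] h FG_D(4)[OF g that] by auto
  have hM: "h x \<in> space M \<longleftrightarrow> x \<in> space M" for x
  proof
    assume "x \<in> space M" then show "h x \<in> space M" using cov h g AM by (metis FG_space)
  next
    assume "h x \<in> space M" then show "x \<in> space M" using out by (cases "x \<in> space M") auto
  qed
  show "h \<in> measurable M M"
  proof (rule measurableI)
    fix B assume B: "B \<in> sets M"
    have "h -` B \<inter> space M = (\<Union>i\<in>I. A i \<inter> g i -` B)"
    proof (intro equalityI subsetI)
      fix x assume x: "x \<in> h -` B \<inter> space M"
      then obtain i where "i \<in> I" "x \<in> A i" using cov by blast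
      then show "x \<in> (\<Union>i\<in>I. A i \<inter> g i -` B)" using x h by auto
    next
      fix x assume "x \<in> (\<Union>i\<in>I. A i \<inter> g i -` B)"
      then obtain i where "i \<in> I" "x \<in> A i" "g i x \<in> B" by blast
      then show "x \<in> h -` B \<inter> space M" using h AM by auto
    qed
    moreover have "(\<Union>i\<in>I. A i \<inter> g i -` B) \<in> sets M"
      using A g B I by (intro sets.countable_UN'') auto
    ultimately show "h -` B \<inter> space M \<in> sets M" by simp
  qed (use hM in auto)
  have ih: "inv_fun h (h x) = x" "h (inv_fun h x) = x" for x
    using b by (simp_all add: bij_is_inj bij_is_surj surj_f_inv_f)
  show "inv_fun h \<in> measurable M M"
  proof (rule measurableI)
    fix B assume B: "B \<in> sets M"
    have BM: "B \<subseteq> space M" by (rule sets.sets_into_space[OF B])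
    have "inv_fun h -` B \<inter> space M = (\<Union>i\<in>I. g i ` (A i \<inter> B))"
    proof (intro equalityI subsetI)
      fix y assume y: "y \<in> inv_fun h -` B \<inter> space M"
      then have "inv_fun h y \<in> B" "inv_fun h y \<in> space M" using BM by auto
      then obtain i where i: "i \<in> I" "inv_fun h y \<in> A i" using cov by blast
      then have "y = g i (inv_fun h y)" using h[OF i] ih by simp
      then show "y \<in> (\<Union>i\<in>I. g i ` (A i \<inter> B))" using i \<open>inv_fun h y \<in> B\<close> by blast
    next
      fix y assume "y \<in> (\<Union>i\<in>I. g i ` (A i \<inter> B))"
      then obtain i x where x: "i \<in> I" "x \<in> A i" "x \<in> B" "y = g i x" by blast
      then have "y = h x" using h by simp
      then show "y \<in> inv_fun h -` B \<inter> space M" using x BM hM ih by auto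
    qed
    moreover have "(\<Union>i\<in>I. g i ` (A i \<inter> B)) \<in> sets M"
      using A g B I by (intro sets.countable_UN'') auto
    ultimately show "inv_fun h -` B \<inter> space M \<in> sets M" by simp
  qed (use hM ih in metis)
  show "h x = x" if "x \<notin> space M" for x by (rule out[OF that])
qed (use b in auto)

text \<open>The base may depend on the index, so that the notion covers both the towers of a single
  automorphism and the family of all factors of the second generator.\<close>

definition tower :: "('i \<Rightarrow> 'a \<Rightarrow> 'a) \<Rightarrow> ('i \<Rightarrow> 'a set) \<Rightarrow> 'i set \<Rightarrow> bool" where
  "tower \<theta> Z J \<longleftrightarrow> countable J \<and> (\<forall>l\<in>J. \<theta> l \<in> FG \<and> Z l \<in> sets M) \<and>
     (\<forall>l\<in>J. \<forall>m\<in>J. l \<noteq> m \<longrightarrow> \<theta> l ` Z l \<inter> \<theta> m ` Z m = {})"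

lemma towerD:
  assumes "tower \<theta> Z J"
  shows "countable J" "l \<in> J \<Longrightarrow> \<theta> l \<in> FG" "l \<in> J \<Longrightarrow> Z l \<in> sets M"
    "l \<in> J \<Longrightarrow> m \<in> J \<Longrightarrow> z \<in> Z l \<Longrightarrow> w \<in> Z m \<Longrightarrow> \<theta> l z = \<theta> m w \<Longrightarrow> l = m"
  using assms unfolding tower_def by (auto, blast)

lemma blk_app:
  assumes t: "tower \<theta> Z J" and l: "l \<in> J" "z \<in> Z l"
  shows "blk \<theta> Z J p (\<theta> l z) = \<theta> (p l) z"
proof -
  have u: "m = l" if "m \<in> J \<and> \<theta> l z \<in> \<theta> m ` Z m" for m
    using that towerD(4)[OF t, of m l _ z] l by auto
  have "(SOME m. m \<in> J \<and> \<theta> l z \<in> \<theta> m ` Z m) = l"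
    by (rule some_equality) (use l u in auto)
  then show ?thesis using l towerD(2)[OF t l(1)] by (auto simp: blk_def Let_def)
qed

lemma blk_id: assumes "tower \<theta> Z J" "\<And>l. l \<in> J \<Longrightarrow> p l = l" shows "blk \<theta> Z J p = id"
proof
  fix x
  show "blk \<theta> Z J p x = id x"
  proof (cases "\<exists>l\<in>J. x \<in> \<theta> l ` Z l")
    case True
    then obtain l z where "l \<in> J" "z \<in> Z l" "x = \<theta> l z" by blast
    then show ?thesis using assms by (simp add: blk_app)
  qed (simp add: blk_def)
qed

text \<open>A point moved from level \<open>l\<close> to level \<open>q l\<close> must lie over the
  base of its new level; hence the condition that \<open>q\<close> preserves the bases.\<close>

lemma blk_comp:
  assumes t: "tower \<theta> Z J" and q: "\<And>l. l \<in> J \<Longrightarrow> q l \<in> J" "\<And>l. l \<in> J \<Longrightarrow> Z (q l) = Z l"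
  shows "blk \<theta> Z J p \<circ> blk \<theta> Z J q = blk \<theta> Z J (p \<circ> q)"
proof
  fix x
  show "(blk \<theta> Z J p \<circ> blk \<theta> Z J q) x = blk \<theta> Z J (p \<circ> q) x"
  proof (cases "\<exists>l\<in>J. x \<in> \<theta> l ` Z l")
    case True
    then obtain l z where "l \<in> J" "z \<in> Z l" "x = \<theta> l z" by blast
    then show ?thesis using t q by (simp add: blk_app)
  qed (simp add: blk_def)
qed

text \<open>The inverse permutation gives the inverse map by \<open>blk_comp\<close>. For
  \<open>glue\<close> the pieces are the levels and the complement of the tower; on the level
  \<open>l\<close> the map is \<open>\<theta> (p l)\<close> after the inverse of
  \<open>\<theta> l\<close>.\<close>

lemma blk_FG:
  assumes t: "tower \<theta> Z J" and p: "bij_betw p J J" and Z: "\<And>l. l \<in> J \<Longrightarrow> Z (p l) = Z l"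
  shows "blk \<theta> Z J p \<in> FG"
proof -
  let ?h = "blk \<theta> Z J p" and ?q = "inv_into J p"
  have pJ: "p l \<in> J" if "l \<in> J" for l using p that bij_betwE by blast
  have qJ: "?q l \<in> J" "p (?q l) = l" "?q (p l) = l" if "l \<in> J" for l
    using p that pJ by (auto simp: bij_betw_def inv_into_into f_inv_into_f inv_into_f_f)
  have Zq: "Z (?q l) = Z l" if "l \<in> J" for l using Z[OF qJ(1)[OF that]] qJ(2)[OF that] by simp
  have "?h \<circ> blk \<theta> Z J ?q = id"
    by (subst blk_comp[OF t qJ(1) Zq]) (auto intro!: blk_id[OF t] simp: qJ)
  moreover have "blk \<theta> Z J ?q \<circ> ?h = id"
    by (subst blk_comp[OF t pJ Z]) (auto intro!: blk_id[OF t] simp: qJ)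
  ultimately have b: "bij ?h" by (rule o_bij[rotated])
  define A where "A i = (case i of None \<Rightarrow> space M - (\<Union>l\<in>J. \<theta> l ` Z l) | Some l \<Rightarrow> \<theta> l ` Z l)" for i
  define g where "g i = (case i of None \<Rightarrow> id | Some l \<Rightarrow> \<theta> (p l) \<circ> inv_fun (\<theta> l))" for i
  have sub: "\<theta> l ` Z l \<subseteq> space M" if "l \<in> J" for l
    using sets.sets_into_space[OF FG_image_sets] towerD[OF t] that by blast
  show ?thesis
  proof (rule glue[OF b, where I = "insert None (Some ` J)" and A = A and g = g])
    show "?h x = x" if "x \<notin> space M" for x by (rule blk_out) (use sub that in blast)
    show "countable (insert None (Some ` J))" using towerD(1)[OF t] by auto
    have U: "(\<Union>l\<in>J. \<theta> l ` Z l) \<in> sets M"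
      using towerD[OF t] by (intro sets.countable_UN'') auto
    show "A i \<in> sets M" if "i \<in> insert None (Some ` J)" for i
      using that U towerD[OF t] by (auto simp: A_def intro!: FG_image_sets)
    show "g i \<in> FG" if "i \<in> insert None (Some ` J)" for i
      using that FG_id towerD(2)[OF t] pJ FG_comp FG_inv by (auto simp: g_def)
    show "\<exists>i\<in>insert None (Some ` J). x \<in> A i" if "x \<in> space M" for x
      using that by (cases "x \<in> (\<Union>l\<in>J. \<theta> l ` Z l)") (auto simp: A_def)
    show "?h x = g i x" if iJ: "i \<in> insert None (Some ` J)" "x \<in> A i" for i x
    proof (cases i)
      case None
      then show ?thesis using iJ by (auto simp: A_def g_def intro!: blk_out)
    next
      case (Some l)
      then obtain z where "l \<in> J" "z \<in> Z l" "x = \<theta> l z" using iJ by (auto simp: A_def)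
      then show ?thesis using Some towerD(2)[OF t] by (simp add: g_def blk_app[OF t])
    qed
  qed
qed

text \<open>A family as in the Feldman-Moore theorem. Off a null set, equivalent points are powers
  of some \<open>\<sigma> n\<close> applied to a common point, so going back by one power and
  forward by the other leads from one to the other.\<close>

lemma countable_generators:
  obtains N :: "'a set" and \<gamma> :: "nat \<Rightarrow> 'a \<Rightarrow> 'a" where "N \<in> null_sets M" "\<And>i. \<gamma> i \<in> FG"
    "\<And>x w. x \<in> space M - N \<Longrightarrow> w \<in> space M - N \<Longrightarrow> (x, w) \<in> E \<Longrightarrow> \<exists>i. \<gamma> i x = w"
proof -
  obtain N :: "'a set" and \<sigma> :: "nat \<Rightarrow> 'a \<Rightarrow> 'a" and Y :: "nat \<Rightarrow> 'a set" where
    N: "N \<in> null_sets M" and \<sigma>: "\<And>n. \<sigma> n \<in> FG" and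
    cov: "\<And>x w. x \<in> space M - N \<Longrightarrow> w \<in> space M - N \<Longrightarrow> (x, w) \<in> E \<Longrightarrow>
       \<exists>n0. \<forall>n\<ge>n0. \<exists>y\<in>Y n. \<exists>a b. x = (\<sigma> n ^^ a) y \<and> w = (\<sigma> n ^^ b) y"
    by (rule hyperfinite_structure) blast
  define \<gamma> where "\<gamma> = (\<lambda>(n, a, b). (\<sigma> n ^^ b) \<circ> inv_fun (\<sigma> n ^^ a))"
  have \<gamma>: "\<gamma> i \<in> FG" for i unfolding \<gamma>_def by (cases i) (simp add: FG_comp FG_inv FG_pow \<sigma>)
  show thesis
  proof (rule that[of N "\<lambda>i. \<gamma> (from_nat i)"])
    fix x w assume xw: "x \<in> space M - N" "w \<in> space M - N" "(x, w) \<in> E"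
    then obtain n y a b where "x = (\<sigma> n ^^ a) y" "w = (\<sigma> n ^^ b) y" using cov[OF xw] by blast
    then have "\<gamma> (n, a, b) x = w" using FG_pow[OF \<sigma>] by (simp add: \<gamma>_def)
    then show "\<exists>i. \<gamma> (from_nat i) x = w" by (metis from_nat_to_nat)
  qed (use N \<gamma> in auto)
qed

text \<open>Points are matched greedily along a countable family generating \<^term>\<open>E\<close>. The unmatched parts of the
  two sets have equal measure and disjoint saturations, so by ergodicity they are null.\<close>

lemma equimeasurable_equivalent:
  assumes A: "A \<in> sets M" and B: "B \<in> sets M" and AB: "measure M A = measure M B"
  shows "\<exists>f\<in>FG. measure M {x \<in> A. f x \<in> B} = measure M A"
proof -
  obtain N and \<gamma> :: "nat \<Rightarrow> 'a \<Rightarrow> 'a" where N: "N \<in> null_sets M" and \<gamma>: "\<And>i. \<gamma> i \<in> FG" and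
    cov: "\<And>x w. x \<in> space M - N \<Longrightarrow> w \<in> space M - N \<Longrightarrow> (x, w) \<in> E \<Longrightarrow> \<exists>i. \<gamma> i x = w"
    by (rule countable_generators) blast
  \<comment> \<open>The pair holds the parts still unmatched. Starting with the differences of
    \<open>A\<close> and \<open>B\<close> makes sources and targets disjoint, so the matching
    extends to an automorphism exchanging them; points of \<open>A \<inter> B\<close> stay
    fixed.\<close>
  define R where "R = rec_nat (A - B - N, B - A - N)
    (\<lambda>i (P, Q). (P - (P \<inter> \<gamma> i -` Q), Q - \<gamma> i ` (P \<inter> \<gamma> i -` Q)))"
  define P Q where "P i = fst (R i)" and "Q i = snd (R i)" for i
  define C where "C i = P i \<inter> \<gamma> i -` Q i" for i
  have P0: "P 0 = A - B - N" "Q 0 = B - A - N" by (auto simp: P_def Q_def R_def)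
  have PS: "P (Suc i) = P i - C i" "Q (Suc i) = Q i - \<gamma> i ` C i" for i
    by (auto simp: P_def Q_def R_def C_def split: prod.splits)
  have Nm: "N \<in> sets M" using N by auto
  have meas: "P i \<in> sets M \<and> Q i \<in> sets M" for i
  proof (induction i)
    case (Suc i)
    then have "C i \<in> sets M" using \<gamma> by (auto simp: C_def)
    then show ?case using Suc \<gamma> by (auto simp: PS)
  qed (use A B Nm P0 in auto)
  then have Pm: "P i \<in> sets M" and Qm: "Q i \<in> sets M" for i by auto
  have Cm: "C i \<in> sets M" for i unfolding C_def by (intro sets.Int FG_vimage_sets Pm Qm \<gamma>)
  have CP: "C i \<subseteq> P i" "\<gamma> i ` C i \<subseteq> Q i" for i by (auto simp: C_def)
  have dec: "decseq P" "decseq Q" by (auto intro!: decseq_SucI simp: PS)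
  have Pj: "P j \<subseteq> P i - C i" "Q j \<subseteq> Q i - \<gamma> i ` C i" if "i < j" for i j
    using dec that PS[of i] by (metis Suc_leI decseqD)+
  \<comment> \<open>The index \<open>(i, False)\<close> stands for \<open>C i\<close> and
    \<open>(i, True)\<close> for its image under \<open>\<gamma> i\<close>; negating the flag
    exchanges the two.\<close>
  define \<theta> where "\<theta> = (\<lambda>(i, b). if b then \<gamma> i else id)"
  define Z where "Z = (\<lambda>(i::nat, b::bool). C i)"
  have PA: "P i \<subseteq> A - B" "Q i \<subseteq> B - A" for i
    using dec P0 decseqD[OF dec(1), of 0 i] decseqD[OF dec(2), of 0 i] by auto
  have dC: "C i \<inter> C j = {}" "\<gamma> i ` C i \<inter> \<gamma> j ` C j = {}" if "i \<noteq> j" for i j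
    using that Pj[of i j] Pj[of j i] CP[of i] CP[of j] by (cases i j rule: linorder_cases; blast)+
  have dAB: "C i \<inter> \<gamma> j ` C j = {}" for i j using CP[of i] CP[of j] PA[of i] PA[of j] by blast
  have tow: "tower \<theta> Z UNIV"
    unfolding tower_def
  proof (intro conjI ballI impI)
    show "\<theta> l \<in> FG" "Z l \<in> sets M" for l using \<gamma> FG_id Cm by (auto simp: \<theta>_def Z_def split: prod.split)
    fix l m :: "nat \<times> bool" assume "l \<noteq> m"
    then show "\<theta> l ` Z l \<inter> \<theta> m ` Z m = {}"
      using dC dAB by (cases l; cases m) (auto simp: \<theta>_def Z_def, blast+)
  qed auto
  define f where "f = blk \<theta> Z UNIV (\<lambda>(i, b). (i, \<not> b))"
  have f: "f \<in> FG"
    unfolding f_def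
  proof (rule blk_FG[OF tow])
    show "bij_betw (\<lambda>(i, b). (i, \<not> b)) UNIV (UNIV :: (nat \<times> bool) set)"
      by (rule o_bij[of "\<lambda>(i, b). (i, \<not> b)"]) auto
  qed (auto simp: Z_def)
  have fC: "f x = \<gamma> i x" if "x \<in> C i" for i x
    using blk_app[OF tow, of "(i, False)" x "\<lambda>(i, b). (i, \<not> b)"] that by (simp add: f_def \<theta>_def Z_def)
  have fid: "f x = x" if "x \<in> A \<inter> B" for x
    unfolding f_def
  proof (rule blk_out)
    fix l :: "nat \<times> bool"
    show "x \<notin> \<theta> l ` Z l" using that CP[of "fst l"] PA[of "fst l"] by (cases l) (auto simp: \<theta>_def Z_def)
  qed
  have eqm: "measure M (P i) = measure M (Q i)" for i
  proof (induction i)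
    case 0
    have "measure M (A - B - N) = measure M (A - B)" "measure M (B - A - N) = measure M (B - A)"
      using A B N by (auto intro!: measure_Diff_null_set)
    moreover have "measure M (A - B) = measure M A - measure M (A \<inter> B)"
      "measure M (B - A) = measure M B - measure M (A \<inter> B)"
      using A B by (auto simp: finite_measure_Diff' Int_commute)
    ultimately show ?case using AB P0 by simp
  next
    case (Suc i)
    have "measure M (P i - C i) = measure M (P i) - measure M (C i)"
      using CP Pm Cm by (intro finite_measure_Diff) auto
    moreover have "measure M (Q i - \<gamma> i ` C i) = measure M (Q i) - measure M (\<gamma> i ` C i)"
      using CP Qm Cm \<gamma> by (intro finite_measure_Diff) auto
    ultimately show ?case using Suc FG_measure[OF \<gamma> Cm] by (simp add: PS)
  qed
  define P' Q' where "P' = (\<Inter>i. P i)" and "Q' = (\<Inter>i. Q i)"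
  have P'm: "P' \<in> sets M" "Q' \<in> sets M" using Pm Qm by (auto simp: P'_def Q'_def)
  have "(\<lambda>i. measure M (P i)) \<longlonglongrightarrow> measure M P'" "(\<lambda>i. measure M (Q i)) \<longlonglongrightarrow> measure M Q'"
    unfolding P'_def Q'_def using Pm Qm dec by (auto intro!: finite_Lim_measure_decseq)
  then have PQ': "measure M P' = measure M Q'" using eqm LIMSEQ_unique by simp
  have sep: "E `` P' \<inter> Q' = {}"
  proof (rule ccontr)
    assume "E `` P' \<inter> Q' \<noteq> {}"
    then obtain x w where xw: "x \<in> P'" "w \<in> Q'" "(x, w) \<in> E" by blast
    have "x \<in> P 0" "w \<in> Q 0" using xw by (auto simp: P'_def Q'_def)
    then have "x \<in> space M - N" "w \<in> space M - N"
      using P0 sets.sets_into_space[OF A] sets.sets_into_space[OF B] by auto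
    then obtain i where i: "\<gamma> i x = w" using cov xw(3) by blast
    then have "x \<in> C i" using xw by (auto simp: C_def P'_def Q'_def)
    moreover have "x \<in> P (Suc i)" using xw by (auto simp: P'_def)
    ultimately show False by (simp add: PS)
  qed
  have P'0: "measure M P' = 0"
  proof (rule ccontr)
    assume ne: "measure M P' \<noteq> 0"
    obtain W where W: "W \<in> sets M" "E `` W = W" "P' \<subseteq> W" "W \<inter> Q' = {}"
      using invariant_separation[OF E_equiv E_sets P'm sep] by blast
    have "0 < measure M P'" using ne by (simp add: zero_less_measure_iff)
    then have "0 < measure M W" using finite_measure_mono[OF W(3,1)] by linarith
    then have "emeasure M W \<noteq> 0" by (simp add: emeasure_eq_measure)
    then have "emeasure M W = 1" using ergE W(1,2) unfolding ergodic_rel_def by blast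
    then have "measure M W = 1" by (simp add: measure_def)
    moreover have "measure M (W \<union> Q') = measure M W + measure M Q'"
      using W P'm by (intro finite_measure_Union) auto
    ultimately have "measure M Q' \<le> 0" using prob_le_1[of "W \<union> Q'"] by simp
    then show False using ne PQ' measure_nonneg[of M Q'] by linarith
  qed
  have Am: "{x \<in> A. f x \<in> B} \<in> sets M"
  proof -
    have "{x \<in> A. f x \<in> B} = A \<inter> f -` B" by auto
    then show ?thesis using A B f by auto
  qed
  have "A \<subseteq> {x \<in> A. f x \<in> B} \<union> (N \<union> P')"
  proof
    fix x assume x: "x \<in> A"
    show "x \<in> {x \<in> A. f x \<in> B} \<union> (N \<union> P')"
    proof (cases "x \<in> B \<or> x \<in> N \<or> x \<in> P'")
      case True
      then show ?thesis using x fid[of x] by auto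
    next
      case False
      then have x0: "x \<in> P 0" using x P0 by simp
      have "\<exists>i. x \<in> C i"
      proof (rule ccontr)
        assume "\<nexists>i. x \<in> C i"
        then have "x \<in> P i" for i by (induction i) (use x0 PS in auto)
        then show False using False by (auto simp: P'_def)
      qed
      then obtain i where i: "x \<in> C i" by blast
      then have "f x \<in> \<gamma> i ` C i" using fC by auto
      then have "f x \<in> B" using CP[of i] PA[of i] by blast
      then show ?thesis using x by blast
    qed
  qed
  then have "measure M A \<le> measure M ({x \<in> A. f x \<in> B} \<union> (N \<union> P'))"
    using Am Nm P'm by (intro finite_measure_mono) auto
  also have "\<dots> \<le> measure M {x \<in> A. f x \<in> B} + measure M (N \<union> P')"
    using Am Nm P'm by (intro measure_Un_le) auto
  also have "measure M (N \<union> P') \<le> measure M N + measure M P'" using Nm P'm by (intro measure_Un_le) auto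
  also have "measure M N = 0" using N by (simp add: null_sets_def measure_def)
  finally have "measure M A \<le> measure M {x \<in> A. f x \<in> B}" using P'0 by simp
  moreover have "measure M {x \<in> A. f x \<in> B} \<le> measure M A" using A by (intro finite_measure_mono) auto
  ultimately show ?thesis using f by (intro bexI[of _ f]) auto
qed

lemma cut_pieces:
  assumes A: "A \<in> sets M" and \<delta>: "0 \<le> \<delta>" "real m * \<delta> \<le> measure M A"
  shows "\<exists>P. (\<forall>c<m. P c \<in> sets M \<and> P c \<subseteq> A \<and> measure M (P c) = \<delta>) \<and>
    (\<forall>c<m. \<forall>c'<m. c \<noteq> c' \<longrightarrow> P c \<inter> P c' = {})"
  using \<delta>(2)
proof (induction m)
  case (Suc m)
  have "real m * \<delta> \<le> measure M A" using Suc.prems \<delta>(1) by (simp add: algebra_simps)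
  from Suc.IH[OF this] obtain P where "(\<forall>c<m. P c \<in> sets M \<and> P c \<subseteq> A \<and> measure M (P c) = \<delta>) \<and>
    (\<forall>c<m. \<forall>c'<m. c \<noteq> c' \<longrightarrow> P c \<inter> P c' = {})" by (rule exE)
  then have P: "\<And>c. c < m \<Longrightarrow> P c \<in> sets M" "\<And>c. c < m \<Longrightarrow> P c \<subseteq> A" "\<And>c. c < m \<Longrightarrow> measure M (P c) = \<delta>"
    "\<And>c c'. c < m \<Longrightarrow> c' < m \<Longrightarrow> c \<noteq> c' \<Longrightarrow> P c \<inter> P c' = {}"
    by simp_all
  have "measure M (\<Union>c<m. P c) = (\<Sum>c<m. measure M (P c))"
    using P by (intro finite_measure_finite_Union) (auto simp: disjoint_family_on_def)
  also have "\<dots> = real m * \<delta>" using P by simp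
  finally have mU: "measure M (\<Union>c<m. P c) = real m * \<delta>" .
  have Um: "(\<Union>c<m. P c) \<in> sets M" "(\<Union>c<m. P c) \<subseteq> A" using P by auto
  have "measure M (A - (\<Union>c<m. P c)) = measure M A - real m * \<delta>"
    using finite_measure_Diff[OF A Um] mU by simp
  then have "\<delta> \<le> measure M (A - (\<Union>c<m. P c))" using Suc.prems by (simp add: algebra_simps)
  then obtain C where C: "C \<in> sets M" "C \<subseteq> A - (\<Union>c<m. P c)" "measure M C = \<delta>"
    using nonatomic_cut[OF na _ \<delta>(1)] A Um by (metis sets.Diff)
  show ?case
    by (rule exI[of _ "P(m := C)"]) (use P C in \<open>auto simp: less_Suc_eq\<close>)
qed simp

end

section \<open>Towers approximating elements of the full group\<close>

text \<open>The complements of \<open>D\<close> and of its image in \<open>J\<close> have the same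
  size, so any bijection between them completes \<open>\<rho>\<close>.\<close>

lemma extend_to_permutation:
  assumes "finite J" "D \<subseteq> J" "\<rho> ` D \<subseteq> J" "inj_on \<rho> D"
  shows "\<exists>p. p permutes J \<and> (\<forall>l\<in>D. p l = \<rho> l)"
proof -
  have "card (J - D) = card (J - \<rho> ` D)"
    using assms by (simp add: card_Diff_subset finite_subset card_image)
  then obtain h where h: "bij_betw h (J - D) (J - \<rho> ` D)"
    using assms(1) finite_same_card_bij[of "J - D" "J - \<rho> ` D"] by auto
  define p where "p l = (if l \<in> D then \<rho> l else if l \<in> J then h l else l)" for l
  have "bij_betw p D (\<rho> ` D)" using assms(4) by (auto simp: p_def bij_betw_def inj_on_def)
  moreover have "bij_betw p (J - D) (J - \<rho> ` D)"
    using h by (subst bij_betw_cong[of _ p h]) (auto simp: p_def)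
  ultimately have "bij_betw p (D \<union> (J - D)) (\<rho> ` D \<union> (J - \<rho> ` D))"
    by (rule bij_betw_combine) auto
  moreover have "D \<union> (J - D) = J" "\<rho> ` D \<union> (J - \<rho> ` D) = J" using assms by auto
  ultimately have "bij_betw p J J" by simp
  then have "p permutes J" by (rule bij_imp_permutes) (use assms(2) in \<open>auto simp: p_def\<close>)
  then show ?thesis by (auto simp: p_def)
qed

section \<open>Distances, rigid pieces and the construction of one tower\<close>

context hyperfinite_setting
begin

text \<open>The distance of \<open>uniform_dist\<close> on maps instead of classes, so that no
  choice of representatives enters the estimates.\<close>

definition udist :: "('a \<Rightarrow> 'a) \<Rightarrow> ('a \<Rightarrow> 'a) \<Rightarrow> real" where
  "udist f g = measure M {x \<in> space M. f x \<noteq> g x}"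

lemma neq_sets: "f \<in> measurable M M \<Longrightarrow> g \<in> measurable M M \<Longrightarrow> {x \<in> space M. f x \<noteq> g x} \<in> sets M"
  by (rule sets_noteq[OF std])

lemma eq_sets: assumes "f \<in> measurable M M" "g \<in> measurable M M" shows "{x \<in> space M. f x = g x} \<in> sets M"
proof -
  have "{x \<in> space M. f x = g x} = space M - {x \<in> space M. f x \<noteq> g x}" by auto
  then show ?thesis using neq_sets[OF assms] by simp
qed

lemma udist_triangle:
  assumes "f \<in> measurable M M" "g \<in> measurable M M" "h \<in> measurable M M"
  shows "udist f h \<le> udist f g + udist g h"
proof -
  have "udist f h \<le> measure M ({x \<in> space M. f x \<noteq> g x} \<union> {x \<in> space M. g x \<noteq> h x})"
    unfolding udist_def using assms by (intro finite_measure_mono sets.Un neq_sets) auto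
  also have "\<dots> \<le> udist f g + udist g h" unfolding udist_def using assms by (intro measure_Un_le neq_sets)
  finally show ?thesis .
qed

lemma udist_commute: "udist f g = udist g f"
  by (simp add: udist_def eq_commute)

lemma measure_UN_le:
  fixes c :: real
  assumes "finite I" "\<And>i. i \<in> I \<Longrightarrow> A i \<in> sets M" "\<And>i. i \<in> I \<Longrightarrow> measure M (A i) \<le> c"
  shows "measure M (\<Union>i\<in>I. A i) \<le> real (card I) * c"
proof -
  have "measure M (\<Union>i\<in>I. A i) \<le> (\<Sum>i\<in>I. measure M (A i))"
    using assms by (intro measure_UNION_le) auto
  also have "\<dots> \<le> real (card I) * c" using assms(3) sum_bounded_above[of I "\<lambda>i. measure M (A i)" c] by simp
  finally show ?thesis .
qed

lemma incseq_UN_lessThan: "incseq (\<lambda>n. \<Union>i<n. A i)" for A :: "nat \<Rightarrow> 'b set"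
  by (rule incseq_SucI) (auto simp: lessThan_Suc)

text \<open>Think of \<open>W \<theta>\<close> as the part of a transversal of type
  \<open>\<theta>\<close> and of \<open>A \<theta>\<close> as the exponents bringing it into
  \<open>B\<close>. Each \<open>W \<theta>\<close> is cut into pieces of measure
  \<open>\<delta>\<close>, with a remainder of measure at most \<open>\<delta>\<close>. Their
  translates are disjoint subsets of \<open>B\<close>, and since \<open>B\<close> has measure
  \<open>n * \<delta>\<close>, further pieces of the same measure complete them to \<open>n\<close>.
  Sets of equal measure being equivalent, one base \<open>Z\<close> can be carried to all of
  them.\<close>

lemma translate_pieces:
  fixes W :: "'t \<Rightarrow> 'a set" and A :: "'t \<Rightarrow> nat set" and g :: "nat \<Rightarrow> 'a \<Rightarrow> 'a"
  assumes B: "B \<in> sets M" "measure M B = real n * \<delta>" and \<delta>: "0 < \<delta>" and n: "0 < n"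
    and \<Theta>: "finite \<Theta>" and W: "\<And>\<theta>. \<theta> \<in> \<Theta> \<Longrightarrow> W \<theta> \<in> sets M" and A: "\<And>\<theta>. \<theta> \<in> \<Theta> \<Longrightarrow> finite (A \<theta>)"
    and g: "\<And>a. g a \<in> FG" and gB: "\<And>\<theta> a y. \<theta> \<in> \<Theta> \<Longrightarrow> a \<in> A \<theta> \<Longrightarrow> y \<in> W \<theta> \<Longrightarrow> g a y \<in> B"
    and disj: "\<And>\<theta> \<theta>' a a' y y'. \<theta> \<in> \<Theta> \<Longrightarrow> \<theta>' \<in> \<Theta> \<Longrightarrow> a \<in> A \<theta> \<Longrightarrow> a' \<in> A \<theta>' \<Longrightarrow> y \<in> W \<theta> \<Longrightarrow>
      y' \<in> W \<theta>' \<Longrightarrow> g a y = g a' y' \<Longrightarrow> \<theta> = \<theta>' \<and> a = a' \<and> y = y'"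
  shows "\<exists>h Z bad. Z \<in> sets M \<and> measure M Z = \<delta> \<and> tower h (\<lambda>_. Z) {..<n} \<and> (\<forall>j<n. h j ` Z \<subseteq> B) \<and>
    (\<forall>\<theta>\<in>\<Theta>. bad \<theta> \<in> sets M \<and> measure M (bad \<theta>) \<le> \<delta> \<and> (\<forall>y\<in>W \<theta> - bad \<theta>. \<exists>\<psi>. (\<exists>z\<in>Z. y = \<psi> z) \<and>
      \<psi> ` Z \<subseteq> W \<theta> \<and> (\<forall>a\<in>A \<theta>. \<exists>j<n. \<forall>z\<in>Z. h j z = g a (\<psi> z))))"
proof -
  define m where "m \<theta> = nat \<lfloor>measure M (W \<theta>) / \<delta>\<rfloor>" for \<theta>
  have m: "real (m \<theta>) * \<delta> \<le> measure M (W \<theta>)" "measure M (W \<theta>) \<le> (real (m \<theta>) + 1) * \<delta>" for \<theta>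
  proof -
    have 0: "0 \<le> measure M (W \<theta>) / \<delta>" using \<delta> by simp
    then have "real (m \<theta>) \<le> measure M (W \<theta>) / \<delta>" "measure M (W \<theta>) / \<delta> \<le> real (m \<theta>) + 1"
      unfolding m_def by linarith+
    then show "real (m \<theta>) * \<delta> \<le> measure M (W \<theta>)" "measure M (W \<theta>) \<le> (real (m \<theta>) + 1) * \<delta>"
      using \<delta> by (simp_all add: field_simps)
  qed
  have "\<forall>\<theta>. \<exists>P. \<theta> \<in> \<Theta> \<longrightarrow> (\<forall>c<m \<theta>. P c \<in> sets M \<and> P c \<subseteq> W \<theta> \<and> measure M (P c) = \<delta>) \<and>
    (\<forall>c<m \<theta>. \<forall>c'<m \<theta>. c \<noteq> c' \<longrightarrow> P c \<inter> P c' = {})"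
    using cut_pieces[OF W less_imp_le[OF \<delta>] m(1)] by auto
  then obtain P where P0: "\<forall>\<theta>. \<theta> \<in> \<Theta> \<longrightarrow> (\<forall>c<m \<theta>. P \<theta> c \<in> sets M \<and> P \<theta> c \<subseteq> W \<theta> \<and> measure M (P \<theta> c) = \<delta>) \<and>
    (\<forall>c<m \<theta>. \<forall>c'<m \<theta>. c \<noteq> c' \<longrightarrow> P \<theta> c \<inter> P \<theta> c' = {})" by (rule choice[THEN exE])
  have P: "P \<theta> c \<in> sets M" "P \<theta> c \<subseteq> W \<theta>" "measure M (P \<theta> c) = \<delta>" if "\<theta> \<in> \<Theta>" "c < m \<theta>" for \<theta> c
    using P0 that by simp_all
  have Pd: "c = c'" if "\<theta> \<in> \<Theta>" "c < m \<theta>" "c' < m \<theta>" "y \<in> P \<theta> c" "y \<in> P \<theta> c'" for \<theta> c c' y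
  proof (rule ccontr)
    assume "c \<noteq> c'"
    then have "P \<theta> c \<inter> P \<theta> c' = {}" using P0 that by simp
    then show False using that by blast
  qed
  define K where "K = (SIGMA \<theta>:\<Theta>. {..<m \<theta>} \<times> A \<theta>)"
  have fK: "finite K" unfolding K_def using \<Theta> A by auto
  define Q where "Q = (\<lambda>(\<theta>, c, a). g a ` P \<theta> c)"
  have Qm: "Q l \<in> sets M" "Q l \<subseteq> B" "measure M (Q l) = \<delta>" if "l \<in> K" for l
  proof -
    obtain \<theta> c a where l: "l = (\<theta>, c, a)" by (cases l)
    have k: "\<theta> \<in> \<Theta>" "c < m \<theta>" "a \<in> A \<theta>" using that by (auto simp: K_def l)
    show "Q l \<in> sets M" using P[OF k(1,2)] g by (auto simp: Q_def l)
    show "Q l \<subseteq> B" using P(2)[OF k(1,2)] gB[OF k(1,3)] by (auto simp: Q_def l)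
    show "measure M (Q l) = \<delta>" using P[OF k(1,2)] FG_measure[OF g] by (simp add: Q_def l)
  qed
  have Qd: "l = l'" if l: "l \<in> K" "l' \<in> K" "x \<in> Q l" "x \<in> Q l'" for l l' x
  proof -
    obtain \<theta> c a where e: "l = (\<theta>, c, a)" by (cases l)
    obtain \<theta>' c' a' where e': "l' = (\<theta>', c', a')" by (cases l')
    have k: "\<theta> \<in> \<Theta>" "c < m \<theta>" "a \<in> A \<theta>" "\<theta>' \<in> \<Theta>" "c' < m \<theta>'" "a' \<in> A \<theta>'"
      using l(1,2) by (auto simp: K_def e e')
    obtain y y' where y: "y \<in> P \<theta> c" "x = g a y" "y' \<in> P \<theta>' c'" "x = g a' y'"
      using l(3,4) by (auto simp: Q_def e e')
    have "\<theta> = \<theta>' \<and> a = a' \<and> y = y'"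
      using disj[OF k(1,4,3,6), of y y'] P(2)[OF k(1,2)] P(2)[OF k(4,5)] y by auto
    then show ?thesis using Pd[of \<theta> c c' y] k y e e' by auto
  qed
  have "measure M (\<Union>l\<in>K. Q l) = (\<Sum>l\<in>K. measure M (Q l))"
    using fK Qm Qd by (intro finite_measure_finite_Union) (auto simp: disjoint_family_on_def)
  then have mQ: "measure M (\<Union>l\<in>K. Q l) = real (card K) * \<delta>" using Qm by simp
  have Qs: "(\<Union>l\<in>K. Q l) \<in> sets M" using fK Qm by auto
  have QB: "(\<Union>l\<in>K. Q l) \<subseteq> B" by (rule UN_least[OF Qm(2)])
  have "real (card K) * \<delta> \<le> real n * \<delta>"
    using finite_measure_mono[OF QB B(1)] mQ B(2) by simp
  then have Kn: "card K \<le> n" using \<delta> by simp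
  define r where "r = n - card K"
  have "measure M (B - (\<Union>l\<in>K. Q l)) = real r * \<delta>"
    using finite_measure_Diff[OF B(1) Qs QB] mQ B(2) Kn by (simp add: r_def algebra_simps of_nat_diff)
  then have rm: "real r * \<delta> \<le> measure M (B - (\<Union>l\<in>K. Q l))" by simp
  obtain P' where P'0: "(\<forall>c<r. P' c \<in> sets M \<and> P' c \<subseteq> B - (\<Union>l\<in>K. Q l) \<and> measure M (P' c) = \<delta>) \<and>
    (\<forall>c<r. \<forall>c'<r. c \<noteq> c' \<longrightarrow> P' c \<inter> P' c' = {})"
    using cut_pieces[OF sets.Diff[OF B(1) Qs] less_imp_le[OF \<delta>] rm] by (rule exE)
  have P': "P' c \<in> sets M" "P' c \<subseteq> B - (\<Union>l\<in>K. Q l)" "measure M (P' c) = \<delta>" if "c < r" for c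
    using P'0 that by simp_all
  have P'd: "c = c'" if "c < r" "c' < r" "y \<in> P' c" "y \<in> P' c'" for c c' y
  proof (rule ccontr)
    assume "c \<noteq> c'"
    then have "P' c \<inter> P' c' = {}" using P'0 that by simp
    then show False using that by blast
  qed
  have "\<delta> \<le> measure M B" using B(2) \<delta> n by (simp add: mult_le_cancel_right1)
  then obtain Z0 where Z0: "Z0 \<in> sets M" "measure M Z0 = \<delta>"
    using nonatomic_cut[OF na B(1), of \<delta>] \<delta> by auto
  have "\<exists>f. S \<in> sets M \<longrightarrow> measure M S = \<delta> \<longrightarrow> f \<in> FG \<and> measure M {x \<in> Z0. f x \<in> S} = \<delta>" for S
    using equimeasurable_equivalent[OF Z0(1), of S] Z0(2) by auto
  then have "\<exists>F. \<forall>S. S \<in> sets M \<longrightarrow> measure M S = \<delta> \<longrightarrow> F S \<in> FG \<and> measure M {x \<in> Z0. F S x \<in> S} = \<delta>"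
    by (intro choice allI)
  then obtain F where F0: "\<forall>S. S \<in> sets M \<longrightarrow> measure M S = \<delta> \<longrightarrow> F S \<in> FG \<and> measure M {x \<in> Z0. F S x \<in> S} = \<delta>"
    by (rule exE)
  have F: "F S \<in> FG" "measure M {x \<in> Z0. F S x \<in> S} = \<delta>" if "S \<in> sets M" "measure M S = \<delta>" for S
    using F0 that by simp_all
  define SS where "SS = (\<lambda>(\<theta>, c). P \<theta> c) ` (SIGMA \<theta>:\<Theta>. {..<m \<theta>}) \<union> P' ` {..<r}"
  have SS: "finite SS" "\<And>S. S \<in> SS \<Longrightarrow> S \<in> sets M" "\<And>S. S \<in> SS \<Longrightarrow> measure M S = \<delta>"
    unfolding SS_def using \<Theta> P P' by auto
  \<comment> \<open>The finitely many matchings are exact only up to null sets; these are removed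
    from the base at once.\<close>
  define Z where "Z = Z0 - (\<Union>S\<in>SS. {x \<in> Z0. F S x \<notin> S})"
  have nul: "{x \<in> Z0. F S x \<notin> S} \<in> null_sets M" if "S \<in> SS" for S
  proof -
    have s1: "{x \<in> Z0. F S x \<in> S} \<in> sets M"
    proof -
      have "{x \<in> Z0. F S x \<in> S} = Z0 \<inter> F S -` S" by auto
      then show ?thesis using Z0(1) FG_vimage_sets[OF F(1)] SS(2,3) that by auto
    qed
    have eq: "{x \<in> Z0. F S x \<notin> S} = Z0 - {x \<in> Z0. F S x \<in> S}" by auto
    have "measure M (Z0 - {x \<in> Z0. F S x \<in> S}) = 0"
      using finite_measure_Diff[OF Z0(1) s1] F(2) SS(2,3) that Z0(2) by auto
    then show ?thesis using Z0(1) s1 unfolding eq by (auto simp: null_sets_def emeasure_eq_measure)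
  qed
  have nulU: "(\<Union>S\<in>SS. {x \<in> Z0. F S x \<notin> S}) \<in> null_sets M"
    using SS(1) nul by (intro null_sets_UN') (auto intro: countable_finite)
  have Zm: "Z \<in> sets M" "measure M Z = \<delta>"
    unfolding Z_def using Z0 nulU by (auto simp: measure_Diff_null_set)
  have ZS: "F S z \<in> S" if "S \<in> SS" "z \<in> Z" for S z using that by (auto simp: Z_def)
  define J where "J = Inl ` K \<union> Inr ` {..<r}"
  have J: "finite J" "card J = n"
  proof -
    show "finite J" unfolding J_def using fK by simp
    have "card J = card (Inl ` K :: (('t \<times> nat \<times> nat) + nat) set) + card (Inr ` {..<r} :: (('t \<times> nat \<times> nat) + nat) set)"
      unfolding J_def using fK by (intro card_Un_disjoint) auto
    also have "\<dots> = card K + r" by (simp add: card_image)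
    finally show "card J = n" using Kn by (simp add: r_def)
  qed
  then obtain e where e: "bij_betw e {..<n} J" using ex_bij_betw_nat_finite[OF J(1)] by (auto simp: atLeast0LessThan)
  \<comment> \<open>All translates of a piece are reached through the same map
    \<open>F (P \<theta> c)\<close>. Hence the maps \<open>g a\<close> relate the corresponding
    levels pointwise and not merely as sets.\<close>
  define h' where "h' l = (case l of Inl (\<theta>, c, a) \<Rightarrow> g a \<circ> F (P \<theta> c) | Inr c \<Rightarrow> F (P' c))" for l
  define Q' where "Q' l = (case l of Inl l \<Rightarrow> Q l | Inr c \<Rightarrow> P' c)" for l
  have PS: "P \<theta> c \<in> SS" if "\<theta> \<in> \<Theta>" "c < m \<theta>" for \<theta> c using that unfolding SS_def by force
  have P'S: "P' c \<in> SS" if "c < r" for c using that unfolding SS_def by force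
  have h'FG: "h' l \<in> FG" if "l \<in> J" for l
    using that P P' F g by (auto simp: J_def h'_def K_def intro!: FG_comp)
  have h'Q: "h' l z \<in> Q' l" if "l \<in> J" "z \<in> Z" for l z
    using that ZS PS P'S by (auto simp: J_def h'_def Q'_def Q_def K_def)
  have Q'B: "Q' l \<subseteq> B" if "l \<in> J" for l
  proof (cases l)
    case (Inl l0)
    then show ?thesis using that Qm(2)[of l0] by (auto simp: J_def Q'_def)
  next
    case (Inr c)
    then have "c < r" using that by (auto simp: J_def)
    then show ?thesis using P'(2)[of c] Inr by (auto simp: Q'_def)
  qed
  have Q'd: "l = l'" if l: "l \<in> J" "l' \<in> J" "x \<in> Q' l" "x \<in> Q' l'" for l l' x
  proof -
    have x1: False if "l1 \<in> K" "c < r" "x \<in> Q l1" "x \<in> P' c" for l1 c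
      using P'(2)[OF that(2)] that by blast
    show ?thesis using l Qd P'd x1 by (auto simp: J_def Q'_def)
  qed
  define h where "h j = h' (e j)" for j
  have ej: "e j \<in> J" if "j < n" for j using e that bij_betwE by blast
  have tow: "tower h (\<lambda>_. Z) {..<n}"
    unfolding tower_def
  proof (intro conjI ballI impI)
    fix i j assume ij: "i \<in> {..<n}" "j \<in> {..<n}" "i \<noteq> j"
    then have "e i \<noteq> e j" using e by (auto simp: bij_betw_def inj_on_def)
    then have "x \<notin> Q' (e j)" if "x \<in> Q' (e i)" for x using Q'd ej ij that by blast
    moreover have "h i ` Z \<subseteq> Q' (e i)" "h j ` Z \<subseteq> Q' (e j)" using h'Q ej ij by (auto simp: h_def)
    ultimately show "h i ` Z \<inter> h j ` Z = {}" by blast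
  qed (use h'FG ej Zm in \<open>auto simp: h_def\<close>)
  define bad where "bad \<theta> = W \<theta> - (\<Union>c<m \<theta>. F (P \<theta> c) ` Z)" for \<theta>
  have bad: "bad \<theta> \<in> sets M" "measure M (bad \<theta>) \<le> \<delta>" if \<theta>: "\<theta> \<in> \<Theta>" for \<theta>
  proof -
    have Fs: "F (P \<theta> c) ` Z \<in> sets M" "measure M (F (P \<theta> c) ` Z) = \<delta>" "F (P \<theta> c) ` Z \<subseteq> P \<theta> c" if "c < m \<theta>" for c
      using F(1)[OF P(1,3)[OF \<theta> that]] Zm FG_measure ZS[OF PS[OF \<theta> that]] by auto
    have U: "(\<Union>c<m \<theta>. F (P \<theta> c) ` Z) \<in> sets M" using Fs(1) by auto
    have U2: "(\<Union>c<m \<theta>. F (P \<theta> c) ` Z) \<subseteq> W \<theta>"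
      by (rule UN_least, rule subset_trans[OF Fs(3) P(2)[OF \<theta>]]) auto
    have "measure M (\<Union>c<m \<theta>. F (P \<theta> c) ` Z) = (\<Sum>c<m \<theta>. measure M (F (P \<theta> c) ` Z))"
    proof (rule finite_measure_finite_Union)
      show "disjoint_family_on (\<lambda>c. F (P \<theta> c) ` Z) {..<m \<theta>}"
        unfolding disjoint_family_on_def
      proof (intro ballI impI)
        fix c c' assume c: "c \<in> {..<m \<theta>}" "c' \<in> {..<m \<theta>}" "c \<noteq> c'"
        then have "F (P \<theta> c) ` Z \<subseteq> P \<theta> c" "F (P \<theta> c') ` Z \<subseteq> P \<theta> c'" using Fs(3) by auto
        moreover have "y \<notin> P \<theta> c'" if "y \<in> P \<theta> c" for y using Pd[OF \<theta>, of c c' y] c that by auto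
        ultimately show "F (P \<theta> c) ` Z \<inter> F (P \<theta> c') ` Z = {}" by blast
      qed
    qed (use Fs in auto)
    also have "\<dots> = real (m \<theta>) * \<delta>" using Fs(2) by simp
    finally have "measure M (bad \<theta>) = measure M (W \<theta>) - real (m \<theta>) * \<delta>"
      unfolding bad_def using finite_measure_Diff[OF W[OF \<theta>] U U2] by simp
    then show "measure M (bad \<theta>) \<le> \<delta>" using m(2)[of \<theta>] by (simp add: algebra_simps)
    show "bad \<theta> \<in> sets M" unfolding bad_def using W[OF \<theta>] U by auto
  qed
  have main: "\<exists>\<psi>. (\<exists>z\<in>Z. y = \<psi> z) \<and> \<psi> ` Z \<subseteq> W \<theta> \<and> (\<forall>a\<in>A \<theta>. \<exists>j<n. \<forall>z\<in>Z. h j z = g a (\<psi> z))"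
    if \<theta>: "\<theta> \<in> \<Theta>" and y: "y \<in> W \<theta> - bad \<theta>" for \<theta> y
  proof -
    obtain c where c: "c < m \<theta>" "y \<in> F (P \<theta> c) ` Z" using y by (auto simp: bad_def)
    have "\<exists>j<n. \<forall>z\<in>Z. h j z = g a (F (P \<theta> c) z)" if a: "a \<in> A \<theta>" for a
    proof -
      have "Inl (\<theta>, c, a) \<in> J" using \<theta> c a by (auto simp: J_def K_def)
      then obtain j where "j < n" "e j = Inl (\<theta>, c, a)" using e unfolding bij_betw_def by (metis imageE lessThan_iff)
      then show ?thesis by (intro exI[of _ j]) (auto simp: h_def h'_def)
    qed
    moreover have "F (P \<theta> c) ` Z \<subseteq> W \<theta>" using ZS[OF PS[OF \<theta> c(1)]] P(2)[OF \<theta> c(1)] by blast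
    ultimately show ?thesis using c(2) by (intro exI[of _ "F (P \<theta> c)"]) auto
  qed
  have hB: "h j ` Z \<subseteq> B" if "j < n" for j
    using h'Q[OF ej[OF that]] Q'B[OF ej[OF that]] by (auto simp: h_def)
  show ?thesis
    by (intro exI[of _ h] exI[of _ Z] exI[of _ bad] conjI ballI allI impI) (use Zm tow hB bad main in blast)+
qed

text \<open>On the levels that \<open>f\<close> moves rigidly onto levels, the target is unique
  because levels are disjoint, and injectivity of \<open>f\<close> makes the partial map injective.
  It extends to a permutation.\<close>

lemma match_levels:
  assumes t: "tower \<theta> (\<lambda>_. Z) J" and J: "finite J" and Z: "Z \<noteq> {}" and f: "inj_on f (space M)" and Zm: "Z \<in> sets M"
  shows "\<exists>p. p permutes J \<and> (\<forall>l\<in>J. \<forall>l'\<in>J. (\<forall>z\<in>Z. f (\<theta> l z) = \<theta> l' z) \<longrightarrow> p l = l')"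
proof -
  define D where "D = {l \<in> J. \<exists>l'\<in>J. \<forall>z\<in>Z. f (\<theta> l z) = \<theta> l' z}"
  have "\<forall>l\<in>D. \<exists>l'. l' \<in> J \<and> (\<forall>z\<in>Z. f (\<theta> l z) = \<theta> l' z)" by (auto simp: D_def)
  then obtain \<rho> where \<rho>0: "\<forall>l\<in>D. \<rho> l \<in> J \<and> (\<forall>z\<in>Z. f (\<theta> l z) = \<theta> (\<rho> l) z)" by (rule bchoice[THEN exE])
  have \<rho>: "\<rho> l \<in> J" "z \<in> Z \<Longrightarrow> f (\<theta> l z) = \<theta> (\<rho> l) z" if "l \<in> D" for l z using \<rho>0 that by simp_all
  obtain z0 where z0: "z0 \<in> Z" using Z by blast
  have z0M: "z0 \<in> space M" using z0 sets.sets_into_space[OF Zm] by blast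
  have uniq: "l' = \<rho> l" if "l \<in> D" "l' \<in> J" "\<forall>z\<in>Z. f (\<theta> l z) = \<theta> l' z" for l l'
    using towerD(4)[OF t that(2) \<rho>(1)[OF that(1)] z0 z0] \<rho>(2)[OF that(1) z0] that(3) z0 by simp
  have "inj_on \<rho> D"
  proof (rule inj_onI)
    fix l l' assume l: "l \<in> D" "l' \<in> D" "\<rho> l = \<rho> l'"
    have lJ: "l \<in> J" "l' \<in> J" using l by (auto simp: D_def)
    have "f (\<theta> l z0) = f (\<theta> l' z0)" using \<rho>(2)[OF l(1) z0] \<rho>(2)[OF l(2) z0] l(3) by simp
    then have "\<theta> l z0 = \<theta> l' z0"
      using f towerD(2)[OF t] lJ z0M by (auto dest: inj_onD)
    then show "l = l'" using towerD(4)[OF t lJ z0 z0] by simp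
  qed
  then obtain p where p: "p permutes J" "\<forall>l\<in>D. p l = \<rho> l"
    using extend_to_permutation[OF J, of D \<rho>] \<rho>(1) by (auto simp: D_def)
  have "p l = l'" if "l \<in> J" "l' \<in> J" "\<forall>z\<in>Z. f (\<theta> l z) = \<theta> l' z" for l l'
  proof -
    have "l \<in> D" using that by (auto simp: D_def)
    then show ?thesis using p uniq that by simp
  qed
  then show ?thesis using p(1) by blast
qed

text \<open>So a tower of \<open>t\<close> with \<open>k\<close> levels over \<open>B\<close> and a tower of \<open>s\<close> with \<open>n\<close> levels inside \<open>B\<close> combine to a tower
  of \<open>s \<circ> t\<close> with \<open>k n\<close> levels.\<close>

lemma refine_pow:
  assumes t: "t \<in> FG" and disj: "\<And>i. 0 < i \<Longrightarrow> i < k \<Longrightarrow> (t ^^ i) ` B \<inter> B = {}"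
    and per: "\<And>x. x \<in> B \<Longrightarrow> (t ^^ k) x = x" and k: "0 < k"
    and sB: "\<And>x. x \<notin> B \<Longrightarrow> s x = x" and sin: "\<And>x. x \<in> B \<Longrightarrow> s x \<in> B"
    and x: "x \<in> B" and i: "i < k"
  shows "((s \<circ> t) ^^ (k * j + i)) x = (t ^^ i) ((s ^^ j) x)"
proof -
  have spow: "(s ^^ j) x \<in> B" for j using x by (induction j) (auto intro: sin)
  have low: "((s \<circ> t) ^^ i) y = (t ^^ i) y" if "y \<in> B" "i < k" for y i
    using that(2)
  proof (induction i)
    case (Suc i)
    have "t ((t ^^ i) y) \<notin> B" using disj[of "Suc i"] Suc.prems that(1) by auto
    then show ?case using Suc by (simp add: sB)
  qed simp
  have full: "((s \<circ> t) ^^ k) y = s y" if "y \<in> B" for y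
  proof -
    obtain k' where k': "k = Suc k'" using k by (cases k) auto
    show ?thesis using low[OF that, of k'] per[OF that] by (simp add: k')
  qed
  have kj: "((s \<circ> t) ^^ (k * j)) x = (s ^^ j) x" for j
  proof (induction j)
    case (Suc j)
    have "((s \<circ> t) ^^ (k * Suc j)) x = ((s \<circ> t) ^^ k) (((s \<circ> t) ^^ (k * j)) x)"
      by (simp only: mult_Suc_right funpow_add o_apply)
    also have "\<dots> = s ((s ^^ j) x)" by (simp only: Suc.IH full[OF spow])
    finally have "((s \<circ> t) ^^ (k * Suc j)) x = s ((s ^^ j) x)" .
    moreover have "(s ^^ Suc j) x = s ((s ^^ j) x)" by simp
    ultimately show ?case by (simp only:)
  qed simp
  have "((s \<circ> t) ^^ (k * j + i)) x = ((s \<circ> t) ^^ i) (((s \<circ> t) ^^ (k * j)) x)"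
    by (simp only: add.commute[of "k * j" i] funpow_add o_apply)
  then show ?thesis using kj low[OF spow[of j] i] by simp
qed

lemma cyclic_blk:
  assumes t: "tower h (\<lambda>_. Z) {..<n}" and n: "0 < n"
  defines "s \<equiv> blk h (\<lambda>_. Z) {..<n} (\<lambda>j. Suc j mod n)"
  shows "s \<in> FG" "z \<in> Z \<Longrightarrow> i < n \<Longrightarrow> (s ^^ j) (h i z) = h ((i + j) mod n) z"
proof -
  have bij: "bij_betw (\<lambda>j. Suc j mod n) {..<n} {..<n}"
  proof (rule bij_betw_imageI)
    show inj: "inj_on (\<lambda>j. Suc j mod n) {..<n}"
      by (rule inj_onI) (auto simp: mod_Suc split: if_splits)
    show "(\<lambda>j. Suc j mod n) ` {..<n} = {..<n}"
      by (rule endo_inj_surj[OF _ _ inj]) (use n in auto)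
  qed
  show "s \<in> FG" unfolding s_def by (rule blk_FG[OF t bij]) auto
  show "(s ^^ j) (h i z) = h ((i + j) mod n) z" if "z \<in> Z" "i < n"
  proof (induction j)
    case (Suc j)
    have "(i + j) mod n < n" using n by simp
    then show ?case using Suc that by (simp add: s_def blk_app[OF t] mod_Suc_eq)
  qed (use that in simp)
qed

text \<open>Representatives of all elements of the full group, with graph in \<open>E\<close> only
  almost everywhere. They are the elements to be approximated, whereas constructions take place in
  \<open>FG\<close>.\<close>

definition ae_full :: "('a \<Rightarrow> 'a) set" where
  "ae_full = {f \<in> mp_auts M. AE x in M. (x, f x) \<in> E}"

lemma FG_ae_full: "f \<in> FG \<Longrightarrow> f \<in> ae_full"
  using FG_mp FG_D(4) by (auto simp: ae_full_def)

text \<open>On most of the space, \<open>f\<close> stays within the classes of a finite subrelation, of bounded size. A transversal is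
  divided into finitely many types recording how \<open>f\<close> acts on the part of the tower above a class, and each type is
  cut into pieces of one small measure; the translates of these pieces, matched with each other, become the
  levels of the new tower.\<close>

lemma dye_step:
  assumes t: "t \<in> FG" and B: "B \<in> sets M" and k: "0 < k"
    and disj: "\<And>i j. i < k \<Longrightarrow> j < k \<Longrightarrow> i \<noteq> j \<Longrightarrow> (t ^^ i) ` B \<inter> (t ^^ j) ` B = {}"
    and per: "\<And>x. x \<in> B \<Longrightarrow> (t ^^ k) x = x" and mB: "measure M B = 1 / real k"
    and f: "f \<in> ae_full" and \<epsilon>: "0 < \<epsilon>"
  shows "\<exists>s B' n p. s \<in> FG \<and> (\<forall>x. x \<notin> B \<longrightarrow> s x = x) \<and> B' \<in> sets M \<and> B' \<subseteq> B \<and> L \<le> n \<and> 0 < n \<and>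
     measure M B' = 1 / real (k * n) \<and> tower (\<lambda>i. (s \<circ> t) ^^ i) (\<lambda>_. B') {..<k * n} \<and>
     (\<forall>x\<in>B'. ((s \<circ> t) ^^ (k * n)) x = x) \<and> p permutes {..<k * n} \<and>
     udist f (blk (\<lambda>i. (s \<circ> t) ^^ i) (\<lambda>_. B') {..<k * n} p) < \<epsilon>"
proof -
  have fm: "f \<in> measurable M M" and fmp: "distr M M f = M" and finj: "inj_on f (space M)"
    and fE: "AE x in M. (x, f x) \<in> E"
    using f mp_autsD[of f M] by (auto simp: ae_full_def bij_betw_def)
  have BM: "B \<subseteq> space M" using sets.sets_into_space[OF B] .
  obtain N0 :: "'a set" and \<sigma> :: "nat \<Rightarrow> 'a \<Rightarrow> 'a" and Y :: "nat \<Rightarrow> 'a set" where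
    N0: "N0 \<in> null_sets M" and \<sigma>: "\<And>n. \<sigma> n \<in> FG" and Y: "\<And>n. Y n \<in> sets M" and
    transv: "\<And>n a b y y'. y \<in> Y n \<Longrightarrow> y' \<in> Y n \<Longrightarrow> (\<sigma> n ^^ a) y = (\<sigma> n ^^ b) y' \<Longrightarrow> y = y'" and
    cov: "\<And>x w. x \<in> space M - N0 \<Longrightarrow> w \<in> space M - N0 \<Longrightarrow> (x, w) \<in> E \<Longrightarrow>
       \<exists>n0. \<forall>n\<ge>n0. \<exists>y\<in>Y n. \<exists>a b. x = (\<sigma> n ^^ a) y \<and> w = (\<sigma> n ^^ b) y"
    by (rule hyperfinite_structure) blast
  have tp: "t ^^ i \<in> FG" for i by (rule FG_pow[OF t])
  have sp: "\<sigma> n ^^ a \<in> FG" for n a by (rule FG_pow[OF \<sigma>])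
  \<comment> \<open>Several exponents may reach the same point; only the least one is used, so that
    no point of an orbit is counted twice.\<close>
  define fresh where "fresh n a y \<longleftrightarrow> (\<forall>a'<a. (\<sigma> n ^^ a') y \<noteq> (\<sigma> n ^^ a) y)" for n a y
  have fresh_ex: "\<exists>a'. fresh n a' y \<and> (\<sigma> n ^^ a') y = (\<sigma> n ^^ a) y" for n a y
  proof -
    define a' where "a' = (LEAST a'. (\<sigma> n ^^ a') y = (\<sigma> n ^^ a) y)"
    have e: "(\<sigma> n ^^ a') y = (\<sigma> n ^^ a) y" unfolding a'_def by (rule LeastI[of _ a]) simp
    have "(\<sigma> n ^^ b) y \<noteq> (\<sigma> n ^^ a') y" if "b < a'" for b
      using not_less_Least[of b "\<lambda>a'. (\<sigma> n ^^ a') y = (\<sigma> n ^^ a) y"] that e unfolding a'_def[symmetric] by simp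
    then show ?thesis using e unfolding fresh_def by blast
  qed
  have fresh_inj: "a = b" if "fresh n a y" "fresh n b y" "(\<sigma> n ^^ a) y = (\<sigma> n ^^ b) y" for n a b y
    using that unfolding fresh_def by (metis linorder_cases)
  have freshm: "{y \<in> Y n. fresh n a y} \<in> sets M" for n a
  proof -
    have "{y \<in> Y n. fresh n a y} = Y n \<inter> (\<Inter>a'\<in>{..<a}. {y \<in> space M. (\<sigma> n ^^ a') y \<noteq> (\<sigma> n ^^ a) y})" if "0 < a"
      using that sets.sets_into_space[OF Y[of n]] by (auto simp: fresh_def)
    moreover have "(\<Inter>a'\<in>{..<a}. {y \<in> space M. (\<sigma> n ^^ a') y \<noteq> (\<sigma> n ^^ a) y}) \<in> sets M" if "0 < a"
      using that by (intro sets.finite_INT neq_sets FG_D(2) sp) auto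
    moreover have "{y \<in> Y n. fresh n a y} = Y n" if "a = 0" using that by (auto simp: fresh_def)
    ultimately show ?thesis using Y[of n] by (cases "a = 0") auto
  qed
  \<comment> \<open>\<open>lv\<close> marks the exponents that represent points of the class in
    \<open>B\<close>. \<open>mv\<close> below records that \<open>f\<close> takes the
    \<open>i\<close>-th floor above the point of exponent \<open>a\<close> to the
    \<open>j\<close>-th floor above the point of exponent \<open>b\<close>.\<close>
  define lv where "lv n a y \<longleftrightarrow> fresh n a y \<and> (\<sigma> n ^^ a) y \<in> B" for n a y
  have lvm: "{y \<in> Y n. lv n a y} \<in> sets M" for n a
  proof -
    have "{y \<in> Y n. lv n a y} = {y \<in> Y n. fresh n a y} \<inter> (\<sigma> n ^^ a) -` B" by (auto simp: lv_def)
    then show ?thesis using freshm FG_vimage_sets[OF sp B] by auto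
  qed
  define mv where "mv n a i b j y \<longleftrightarrow> f ((t ^^ i) ((\<sigma> n ^^ a) y)) = (t ^^ j) ((\<sigma> n ^^ b) y)" for n a i b j y
  have mvm: "{y \<in> Y n. mv n a i b j y} \<in> sets M" for n a i b j
  proof -
    have "{y \<in> Y n. mv n a i b j y} = Y n \<inter> {y \<in> space M. (f \<circ> ((t ^^ i) \<circ> (\<sigma> n ^^ a))) y = ((t ^^ j) \<circ> (\<sigma> n ^^ b)) y}"
      using sets.sets_into_space[OF Y[of n]] by (auto simp: mv_def)
    moreover have "f \<circ> ((t ^^ i) \<circ> (\<sigma> n ^^ a)) \<in> measurable M M"
      by (rule measurable_comp[OF FG_D(2)[OF FG_comp[OF tp sp]] fm])
    then have "{y \<in> space M. (f \<circ> ((t ^^ i) \<circ> (\<sigma> n ^^ a))) y = ((t ^^ j) \<circ> (\<sigma> n ^^ b)) y} \<in> sets M"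
      by (rule eq_sets[OF _ FG_D(2)[OF FG_comp[OF tp sp]]])
    ultimately show ?thesis using sets.Int[OF Y] by (simp only:)
  qed
  define T where "T n R a i = {y \<in> Y n. lv n a y \<and> (\<exists>b<R. \<exists>j<k. lv n b y \<and> mv n a i b j y)}" for n R a i
  have Tm: "T n R a i \<in> sets M" for n R a i
  proof -
    have "T n R a i = {y \<in> Y n. lv n a y} \<inter> (\<Union>b<R. \<Union>j<k. {y \<in> Y n. lv n b y} \<inter> {y \<in> Y n. mv n a i b j y})"
      by (auto simp: T_def)
    then show ?thesis using lvm mvm by auto
  qed
  \<comment> \<open>On \<open>G n R\<close> the action of \<open>f\<close> is visible with exponents
    below \<open>R\<close>, that is, in a finite amount of data.\<close>
  define G where "G n R = (\<Union>a<R. \<Union>i<k. ((t ^^ i) \<circ> (\<sigma> n ^^ a)) ` T n R a i)" for n R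
  have Gm: "G n R \<in> sets M" for n R
    unfolding G_def using FG_image_sets[OF FG_comp[OF tp sp] Tm] by auto
  have Gmono: "G n R \<subseteq> G n R'" if "R \<le> R'" for n R R'
  proof
    fix x assume "x \<in> G n R"
    then obtain a i y where y: "a < R" "i < k" "y \<in> T n R a i" "x = ((t ^^ i) \<circ> (\<sigma> n ^^ a)) y"
      unfolding G_def by blast
    obtain b j where "y \<in> Y n" "lv n a y" "b < R" "j < k" "lv n b y" "mv n a i b j y"
      using y(3) unfolding T_def by blast
    moreover have "b < R'" "a < R'" using \<open>b < R\<close> y(1) that by auto
    ultimately have "y \<in> T n R' a i" unfolding T_def by blast
    then show "x \<in> G n R'" using y(2,4) \<open>a < R'\<close> unfolding G_def by blast
  qed
  \<comment> \<open>The \<open>k\<close> levels over \<open>B - N0\<close> are disjoint and have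
    measure \<open>1 / k\<close> each, so almost every point lies on one of them, and so does its
    image under \<open>f\<close>.\<close>
  define X1 where "X1 = (\<Union>i<k. (t ^^ i) ` (B - N0))"
  have X1m: "X1 \<in> sets M" unfolding X1_def using B N0 tp by auto
  have "measure M X1 = (\<Sum>i<k. measure M ((t ^^ i) ` (B - N0)))"
    unfolding X1_def
  proof (rule finite_measure_finite_Union)
    show "disjoint_family_on (\<lambda>i. (t ^^ i) ` (B - N0)) {..<k}"
      unfolding disjoint_family_on_def
    proof (intro ballI impI)
      fix i j assume "i \<in> {..<k}" "j \<in> {..<k}" "i \<noteq> j"
      then have "(t ^^ i) ` B \<inter> (t ^^ j) ` B = {}" using disj by simp
      then show "(t ^^ i) ` (B - N0) \<inter> (t ^^ j) ` (B - N0) = {}" by blast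
    qed
  qed (use B N0 tp in auto)
  also have "\<dots> = (\<Sum>i<k. 1 / real k)"
    using B N0 mB by (intro sum.cong refl, subst FG_measure[OF tp]) (auto simp: measure_Diff_null_set)
  finally have "prob X1 = 1" using k by simp
  then have X1ae: "AE x in M. x \<in> X1" using prob_eq_1[OF X1m] by simp
  have fX1: "AE x in M. f x \<in> X1"
    using AE_distrD[OF fm, of "\<lambda>x. x \<in> X1"] X1ae unfolding fmp by blast
  define H where "H n = (\<Union>R. G n R)" for n
  have Hm: "H n \<in> sets M" for n unfolding H_def using Gm by auto
  have aeH: "AE x in M. x \<in> (\<Union>m. \<Inter>n\<in>{m..}. H n)"
    using X1ae fX1 fE
  proof eventually_elim
    case (elim x)
    obtain i w where w: "i < k" "w \<in> B - N0" "x = (t ^^ i) w" using elim(1) unfolding X1_def by blast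
    obtain j w' where w': "j < k" "w' \<in> B - N0" "f x = (t ^^ j) w'" using elim(2) unfolding X1_def by blast
    have M': "w \<in> space M - N0" "w' \<in> space M - N0" using w w' BM by auto
    have "(w, x) \<in> E" "(w', f x) \<in> E" using FG_D(4)[OF tp] w w' M' by auto
    then have "(w, w') \<in> E" using elim(3) E_sym E_trans by blast
    then obtain n0 where n0: "\<And>n. n \<ge> n0 \<Longrightarrow> \<exists>y\<in>Y n. \<exists>a b. w = (\<sigma> n ^^ a) y \<and> w' = (\<sigma> n ^^ b) y"
      using cov[OF M'] by blast
    have "x \<in> H n" if n: "n \<ge> n0" for n
    proof -
      obtain y a0 b0 where y: "y \<in> Y n" "w = (\<sigma> n ^^ a0) y" "w' = (\<sigma> n ^^ b0) y" using n0[OF n] by blast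
      obtain a where a: "fresh n a y" "(\<sigma> n ^^ a) y = w" using fresh_ex[of n y a0] y(2) by auto
      obtain b where b: "fresh n b y" "(\<sigma> n ^^ b) y = w'" using fresh_ex[of n y b0] y(3) by auto
      define R where "R = Suc (max a b)"
      have "lv n a y" "lv n b y" "mv n a i b j y" using a b w w' by (auto simp: lv_def mv_def)
      moreover have R: "a < R" "b < R" by (auto simp: R_def)
      ultimately have "y \<in> T n R a i" using y(1) w'(1) unfolding T_def by blast
      moreover have "x = ((t ^^ i) \<circ> (\<sigma> n ^^ a)) y" using w(3) a(2) by simp
      ultimately have "x \<in> G n R" unfolding G_def using w(1) R(1) by blast
      then show ?thesis unfolding H_def by blast
    qed
    then show ?case by auto
  qed
  obtain n where n: "1 - \<epsilon> / 4 < measure M (H n)"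
  proof -
    \<comment> \<open>A common transversal point exists for all large \<open>n\<close>, with a
      threshold depending on the point; the points with threshold at most \<open>m\<close> exhaust
      the space up to a null set.\<close>
    define Hn where "Hn m = (\<Inter>n\<in>{m..}. H n)" for m
    have Hnm: "Hn m \<in> sets M" for m unfolding Hn_def by (rule sets.countable_INT') (use Hm in auto)
    have inc: "incseq Hn" unfolding Hn_def by (intro incseq_SucI INF_superset_mono) auto
    have "(\<lambda>m. measure M (Hn m)) \<longlonglongrightarrow> measure M (\<Union>m. Hn m)"
      by (rule finite_Lim_measure_incseq) (use Hnm inc in auto)
    moreover have "measure M (\<Union>m. Hn m) = 1"
      by (subst prob_eq_1) (use aeH Hnm in \<open>auto simp: Hn_def\<close>)
    ultimately have "\<forall>\<^sub>F m in sequentially. 1 - \<epsilon> / 4 < measure M (Hn m)"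
      using \<epsilon> by (intro order_tendstoD(1)) auto
    then obtain m where "1 - \<epsilon> / 4 < measure M (Hn m)" unfolding eventually_sequentially by blast
    moreover have "measure M (Hn m) \<le> measure M (H m)"
      using Hm by (intro finite_measure_mono) (auto simp: Hn_def)
    ultimately show thesis using that[of m] by simp
  qed
  obtain R where R: "1 - \<epsilon> / 2 < measure M (G n R)"
  proof -
    have "(\<lambda>R. measure M (G n R)) \<longlonglongrightarrow> measure M (\<Union>R. G n R)"
      by (rule finite_Lim_measure_incseq) (use Gm Gmono in \<open>auto simp: incseq_def\<close>)
    then have "\<forall>\<^sub>F R in sequentially. 1 - \<epsilon> / 2 < measure M (G n R)"
      using n \<epsilon> unfolding H_def by (intro order_tendstoD(1)) auto
    then show thesis using that unfolding eventually_sequentially by blast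
  qed
  \<comment> \<open>Points of one type have the same exponents landing in \<open>B\<close> and
    undergo the same moves under \<open>f\<close>. Over a piece of constant type, \<open>f\<close>
    therefore moves whole translates of the piece.\<close>
  define \<tau> where "\<tau> y = ({a. a < R \<and> lv n a y},
      {(a, i, b, j). a < R \<and> i < k \<and> b < R \<and> j < k \<and> mv n a i b j y})" for y
  define \<Theta> where "\<Theta> = Pow {..<R} \<times> Pow ({..<R} \<times> {..<k} \<times> {..<R} \<times> {..<k})"
  have \<Theta>: "finite \<Theta>" by (simp add: \<Theta>_def)
  have \<tau>\<Theta>: "\<tau> y \<in> \<Theta>" for y by (auto simp: \<tau>_def \<Theta>_def)
  define W where "W \<theta> = {y \<in> Y n. \<tau> y = \<theta>}" for \<theta>
  have Wm: "W \<theta> \<in> sets M" if "\<theta> \<in> \<Theta>" for \<theta>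
  proof -
    obtain A1 A2 where \<theta>: "\<theta> = (A1, A2)" by fastforce
    have A: "A1 \<subseteq> {..<R}" "A2 \<subseteq> {..<R} \<times> {..<k} \<times> {..<R} \<times> {..<k}" using that by (auto simp: \<Theta>_def \<theta>)
    define C1 where "C1 a = (if a \<in> A1 then {y \<in> Y n. lv n a y} else Y n - {y \<in> Y n. lv n a y})" for a
    define C2 where "C2 = (\<lambda>(a, i, b, j). if (a, i, b, j) \<in> A2 then {y \<in> Y n. mv n a i b j y}
        else Y n - {y \<in> Y n. mv n a i b j y})"
    have C: "C1 a \<in> sets M" "C2 q \<in> sets M" for a q
      using lvm mvm Y by (auto simp: C1_def C2_def split: prod.split)
    have memW: "y \<in> W \<theta> \<longleftrightarrow> y \<in> Y n \<and> (\<forall>a\<in>{..<R}. y \<in> C1 a) \<and> (\<forall>q\<in>{..<R} \<times> {..<k} \<times> {..<R} \<times> {..<k}. y \<in> C2 q)" for y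
    proof -
      have "y \<in> W \<theta> \<longleftrightarrow> y \<in> Y n \<and> {a. a < R \<and> lv n a y} = A1 \<and>
          {(a, i, b, j). a < R \<and> i < k \<and> b < R \<and> j < k \<and> mv n a i b j y} = A2"
        by (auto simp: W_def \<tau>_def \<theta>)
      moreover have "{a. a < R \<and> lv n a y} = A1 \<longleftrightarrow> (\<forall>a\<in>{..<R}. y \<in> C1 a)" if "y \<in> Y n"
        using A(1) that by (auto simp: C1_def set_eq_iff split: if_splits)
      moreover have "{(a, i, b, j). a < R \<and> i < k \<and> b < R \<and> j < k \<and> mv n a i b j y} = A2 \<longleftrightarrow>
          (\<forall>q\<in>{..<R} \<times> {..<k} \<times> {..<R} \<times> {..<k}. y \<in> C2 q)" if "y \<in> Y n"
      proof -
        define mvq where "mvq q \<longleftrightarrow> (case q of (a, i, b, j) \<Rightarrow> mv n a i b j y)" for q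
        let ?S = "{..<R} \<times> {..<k} \<times> {..<R} \<times> {..<k}"
        have "{(a, i, b, j). a < R \<and> i < k \<and> b < R \<and> j < k \<and> mv n a i b j y} = {q \<in> ?S. mvq q}"
          by (auto simp: mvq_def)
        moreover have "y \<in> C2 q \<longleftrightarrow> (mvq q \<longleftrightarrow> q \<in> A2)" for q
          using that by (cases q) (auto simp: C2_def mvq_def)
        moreover have "{q \<in> ?S. mvq q} = A2 \<longleftrightarrow> (\<forall>q\<in>?S. mvq q \<longleftrightarrow> q \<in> A2)" using A(2) by blast
        ultimately show ?thesis by simp
      qed
      ultimately show ?thesis by blast
    qed
    have diff: "y \<in> Y n - (\<Union>a\<in>I. Y n - C1 a) - (\<Union>q\<in>S. Y n - C2 q) \<longleftrightarrow>
        y \<in> Y n \<and> (\<forall>a\<in>I. y \<in> C1 a) \<and> (\<forall>q\<in>S. y \<in> C2 q)" for y I S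
      by blast
    have "W \<theta> = Y n - (\<Union>a\<in>{..<R}. Y n - C1 a) - (\<Union>q\<in>{..<R} \<times> {..<k} \<times> {..<R} \<times> {..<k}. Y n - C2 q)"
      unfolding set_eq_iff memW diff by (rule allI, rule refl)
    also have "\<dots> \<in> sets M" using C Y[of n] by (intro sets.Diff sets.finite_UN) auto
    finally show ?thesis .
  qed
  \<comment> \<open>There are \<open>card \<Theta> * R * k\<close> translated remainders, each of
    measure at most \<open>\<delta> = 1 / (k * N)\<close>. This \<open>N\<close> makes their total
    less than \<open>\<epsilon> / 2\<close>.\<close>
  define N where "N = Suc (max L (nat \<lceil>4 * real (card \<Theta>) * real R / \<epsilon>\<rceil>))"
  define \<delta> where "\<delta> = 1 / (real k * real N)"
  have \<delta>: "0 < \<delta>" using k by (simp add: \<delta>_def N_def)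
  have NN: "real (card \<Theta>) * real R / real N < \<epsilon> / 2"
  proof -
    have "4 * real (card \<Theta>) * real R / \<epsilon> < real N" unfolding N_def by linarith
    then have "4 * (real (card \<Theta>) * real R) < \<epsilon> * real N" using \<epsilon> by (simp add: field_simps)
    then have "2 * (real (card \<Theta>) * real R) < \<epsilon> * real N"
      using mult_nonneg_nonneg[of "real (card \<Theta>)" "real R"] by linarith
    then show ?thesis by (simp add: field_simps N_def)
  qed
  have "\<exists>h Z bad. Z \<in> sets M \<and> measure M Z = \<delta> \<and> tower h (\<lambda>_. Z) {..<N} \<and> (\<forall>j<N. h j ` Z \<subseteq> B) \<and>
    (\<forall>\<theta>\<in>\<Theta>. bad \<theta> \<in> sets M \<and> measure M (bad \<theta>) \<le> \<delta> \<and> (\<forall>y\<in>W \<theta> - bad \<theta>. \<exists>\<psi>. (\<exists>z\<in>Z. y = \<psi> z) \<and>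
      \<psi> ` Z \<subseteq> W \<theta> \<and> (\<forall>a\<in>fst \<theta>. \<exists>j<N. \<forall>z\<in>Z. h j z = (\<sigma> n ^^ a) (\<psi> z))))"
  proof (rule translate_pieces[OF B _ \<delta> _ \<Theta> Wm])
    show "measure M B = real N * \<delta>" using mB k by (simp add: \<delta>_def N_def)
    show "0 < N" by (simp add: N_def)
    show "finite (fst \<theta>)" if "\<theta> \<in> \<Theta>" for \<theta>
      by (rule finite_subset[OF _ finite_lessThan[of R]]) (use that in \<open>auto simp: \<Theta>_def\<close>)
    show "(\<sigma> n ^^ a) y \<in> B" if "\<theta> \<in> \<Theta>" "a \<in> fst \<theta>" "y \<in> W \<theta>" for \<theta> a y
      using that by (auto simp: W_def \<tau>_def lv_def)
    show "\<theta> = \<theta>' \<and> a = a' \<and> y = y'"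
      if "\<theta> \<in> \<Theta>" "\<theta>' \<in> \<Theta>" "a \<in> fst \<theta>" "a' \<in> fst \<theta>'" "y \<in> W \<theta>" "y' \<in> W \<theta>'" "(\<sigma> n ^^ a) y = (\<sigma> n ^^ a') y'"
      for \<theta> \<theta>' a a' y y'
    proof -
      have yy: "y = y'" using transv[of y n y' a a'] that by (auto simp: W_def)
      moreover have "\<theta> = \<theta>'" using that yy by (auto simp: W_def)
      moreover have "fresh n a y" "fresh n a' y" using that yy by (auto simp: W_def \<tau>_def lv_def)
      then have "a = a'" using fresh_inj that(7) yy by blast
      ultimately show ?thesis by blast
    qed
  qed (use sp in auto)
  then obtain h Z bad where hZ0: "Z \<in> sets M \<and> measure M Z = \<delta> \<and> tower h (\<lambda>_. Z) {..<N} \<and> (\<forall>j<N. h j ` Z \<subseteq> B) \<and>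
    (\<forall>\<theta>\<in>\<Theta>. bad \<theta> \<in> sets M \<and> measure M (bad \<theta>) \<le> \<delta> \<and> (\<forall>y\<in>W \<theta> - bad \<theta>. \<exists>\<psi>. (\<exists>z\<in>Z. y = \<psi> z) \<and>
      \<psi> ` Z \<subseteq> W \<theta> \<and> (\<forall>a\<in>fst \<theta>. \<exists>j<N. \<forall>z\<in>Z. h j z = (\<sigma> n ^^ a) (\<psi> z))))"
    by (elim exE) (rule that)
  then have Z: "Z \<in> sets M" "measure M Z = \<delta>" and tow: "tower h (\<lambda>_. Z) {..<N}"
    and hB: "\<And>j z. j < N \<Longrightarrow> z \<in> Z \<Longrightarrow> h j z \<in> B"
    and bad: "\<And>\<theta>. \<theta> \<in> \<Theta> \<Longrightarrow> bad \<theta> \<in> sets M" "\<And>\<theta>. \<theta> \<in> \<Theta> \<Longrightarrow> measure M (bad \<theta>) \<le> \<delta>"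
    and \<psi>: "\<And>\<theta> y. \<theta> \<in> \<Theta> \<Longrightarrow> y \<in> W \<theta> - bad \<theta> \<Longrightarrow> \<exists>\<psi>. (\<exists>z\<in>Z. y = \<psi> z) \<and>
      \<psi> ` Z \<subseteq> W \<theta> \<and> (\<forall>a\<in>fst \<theta>. \<exists>j<N. \<forall>z\<in>Z. h j z = (\<sigma> n ^^ a) (\<psi> z))"
    by (simp_all add: image_subset_iff)
  have N0': "0 < N" by (simp add: N_def)
  \<comment> \<open>\<open>s\<close> rotates the \<open>N\<close> pieces, which fill
    \<open>B\<close> up to a null set. By \<open>refine_pow\<close>, level \<open>k * j + i\<close>
    of \<open>s \<circ> t\<close> is the image of the \<open>j\<close>-th piece under the
    \<open>i\<close>-th power of \<open>t\<close>.\<close>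
  define s where "s = blk h (\<lambda>_. Z) {..<N} (\<lambda>j. Suc j mod N)"
  have s: "s \<in> FG" and spow: "\<And>z i j. z \<in> Z \<Longrightarrow> i < N \<Longrightarrow> (s ^^ j) (h i z) = h ((i + j) mod N) z"
    using cyclic_blk[OF tow N0'] unfolding s_def by auto
  have sB: "s x = x" if "x \<notin> B" for x
    unfolding s_def by (rule blk_out) (use hB that in auto)
  have sin: "s x \<in> B" if "x \<in> B" for x
  proof (rule ccontr)
    assume "s x \<notin> B"
    then have "s (s x) = s x" by (rule sB)
    then show False using s \<open>s x \<notin> B\<close> that by simp
  qed
  define B' where "B' = h 0 ` Z"
  have h0: "h 0 \<in> FG" using towerD(2)[OF tow] N0' by auto
  have B': "B' \<in> sets M" "B' \<subseteq> B" "measure M B' = 1 / real (k * N)"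
    using Z h0 hB N0' FG_measure[OF h0 Z(1)] by (auto simp: B'_def \<delta>_def)
  have dj0: "(t ^^ i) ` B \<inter> B = {}" if "0 < i" "i < k" for i using disj[of i 0] that by auto
  have key: "((s \<circ> t) ^^ (k * j + i)) (h 0 z) = (t ^^ i) (h j z)" if "z \<in> Z" "i < k" "j < N" for i j z
    using refine_pow[OF t dj0 per k sB sin hB[OF N0' that(1)] that(2), of j] spow[OF that(1) N0', of j] that(3) by simp
  have st: "s \<circ> t \<in> FG" by (rule FG_comp[OF s t])
  have dm: "\<exists>i j. l = k * j + i \<and> i < k \<and> j < N" if "l < k * N" for l
  proof -
    have "l div k < N" using that by (simp add: less_mult_imp_div_less mult.commute)
    then show ?thesis using k by (intro exI[of _ "l mod k"] exI[of _ "l div k"]) auto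
  qed
  have lt: "k * j + i < k * N" if "i < k" "j < N" for i j
  proof -
    have "k * j + i < k * Suc j" using that by simp
    also have "\<dots> \<le> k * N" using that by (intro mult_le_mono) auto
    finally show ?thesis .
  qed
  have tow': "tower (\<lambda>i. (s \<circ> t) ^^ i) (\<lambda>_. B') {..<k * N}"
    unfolding tower_def
  proof (intro conjI ballI impI)
    fix l l' assume l: "l \<in> {..<k * N}" "l' \<in> {..<k * N}" "l \<noteq> l'"
    have lk: "l < k * N" "l' < k * N" using l by auto
    obtain i j where ij: "l = k * j + i" "i < k" "j < N" using dm[OF lk(1)] by blast
    obtain i' j' where ij': "l' = k * j' + i'" "i' < k" "j' < N" using dm[OF lk(2)] by blast
    show "((s \<circ> t) ^^ l) ` B' \<inter> ((s \<circ> t) ^^ l') ` B' = {}"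
    proof (rule ccontr)
      assume "((s \<circ> t) ^^ l) ` B' \<inter> ((s \<circ> t) ^^ l') ` B' \<noteq> {}"
      then obtain z z' where z: "z \<in> Z" "z' \<in> Z" "((s \<circ> t) ^^ l) (h 0 z) = ((s \<circ> t) ^^ l') (h 0 z')"
        unfolding B'_def by blast
      then have e: "(t ^^ i) (h j z) = (t ^^ i') (h j' z')" using key ij ij' by simp
      then have "i = i'" using disj[of i i'] ij ij' hB z by blast
      then have "h j z = h j' z'" using e tp[of i'] by simp
      then have "j = j'" using towerD(4)[OF tow, of j j' z z'] z ij ij' by simp
      then show False using l ij ij' \<open>i = i'\<close> by simp
    qed
  qed (use B' FG_pow[OF st] in auto)
  have per': "((s \<circ> t) ^^ (k * N)) x = x" if xB: "x \<in> B'" for x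
  proof -
    obtain z where z: "z \<in> Z" "x = h 0 z" using xB unfolding B'_def by blast
    have "((s \<circ> t) ^^ (k * N + 0)) (h 0 z) = (t ^^ 0) ((s ^^ N) (h 0 z))"
      by (rule refine_pow[OF t dj0 per k sB sin hB[OF N0' z(1)] k])
    then show ?thesis using spow[OF z(1) N0', of N] z(2) by simp
  qed
  have ne: "B' \<noteq> {}" using B'(3) k N0' by auto
  obtain p where p: "p permutes {..<k * N}"
    "\<And>l l'. l < k * N \<Longrightarrow> l' < k * N \<Longrightarrow> (\<forall>z\<in>B'. f (((s \<circ> t) ^^ l) z) = ((s \<circ> t) ^^ l') z) \<Longrightarrow> p l = l'"
    using match_levels[OF tow' _ ne finj B'(1)] by auto
  let ?b = "blk (\<lambda>i. (s \<circ> t) ^^ i) (\<lambda>_. B') {..<k * N} p"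
  have bFG: "?b \<in> FG"
    by (rule blk_FG[OF tow']) (use p(1) permutes_imp_bij in auto)
  \<comment> \<open>A point of \<open>G n R\<close> outside \<open>Bad\<close> lies on a level which
    \<open>f\<close> carries pointwise along the tower onto another level; on such levels
    \<open>p\<close> is prescribed by \<open>f\<close>.\<close>
  define Bad where "Bad = (\<Union>q\<in>\<Theta> \<times> {..<R} \<times> {..<k}. case q of (\<theta>, a, i) \<Rightarrow> ((t ^^ i) \<circ> (\<sigma> n ^^ a)) ` bad \<theta>)"
  have Badm: "(case q of (\<theta>, a, i) \<Rightarrow> ((t ^^ i) \<circ> (\<sigma> n ^^ a)) ` bad \<theta>) \<in> sets M"
     "measure M (case q of (\<theta>, a, i) \<Rightarrow> ((t ^^ i) \<circ> (\<sigma> n ^^ a)) ` bad \<theta>) \<le> \<delta>"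
    if "q \<in> \<Theta> \<times> {..<R} \<times> {..<k}" for q
    using that bad FG_image_sets[OF FG_comp[OF tp sp]] FG_measure[OF FG_comp[OF tp sp]] by (auto simp del: o_apply)
  have Badsets: "Bad \<in> sets M" unfolding Bad_def by (intro sets.finite_UN Badm) (use \<Theta> in auto)
  have "measure M Bad \<le> real (card (\<Theta> \<times> {..<R} \<times> {..<k})) * \<delta>"
    unfolding Bad_def by (rule measure_UN_le[OF _ Badm]) (use \<Theta> in auto)
  also have "\<dots> = real (card \<Theta>) * real R / real N"
    using k by (simp add: card_cartesian_product \<delta>_def)
  finally have mBad: "measure M Bad < \<epsilon> / 2" using NN by linarith
  have "{x \<in> space M. f x \<noteq> ?b x} \<subseteq> (space M - G n R) \<union> Bad"
  proof
    fix x assume x: "x \<in> {x \<in> space M. f x \<noteq> ?b x}"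
    show "x \<in> (space M - G n R) \<union> Bad"
    proof (rule ccontr)
      assume nx: "x \<notin> (space M - G n R) \<union> Bad"
      then have "x \<in> G n R" using x by blast
      then obtain a i y where y: "a < R" "i < k" "y \<in> T n R a i" "x = ((t ^^ i) \<circ> (\<sigma> n ^^ a)) y"
        unfolding G_def by blast
      obtain b j where y2: "y \<in> Y n" "lv n a y" "b < R" "j < k" "lv n b y" "mv n a i b j y"
        using y(3) unfolding T_def by blast
      define \<theta> where "\<theta> = \<tau> y"
      have \<theta>: "\<theta> \<in> \<Theta>" "y \<in> W \<theta>" "a \<in> fst \<theta>" "b \<in> fst \<theta>" "(a, i, b, j) \<in> snd \<theta>"
        using \<tau>\<Theta> y y2 by (auto simp: \<theta>_def W_def \<tau>_def)
      have "y \<notin> bad \<theta>"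
      proof
        assume "y \<in> bad \<theta>"
        then have "x \<in> ((t ^^ i) \<circ> (\<sigma> n ^^ a)) ` bad \<theta>" using y(4) by blast
        then have "x \<in> Bad" unfolding Bad_def using \<theta>(1) y(1,2)
          by (intro UN_I[of "(\<theta>, a, i)"]) auto
        then show False using nx by blast
      qed
      then obtain \<psi> where \<psi>1: "\<exists>z\<in>Z. y = \<psi> z" "\<psi> ` Z \<subseteq> W \<theta>"
        "\<forall>a\<in>fst \<theta>. \<exists>j<N. \<forall>z\<in>Z. h j z = (\<sigma> n ^^ a) (\<psi> z)" using \<psi>[OF \<theta>(1), of y] \<theta>(2) by blast
      obtain c where c: "c < N" "\<And>z. z \<in> Z \<Longrightarrow> h c z = (\<sigma> n ^^ a) (\<psi> z)" using \<psi>1(3) \<theta>(3) by blast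
      obtain c' where c': "c' < N" "\<And>z. z \<in> Z \<Longrightarrow> h c' z = (\<sigma> n ^^ b) (\<psi> z)" using \<psi>1(3) \<theta>(4) by blast
      have mvz: "mv n a i b j (\<psi> z)" if "z \<in> Z" for z
      proof -
        have "\<tau> (\<psi> z) = \<theta>" using \<psi>1(2) that by (auto simp: W_def)
        then have "(a, i, b, j) \<in> snd (\<tau> (\<psi> z))" using \<theta>(5) by simp
        then show ?thesis by (simp add: \<tau>_def)
      qed
      have fl: "f (((s \<circ> t) ^^ (k * c + i)) w) = ((s \<circ> t) ^^ (k * c' + j)) w" if wB: "w \<in> B'" for w
      proof -
        obtain z where z: "z \<in> Z" "w = h 0 z" using wB unfolding B'_def by blast
        show ?thesis using key[OF z(1) y(2) c(1)] key[OF z(1) y2(4) c'(1)] c(2)[OF z(1)] c'(2)[OF z(1)] mvz[OF z(1)] z(2)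
          by (simp add: mv_def)
      qed
      have pl: "p (k * c + i) = k * c' + j"
        by (rule p(2)) (use fl lt y(2) y2(4) c(1) c'(1) in auto)
      obtain z where z: "z \<in> Z" "y = \<psi> z" using \<psi>1(1) by blast
      have xz: "x = ((s \<circ> t) ^^ (k * c + i)) (h 0 z)"
        using key[OF z(1) y(2) c(1)] c(2)[OF z(1)] z(2) y(4) by simp
      have hz: "h 0 z \<in> B'" using z by (auto simp: B'_def)
      have "?b x = ((s \<circ> t) ^^ (k * c' + j)) (h 0 z)"
        unfolding xz using blk_app[OF tow', of "k * c + i" "h 0 z" p] hz lt[OF y(2) c(1)] pl by simp
      also have "\<dots> = f x" unfolding xz by (rule fl[OF hz, symmetric])
      finally show False using x by simp
    qed
  qed
  then have "udist f ?b \<le> measure M ((space M - G n R) \<union> Bad)"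
    unfolding udist_def using Gm Badsets by (intro finite_measure_mono) auto
  also have "\<dots> \<le> measure M (space M - G n R) + measure M Bad"
    using Gm Badsets by (intro measure_Un_le) auto
  also have "measure M (space M - G n R) = 1 - measure M (G n R)" using prob_compl[OF Gm] .
  finally have dist: "udist f ?b < \<epsilon>" using R mBad by linarith
  have LN: "L \<le> N" by (simp add: N_def)
  show ?thesis
    by (intro exI[of _ s] exI[of _ B'] exI[of _ N] exI[of _ p] conjI allI ballI impI)
      (rule s sB B' LN N0' tow' per' p(1) dist; assumption?)+
qed

section \<open>Separability of the full group\<close>

lemma countable_dense_sets:
  obtains D :: "nat \<Rightarrow> 'a set" where "\<And>i. D i \<in> sets M"
    "\<And>A e. A \<in> sets M \<Longrightarrow> 0 < e \<Longrightarrow> \<exists>i. measure M ((A - D i) \<union> (D i - A)) < e"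
proof -
  obtain V :: "nat \<Rightarrow> 'a set" where V: "\<And>n. V n \<in> sets M" and sV: "sets M = sigma_sets (space M) (range V)"
    by (rule real_injection) blast
  \<comment> \<open>The generators are closed under complements and unions in stages. All stages are
    countable, and their union is an algebra, which approximates every set of the generated
    sigma-algebra.\<close>
  define S where "S = rec_nat (insert {} (range V))
     (\<lambda>_ T. T \<union> (\<lambda>a. space M - a) ` T \<union> (\<lambda>(a, b). a \<union> b) ` (T \<times> T))"
  have S0: "S 0 = insert {} (range V)" by (simp add: S_def)
  have SS: "S (Suc n) = S n \<union> (\<lambda>a. space M - a) ` S n \<union> (\<lambda>(a, b). a \<union> b) ` (S n \<times> S n)" for n
    by (simp add: S_def)
  have cS: "countable (S n)" for n by (induction n) (auto simp: S0 SS)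
  have mS: "S n \<subseteq> sets M" for n by (induction n) (use V in \<open>auto simp: S0 SS\<close>)
  have mono: "S m \<subseteq> S n" if "m \<le> n" for m n
    by (rule lift_Suc_mono_le[OF _ that]) (auto simp: SS)
  define DD where "DD = (\<Union>n. S n)"
  have DD: "countable DD" "DD \<subseteq> sets M" "{} \<in> DD" "\<And>n. V n \<in> DD"
  proof -
    show "countable DD" unfolding DD_def using cS by auto
    show "DD \<subseteq> sets M" unfolding DD_def using mS by (rule UN_least)
    have "insert {} (range V) \<subseteq> DD" unfolding DD_def S0[symmetric] by blast
    then show "{} \<in> DD" "V n \<in> DD" for n by auto
  qed
  have DDc: "space M - a \<in> DD" if a: "a \<in> DD" for a
  proof -
    obtain n where "a \<in> S n" using a unfolding DD_def by blast
    then have "space M - a \<in> S (Suc n)" by (auto simp: SS)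
    then show ?thesis unfolding DD_def by blast
  qed
  have DDu: "a \<union> b \<in> DD" if ab: "a \<in> DD" "b \<in> DD" for a b
  proof -
    obtain n m where "a \<in> S n" "b \<in> S m" using ab unfolding DD_def by blast
    then have "a \<in> S (max n m)" "b \<in> S (max n m)" using mono[of n "max n m"] mono[of m "max n m"] by auto
    then have "a \<union> b \<in> S (Suc (max n m))" by (auto simp: SS)
    then show ?thesis unfolding DD_def by blast
  qed
  define sd where "sd A B = measure M ((A - B) \<union> (B - A))" for A B
  have sdU: "sd (A \<union> A') (B \<union> B') \<le> sd A B + sd A' B'"
    if "A \<in> sets M" "A' \<in> sets M" "B \<in> sets M" "B' \<in> sets M" for A A' B B'
  proof -
    have "sd (A \<union> A') (B \<union> B') \<le> measure M (((A - B) \<union> (B - A)) \<union> ((A' - B') \<union> (B' - A')))"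
      unfolding sd_def using that by (intro finite_measure_mono) auto
    also have "\<dots> \<le> sd A B + sd A' B'" unfolding sd_def using that by (intro measure_Un_le) auto
    finally show ?thesis .
  qed
  have sdT: "sd A C \<le> sd A B + sd B C" if "A \<in> sets M" "B \<in> sets M" "C \<in> sets M" for A B C
  proof -
    have "sd A C \<le> measure M (((A - B) \<union> (B - A)) \<union> ((B - C) \<union> (C - B)))"
      unfolding sd_def using that by (intro finite_measure_mono) auto
    also have "\<dots> \<le> sd A B + sd B C" unfolding sd_def using that by (intro measure_Un_le) auto
    finally show ?thesis .
  qed
  have approx: "\<forall>e>0. \<exists>d\<in>DD. sd A d < e" if "A \<in> sets M" for A
    using that unfolding sV
  proof induction
    case (Basic a)
    then have "a \<in> DD" using DD(4) by auto
    moreover have "sd a a = 0" by (simp add: sd_def)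
    ultimately show ?case by (metis)
  next
    case Empty
    then show ?case using DD(3) by (intro allI impI bexI[of _ "{}"]) (auto simp: sd_def)
  next
    case (Compl a)
    have aM: "a \<in> sets M" using Compl.hyps sV by simp
    show ?case
    proof (intro allI impI)
      fix e :: real assume "0 < e"
      then obtain d where d: "d \<in> DD" "sd a d < e" using Compl.IH by blast
      have dM: "d \<subseteq> space M" using d DD(2) sets.sets_into_space by blast
      have "((space M - a) - (space M - d)) \<union> ((space M - d) - (space M - a)) = (a - d) \<union> (d - a)"
        using sets.sets_into_space[OF aM] dM by blast
      then have "sd (space M - a) (space M - d) = sd a d" by (simp add: sd_def)
      then show "\<exists>d\<in>DD. sd (space M - a) d < e"
        by (intro bexI[of _ "space M - d"]) (simp_all add: DDc d)
    qed
  next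
    case (Union a)
    have aM: "a i \<in> sets M" for i using Union.hyps sV by simp
    have fin: "\<forall>e>0. \<exists>d\<in>DD. sd (\<Union>i<n. a i) d < e" for n :: nat
    proof (induction n)
      case 0
      show ?case using DD(3) by (intro allI impI bexI[of _ "{}"]) (auto simp: sd_def)
    next
      case (Suc n)
      show ?case
      proof (intro allI impI)
        fix e :: real assume "0 < e"
        then have e2: "0 < e / 2" by simp
        obtain d d' where d: "d \<in> DD" "sd (\<Union>i<n. a i) d < e / 2" "d' \<in> DD" "sd (a n) d' < e / 2"
          using Suc e2 Union.IH[of n] by blast
        have "(\<Union>i<n. a i) \<in> sets M" using aM by auto
        then have "sd ((\<Union>i<n. a i) \<union> a n) (d \<union> d') < e"
          using sdU[of "\<Union>i<n. a i" "a n" d d'] aM d DD(2) by fastforce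
        then show "\<exists>d\<in>DD. sd (\<Union>i<Suc n. a i) d < e"
          using DDu[OF d(1,3)] by (auto simp: lessThan_Suc Un_commute)
      qed
    qed
    show ?case
    proof (intro allI impI)
      fix e :: real assume e: "0 < e"
      have Um: "(\<Union>i<n. a i) \<in> sets M" "(\<Union>i. a i) \<in> sets M" for n :: nat using aM by auto
      have "(\<lambda>n. measure M (\<Union>i<n. a i)) \<longlonglongrightarrow> measure M (\<Union>n. \<Union>i<n. a i)"
        by (rule finite_Lim_measure_incseq) (use Um incseq_UN_lessThan in auto)
      moreover have "(\<Union>n. \<Union>i<n. a i) = (\<Union>i. a i)" by (auto; metis lessI)
      ultimately have "\<forall>\<^sub>F n in sequentially. measure M (\<Union>i. a i) - e / 2 < measure M (\<Union>i<n. a i)"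
        using e by (intro order_tendstoD(1)[of _ "measure M (\<Union>i. a i)"]) auto
      then obtain n where n: "measure M (\<Union>i. a i) - e / 2 < measure M (\<Union>i<n. a i)"
        unfolding eventually_sequentially by blast
      have eq: "((\<Union>i. a i) - (\<Union>i<n. a i)) \<union> ((\<Union>i<n. a i) - (\<Union>i. a i)) = (\<Union>i. a i) - (\<Union>i<n. a i)" by blast
      have "sd (\<Union>i. a i) (\<Union>i<n. a i) = measure M (\<Union>i. a i) - measure M (\<Union>i<n. a i)"
        unfolding sd_def eq using Um by (intro finite_measure_Diff) auto
      then have 1: "sd (\<Union>i. a i) (\<Union>i<n. a i) < e / 2" using n by simp
      obtain d where d: "d \<in> DD" "sd (\<Union>i<n. a i) d < e / 2" using fin[of n] e by (meson half_gt_zero)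
      have "sd (\<Union>i. a i) d < e" using sdT[of "\<Union>i. a i" "\<Union>i<n. a i" d] Um 1 d DD(2) by fastforce
      then show "\<exists>d\<in>DD. sd (\<Union>i. a i) d < e" using d by blast
    qed
  qed
  have r: "range (from_nat_into DD) = DD" using DD(1,3) by (intro range_from_nat_into) auto
  show thesis
  proof (rule that[of "from_nat_into DD"])
    show "from_nat_into DD i \<in> sets M" for i using r DD(2) by blast
    fix A and e :: real assume "A \<in> sets M" "0 < e"
    then obtain d where d: "d \<in> DD" "sd A d < e" using approx by blast
    then obtain i where "d = from_nat_into DD i" using r by blast
    then show "\<exists>i. measure M ((A - from_nat_into DD i) \<union> (from_nat_into DD i - A)) < e"
      using d(2) by (auto simp: sd_def)
  qed
qed

text \<open>Up to a small error, an element of the full group is determined by approximations, from a countable family,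
  to finitely many of the sets on which it agrees with a given generator of \<^term>\<open>E\<close>.\<close>

lemma separable_ae_full:
  obtains f :: "nat \<Rightarrow> 'a \<Rightarrow> 'a" where "\<And>n. f n \<in> ae_full"
    "\<And>g e n0. g \<in> ae_full \<Longrightarrow> 0 < e \<Longrightarrow> \<exists>n\<ge>n0. udist g (f n) < e"
proof -
  obtain N and \<gamma> :: "nat \<Rightarrow> 'a \<Rightarrow> 'a" where N: "N \<in> null_sets M" and \<gamma>: "\<And>i. \<gamma> i \<in> FG" and
    cov: "\<And>x w. x \<in> space M - N \<Longrightarrow> w \<in> space M - N \<Longrightarrow> (x, w) \<in> E \<Longrightarrow> \<exists>i. \<gamma> i x = w"
    by (rule countable_generators) blast
  obtain D :: "nat \<Rightarrow> 'a set" where D: "\<And>i. D i \<in> sets M"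
    "\<And>A e. A \<in> sets M \<Longrightarrow> 0 < e \<Longrightarrow> \<exists>i. measure M ((A - D i) \<union> (D i - A)) < e"
    by (rule countable_dense_sets) blast
  \<comment> \<open>Taking the first generator that agrees with \<open>g\<close> makes the sets
    \<open>A g i\<close> disjoint; together they exhaust the space up to a null set.\<close>
  define A where "A g i = {x \<in> space M. g x = \<gamma> i x} - (\<Union>j<i. {x \<in> space M. g x = \<gamma> j x})" for g i
  have gm: "g \<in> measurable M M" if "g \<in> ae_full" for g using that mp_autsD(2) by (auto simp: ae_full_def)
  have Am: "A g i \<in> sets M" if "g \<in> ae_full" for g i
    unfolding A_def using eq_sets[OF gm[OF that] FG_D(2)[OF \<gamma>]] by auto
  define good where "good l r g \<longleftrightarrow> g \<in> ae_full \<and>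
      (\<forall>i<length l. measure M ((A g i - D (l ! i)) \<union> (D (l ! i) - A g i)) < of_rat r)" for l :: "nat list" and r g
  \<comment> \<open>Any element matching the code will do, since two elements with the same code are
    close. A code that matches nothing receives the identity.\<close>
  define F where "F = (\<lambda>(l, r). if \<exists>g. good l r g then SOME g. good l r g else id)"
  have F: "good l r (F (l, r))" if "\<exists>g. good l r g" for l r
  proof -
    have "good l r (SOME g. good l r g)" using that by (rule someI_ex)
    then show ?thesis using that by (simp add: F_def)
  qed
  have F': "F q \<in> ae_full" for q
  proof (cases q)
    case (Pair l r)
    show ?thesis
    proof (cases "\<exists>g. good l r g")
      case True
      then show ?thesis using F[OF True] Pair by (simp add: good_def)
    next
      case False
      show ?thesis unfolding Pair F_def prod.case if_not_P[OF False] by (rule FG_ae_full[OF FG_id])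
    qed
  qed
  have dense: "\<exists>q. udist g (F q) < e" if g: "g \<in> ae_full" and e: "0 < e" for g e
  proof -
    have UA: "(\<Union>i<m. A g i) = {x \<in> space M. \<exists>i<m. g x = \<gamma> i x}" for m
    proof (intro equalityI subsetI)
      fix x assume x: "x \<in> {x \<in> space M. \<exists>i<m. g x = \<gamma> i x}"
      then obtain i0 where i0: "i0 < m" "g x = \<gamma> i0 x" by blast
      define i where "i = (LEAST i. g x = \<gamma> i x)"
      have "g x = \<gamma> i x" unfolding i_def by (rule LeastI[of _ i0]) (rule i0)
      moreover have "i \<le> i0" unfolding i_def by (rule Least_le) (rule i0)
      moreover have "g x \<noteq> \<gamma> j x" if "j < i" for j using not_less_Least[of j] that unfolding i_def by blast
      ultimately have "x \<in> A g i" "i < m" using x i0 by (auto simp: A_def)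
      then show "x \<in> (\<Union>i<m. A g i)" by blast
    qed (auto simp: A_def)
    have Um: "(\<Union>i<m. A g i) \<in> sets M" for m using Am[OF g] by auto
    have "AE x in M. x \<notin> N" using N by (rule AE_not_in)
    moreover have "AE x in M. g x \<notin> N"
    proof -
      have "distr M M g = M" using g mp_autsD(3)[of g M] by (simp add: ae_full_def)
      then show ?thesis using AE_distrD[OF gm[OF g], of "\<lambda>x. x \<notin> N"] AE_not_in[OF N] by metis
    qed
    moreover have "AE x in M. (x, g x) \<in> E" using g by (simp add: ae_full_def)
    ultimately have ae: "AE x in M. x \<in> (\<Union>m. \<Union>i<m. A g i)"
    proof (eventually_elim, goal_cases)
      case (1 x)
      have xM: "x \<in> space M" "g x \<in> space M"
        using 1(3) E_sets[THEN sets.sets_into_space] by (auto simp: space_pair_measure)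
      then obtain i where "\<gamma> i x = g x" using cov[of x "g x"] 1 by auto
      then have "x \<in> (\<Union>i<Suc i. A g i)" unfolding UA using xM by auto
      then show ?case by blast
    qed
    have "(\<lambda>m. measure M (\<Union>i<m. A g i)) \<longlonglongrightarrow> measure M (\<Union>m. \<Union>i<m. A g i)"
      by (rule finite_Lim_measure_incseq) (use Um incseq_UN_lessThan in auto)
    moreover have "measure M (\<Union>m. \<Union>i<m. A g i) = 1"
      by (subst prob_eq_1) (use ae Um in auto)
    ultimately have "\<forall>\<^sub>F m in sequentially. 1 - e / 2 < measure M (\<Union>i<m. A g i)"
      using e by (intro order_tendstoD(1)) auto
    then obtain m where m: "1 - e / 2 < measure M (\<Union>i<m. A g i)" unfolding eventually_sequentially by blast
    \<comment> \<open>Comparing two elements through a common approximation within \<open>r\<close>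
      costs at most \<open>2 * r\<close> on each of the \<open>m\<close> sets, in total at most
      \<open>e / 2\<close>.\<close>
    have "0 < e / (4 * (real m + 1))" using e by simp
    then obtain r where r: "0 < real_of_rat r" "real_of_rat r < e / (4 * (real m + 1))" using of_rat_dense by blast
    have "\<forall>i. \<exists>c. measure M ((A g i - D c) \<union> (D c - A g i)) < of_rat r" using D(2)[OF Am[OF g] r(1)] by blast
    then obtain c where c: "\<And>i. measure M ((A g i - D (c i)) \<union> (D (c i) - A g i)) < of_rat r" by metis
    define l where "l = map c [0..<m]"
    have "good l r g" using g c by (auto simp: good_def l_def)
    then have gF: "good l r (F (l, r))" using F by blast
    let ?h = "F (l, r)"
    have dA: "measure M (A g i - A ?h i) \<le> 2 * of_rat r" if "i < m" for i
    proof -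
      have 1: "measure M ((A ?h i - D (c i)) \<union> (D (c i) - A ?h i)) < of_rat r"
        using gF that by (auto simp: good_def l_def)
      have "measure M (A g i - A ?h i) \<le> measure M (((A g i - D (c i)) \<union> (D (c i) - A g i)) \<union> ((A ?h i - D (c i)) \<union> (D (c i) - A ?h i)))"
        using Am[OF g] Am[OF F'] D(1) by (intro finite_measure_mono) auto
      also have "\<dots> \<le> measure M ((A g i - D (c i)) \<union> (D (c i) - A g i)) + measure M ((A ?h i - D (c i)) \<union> (D (c i) - A ?h i))"
        using Am[OF g] Am[OF F'] D(1) by (intro measure_Un_le) auto
      finally show ?thesis using 1 c[of i] by simp
    qed
    have "{x \<in> space M. g x \<noteq> ?h x} \<subseteq> (space M - (\<Union>i<m. A g i)) \<union> (\<Union>i<m. A g i - A ?h i)"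
      by (auto simp: A_def)
    then have "udist g ?h \<le> measure M ((space M - (\<Union>i<m. A g i)) \<union> (\<Union>i<m. A g i - A ?h i))"
      unfolding udist_def using Um Am[OF g] Am[OF F'] by (intro finite_measure_mono) auto
    also have "\<dots> \<le> measure M (space M - (\<Union>i<m. A g i)) + measure M (\<Union>i<m. A g i - A ?h i)"
      using Um Am[OF g] Am[OF F'] by (intro measure_Un_le) auto
    also have "measure M (space M - (\<Union>i<m. A g i)) < e / 2" using prob_compl[OF Um[of m]] m by simp
    also have "measure M (\<Union>i<m. A g i - A ?h i) \<le> real (card {..<m}) * (2 * of_rat r)"
      by (rule measure_UN_le) (use dA Am[OF g] Am[OF F'] in auto)
    also have "\<dots> \<le> e / 2"
    proof -
      have "4 * (real m * real_of_rat r) + 4 * real_of_rat r < e" using r(2) by (simp add: field_simps)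
      then show ?thesis using r(1) unfolding card_lessThan by linarith
    qed
    finally have "udist g ?h < e" by simp
    then show ?thesis by blast
  qed
  \<comment> \<open>The pairing lists every member infinitely often. Hence a given element is
    approximated by some \<open>f n\<close> with \<open>n\<close> as large as desired, for which the
    error \<open>1 / 2 ^ n\<close> of the tower is small as well.\<close>
  define f where "f n = F (from_nat (fst (prod_decode n)))" for n
  show thesis
  proof (rule that[of f])
    show "f n \<in> ae_full" for n by (simp add: f_def F')
    fix g and e :: real and n0 assume "g \<in> ae_full" "0 < e"
    then obtain q where q: "udist g (F q) < e" using dense by blast
    have "f (prod_encode (to_nat q, n0)) = F q" by (simp add: f_def)
    moreover have "n0 \<le> prod_encode (to_nat q, n0)" by (rule le_prod_encode_2)
    ultimately show "\<exists>n\<ge>n0. udist g (f n) < e" using q by metis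
  qed
qed

section \<open>The odometer\<close>

text \<open>\<open>dye_step\<close> is iterated, stage \<open>Suc n\<close> taking care of
  \<open>f n\<close>, from the one-level tower of the identity over the whole space. The required
  number of levels may depend on the height already reached; this is what later allows heights to
  grow as fast as needed.\<close>

lemma stage_sequence:
  fixes f :: "nat \<Rightarrow> 'a \<Rightarrow> 'a" and L :: "nat \<Rightarrow> nat \<Rightarrow> nat"
  assumes f: "\<And>n. f n \<in> ae_full"
  obtains t s :: "nat \<Rightarrow> 'a \<Rightarrow> 'a" and B :: "nat \<Rightarrow> 'a set" and k :: "nat \<Rightarrow> nat" and p :: "nat \<Rightarrow> nat \<Rightarrow> nat"
  where "\<And>n. t n \<in> FG" "\<And>n. B n \<in> sets M" "\<And>n. 0 < k n" "\<And>n. measure M (B n) = 1 / real (k n)"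
    "\<And>n. tower (\<lambda>i. t n ^^ i) (\<lambda>_. B n) {..<k n}" "\<And>n. B (Suc n) \<subseteq> B n" "\<And>n. s n \<in> FG"
    "\<And>n x. x \<notin> B n \<Longrightarrow> s n x = x" "\<And>n. t (Suc n) = s n \<circ> t n" "\<And>n. L n (k n) \<le> k (Suc n)"
    "\<And>n. p n permutes {..<k (Suc n)}"
    "\<And>n. udist (f n) (blk (\<lambda>i. t (Suc n) ^^ i) (\<lambda>_. B (Suc n)) {..<k (Suc n)} (p n)) < 1 / 2 ^ n"
proof -
  define ok where "ok st \<longleftrightarrow> (case st of (t, B, k) \<Rightarrow> t \<in> FG \<and> B \<in> sets M \<and> 0 < k \<and> measure M B = 1 / real k \<and>
    tower (\<lambda>i. t ^^ i) (\<lambda>_. B) {..<k} \<and> (\<forall>x\<in>B. (t ^^ k) x = x))" for st :: "('a \<Rightarrow> 'a) \<times> 'a set \<times> nat"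
  define nx where "nx n st st' \<longleftrightarrow> (case st of (t, B, k) \<Rightarrow> case st' of (t', B', k') \<Rightarrow>
     \<exists>s p. B' \<subseteq> B \<and> s \<in> FG \<and> (\<forall>x. x \<notin> B \<longrightarrow> s x = x) \<and> t' = s \<circ> t \<and> L n k \<le> k' \<and> p permutes {..<k'} \<and>
       udist (f n) (blk (\<lambda>i. t' ^^ i) (\<lambda>_. B') {..<k'} p) < 1 / 2 ^ n)"
    for n and st st' :: "('a \<Rightarrow> 'a) \<times> 'a set \<times> nat"
  have step: "\<exists>st'. ok st' \<and> nx n st st'" if o: "ok st" for st n
  proof -
    obtain t B k where st: "st = (t, B, k)" by (cases st)
    have o': "t \<in> FG" "B \<in> sets M" "0 < k" "measure M B = 1 / real k" and tw: "tower (\<lambda>i. t ^^ i) (\<lambda>_. B) {..<k}"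
      and pr: "\<And>x. x \<in> B \<Longrightarrow> (t ^^ k) x = x" using o by (auto simp: ok_def st)
    have dj: "(t ^^ i) ` B \<inter> (t ^^ j) ` B = {}" if "i < k" "j < k" "i \<noteq> j" for i j
      using tw that unfolding tower_def by auto
    have e: "0 < (1 / 2 ^ n :: real)" by simp
    have ex: "\<exists>s B' N p. s \<in> FG \<and> (\<forall>x. x \<notin> B \<longrightarrow> s x = x) \<and> B' \<in> sets M \<and> B' \<subseteq> B \<and> L n k \<le> N \<and> 0 < N \<and>
      measure M B' = 1 / real (k * N) \<and> tower (\<lambda>i. (s \<circ> t) ^^ i) (\<lambda>_. B') {..<k * N} \<and>
      (\<forall>x\<in>B'. ((s \<circ> t) ^^ (k * N)) x = x) \<and> p permutes {..<k * N} \<and>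
      udist (f n) (blk (\<lambda>i. (s \<circ> t) ^^ i) (\<lambda>_. B') {..<k * N} p) < 1 / 2 ^ n"
      by (rule dye_step[OF o'(1,2,3) _ _ o'(4) f[of n] e]) (use dj pr in auto)
    then obtain s B' N p where s: "s \<in> FG" "\<forall>x. x \<notin> B \<longrightarrow> s x = x" "B' \<in> sets M" "B' \<subseteq> B" "L n k \<le> N" "0 < N"
      "measure M B' = 1 / real (k * N)" "tower (\<lambda>i. (s \<circ> t) ^^ i) (\<lambda>_. B') {..<k * N}"
      "\<forall>x\<in>B'. ((s \<circ> t) ^^ (k * N)) x = x" "p permutes {..<k * N}"
      "udist (f n) (blk (\<lambda>i. (s \<circ> t) ^^ i) (\<lambda>_. B') {..<k * N} p) < 1 / 2 ^ n"
      by (elim exE conjE) (rule that)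
    have "L n k \<le> k * N" using s(5) o'(3) by (metis le_trans mult_le_mono1 nat_mult_1 Suc_leI One_nat_def)
    moreover have "0 < k * N" using s(6) o'(3) by simp
    ultimately show ?thesis
      unfolding ok_def nx_def st
      by (intro exI[of _ "(s \<circ> t, B', k * N)"]) (use s FG_comp[OF s(1) o'(1)] in \<open>simp only: prod.case, blast\<close>)
  qed
  have ok0: "ok (id, space M, 1)"
    unfolding ok_def tower_def using FG_id prob_space by (auto simp: id_def[symmetric] lessThan_Suc)
  have "\<exists>F. \<forall>n. (ok (F n)) \<and> nx n (F n) (F (Suc n))"
    by (rule dependent_nat_choice) (use ok0 step in blast)+
  then obtain F where F: "\<And>n. ok (F n)" "\<And>n. nx n (F n) (F (Suc n))" by blast
  define t B k where "t n = fst (F n)" and "B n = fst (snd (F n))" and "k n = snd (snd (F n))" for n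
  have Fn: "F n = (t n, B n, k n)" for n by (simp add: t_def B_def k_def)
  have "\<forall>n. \<exists>s p. B (Suc n) \<subseteq> B n \<and> s \<in> FG \<and> (\<forall>x. x \<notin> B n \<longrightarrow> s x = x) \<and> t (Suc n) = s \<circ> t n \<and> L n (k n) \<le> k (Suc n) \<and>
     p permutes {..<k (Suc n)} \<and> udist (f n) (blk (\<lambda>i. t (Suc n) ^^ i) (\<lambda>_. B (Suc n)) {..<k (Suc n)} p) < 1 / 2 ^ n"
    using F(2) unfolding nx_def Fn prod.case by (rule allI)
  then obtain s p where sp: "\<And>n. B (Suc n) \<subseteq> B n \<and> s n \<in> FG \<and> (\<forall>x. x \<notin> B n \<longrightarrow> s n x = x) \<and> t (Suc n) = s n \<circ> t n \<and> L n (k n) \<le> k (Suc n) \<and>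
     p n permutes {..<k (Suc n)} \<and> udist (f n) (blk (\<lambda>i. t (Suc n) ^^ i) (\<lambda>_. B (Suc n)) {..<k (Suc n)} (p n)) < 1 / 2 ^ n"
    by metis
  have okn: "t n \<in> FG \<and> B n \<in> sets M \<and> 0 < k n \<and> measure M (B n) = 1 / real (k n) \<and>
    tower (\<lambda>i. t n ^^ i) (\<lambda>_. B n) {..<k n} \<and> (\<forall>x\<in>B n. (t n ^^ k n) x = x)" for n
    using F(1)[of n] unfolding ok_def Fn prod.case .
  show thesis
    by (rule that[of t B k s p]) (insert okn sp, blast+)
qed

text \<open>Preimages under all \<open>\<delta> i\<close> are added repeatedly to the null set;
  every stage is null, and a point outside all stages cannot be moved into one.\<close>

lemma invariant_conull:
  assumes Q: "Q \<in> null_sets M" and \<delta>: "\<And>i::nat. \<delta> i \<in> FG"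
  obtains Z where "Z \<in> sets M" "space M - Z \<in> null_sets M" "Z \<inter> Q = {}" "\<And>i x. x \<in> Z \<Longrightarrow> \<delta> i x \<in> Z"
proof -
  define R where "R = rec_nat Q (\<lambda>_ S. S \<union> (\<Union>i. \<delta> i -` S))"
  have R0: "R 0 = Q" and RS: "R (Suc j) = R j \<union> (\<Union>i. \<delta> i -` R j)" for j by (simp_all add: R_def)
  have Rn: "R j \<in> null_sets M" for j
    by (induction j) (use Q \<delta> in \<open>auto simp: R0 RS intro!: null_sets.Un null_sets_UN FG_null_vimage\<close>)
  define Z where "Z = space M - (\<Union>j. R j)"
  have U: "(\<Union>j. R j) \<in> null_sets M" using Rn by (rule null_sets_UN)
  show thesis
  proof (rule that[of Z])
    show "Z \<in> sets M" unfolding Z_def using U by auto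
    have "space M - Z = (\<Union>j. R j)" unfolding Z_def using null_setsD2[OF U] sets.sets_into_space by blast
    then show "space M - Z \<in> null_sets M" using U by simp
    show "Z \<inter> Q = {}" unfolding Z_def using R0 by blast
    fix i x assume x: "x \<in> Z"
    show "\<delta> i x \<in> Z"
    proof (rule ccontr)
      assume "\<delta> i x \<notin> Z"
      moreover have "\<delta> i x \<in> space M" using x \<delta> by (simp add: Z_def)
      ultimately obtain j where "\<delta> i x \<in> R j" unfolding Z_def by blast
      then have "x \<in> R (Suc j)" unfolding RS by blast
      then show False using x unfolding Z_def by blast
    qed
  qed
qed

text \<open>The automorphisms \<open>t n\<close> of the stages change only on sets of measure tending to zero. Their limit \<open>T\<close> is
  defined off a null set, and restricting to a conull set invariant under all \<open>t n\<close> makes it a bijection.\<close>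

lemma limit_automorphism:
  fixes t s :: "nat \<Rightarrow> 'a \<Rightarrow> 'a" and B :: "nat \<Rightarrow> 'a set" and k :: "nat \<Rightarrow> nat"
  assumes t: "\<And>n. t n \<in> FG" and B: "\<And>n. B n \<in> sets M" and lim: "(\<lambda>n. measure M (B n)) \<longlonglongrightarrow> 0"
    and dec: "\<And>n. B (Suc n) \<subseteq> B n" and s: "\<And>n x. x \<notin> B n \<Longrightarrow> s n x = x" and ts: "\<And>n. t (Suc n) = s n \<circ> t n"
  obtains T Z where "T \<in> FG" "Z \<in> sets M" "space M - Z \<in> null_sets M" "\<And>n x. x \<in> Z \<Longrightarrow> t n x \<in> Z"
    "\<And>n x. x \<in> Z \<Longrightarrow> t n x \<notin> B n \<Longrightarrow> T x = t n x"
proof -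
  \<comment> \<open>Once the image of a point has left \<open>B n\<close>, no later correction
    \<open>s m\<close> touches it, since these act inside smaller and smaller sets.\<close>
  have stab: "t m x = t n x \<and> t m x \<notin> B m" if "n \<le> m" "t n x \<notin> B n" for n m x
    using that(1)
  proof (induction m rule: dec_induct)
    case (step m)
    then show ?case using s[of "t m x" m] dec[of m] by (auto simp: ts)
  qed (use that in simp)
  \<comment> \<open>The second intersection contains the points whose images never stabilise, and
    the first one those on which the inverse is not determined at any stage.\<close>
  define Q where "Q = (\<Inter>n. B n) \<union> (\<Inter>n. t n -` B n)"
  have 1: "(\<Inter>n. A n) \<in> null_sets M" if A: "\<And>n. A n \<in> sets M" "\<And>n. measure M (A n) = measure M (B n)" for A :: "nat \<Rightarrow> 'a set"
  proof -
    have Am: "(\<Inter>n. A n) \<in> sets M" using A by auto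
    have "measure M (\<Inter>n. A n) \<le> measure M (B n)" for n
      using finite_measure_mono[of "\<Inter>n. A n" "A n"] A by auto
    then have "measure M (\<Inter>n. A n) \<le> 0" using lim by (intro LIMSEQ_le_const[OF lim]) auto
    then show ?thesis using Am by (auto simp: null_sets_def emeasure_eq_measure measure_le_0_iff)
  qed
  have Qn: "Q \<in> null_sets M"
    unfolding Q_def
    by (intro null_sets.Un 1) (use B t FG_measure_vimage in auto)
  \<comment> \<open>Inverses are included so that the conull set is invariant in both
    directions.\<close>
  define \<delta> where "\<delta> i = (if even i then t (i div 2) else inv_fun (t (i div 2)))" for i
  have \<delta>: "\<delta> i \<in> FG" for i using t FG_inv by (simp add: \<delta>_def)
  obtain Z where Z: "Z \<in> sets M" "space M - Z \<in> null_sets M" "Z \<inter> Q = {}" "\<And>i x. x \<in> Z \<Longrightarrow> \<delta> i x \<in> Z"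
    by (rule invariant_conull[of Q \<delta>, OF Qn \<delta>]) blast
  have tZ: "t n x \<in> Z" "inv_fun (t n) x \<in> Z" if "x \<in> Z" for n x
    using Z(4)[OF that, of "2 * n"] Z(4)[OF that, of "Suc (2 * n)"] by (auto simp: \<delta>_def)
  define T where "T x = (if x \<in> Z then t (LEAST n. t n x \<notin> B n) x else x)" for x
  define S where "S y = (if y \<in> Z then inv_fun (t (LEAST n. y \<notin> B n)) y else y)" for y
  have Tt: "T x = t n x" if x: "x \<in> Z" "t n x \<notin> B n" for n x
  proof -
    have m: "t (LEAST n. t n x \<notin> B n) x \<notin> B (LEAST n. t n x \<notin> B n)" by (rule LeastI[of _ n]) (rule x)
    have mn: "(LEAST n. t n x \<notin> B n) \<le> n" by (rule Least_le) (rule x)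
    show ?thesis using stab[OF mn m] x(1) by (simp add: T_def)
  qed
  have St: "S y = inv_fun (t n) y" if y: "y \<in> Z" "y \<notin> B n" for n y
  proof -
    let ?m = "LEAST n. y \<notin> B n"
    have m: "y \<notin> B ?m" by (rule LeastI[of _ n]) (rule y)
    have mn: "?m \<le> n" by (rule Least_le) (rule y)
    have "t n (inv_fun (t ?m) y) = t ?m (inv_fun (t ?m) y)" using stab[OF mn, of "inv_fun (t ?m) y"] m t by simp
    then have "t n (inv_fun (t ?m) y) = y" using t by simp
    then have "inv_fun (t n) y = inv_fun (t ?m) y" using t by (metis FG_inv_f)
    then show ?thesis using y by (simp add: S_def)
  qed
  have exT: "\<exists>n. t n x \<notin> B n" if "x \<in> Z" for x using Z(3) that by (auto simp: Q_def)
  have exS: "\<exists>n. y \<notin> B n" if "y \<in> Z" for y using Z(3) that by (auto simp: Q_def)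
  have ST: "S (T x) = x" for x
  proof (cases "x \<in> Z")
    case True
    then obtain n where n: "t n x \<notin> B n" using exT by blast
    have "T x = t n x" by (rule Tt[OF True n])
    then show ?thesis using St[OF tZ(1)[OF True] n] t by simp
  qed (simp add: T_def S_def)
  have TS: "T (S y) = y" for y
  proof (cases "y \<in> Z")
    case True
    then obtain n where n: "y \<notin> B n" using exS by blast
    have "t n (inv_fun (t n) y) \<notin> B n" using n t by simp
    then have "T (inv_fun (t n) y) = t n (inv_fun (t n) y)" by (rule Tt[OF tZ(2)[OF True]])
    then have "T (inv_fun (t n) y) = y" using t by simp
    then show ?thesis using St[OF True n] by simp
  qed (simp add: T_def S_def)
  have bT: "bij T" by (rule o_bij[of S]) (auto simp: ST TS)
  define A where "A i = (case i of None \<Rightarrow> space M - Z | Some n \<Rightarrow> Z - t n -` B n)" for i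
  define g where "g i = (case i of None \<Rightarrow> id | Some n \<Rightarrow> t n)" for i
  have ZM: "Z \<subseteq> space M" by (rule sets.sets_into_space[OF Z(1)])
  have "T \<in> FG"
  proof (rule glue[OF bT, where I = UNIV and A = A and g = g])
    show "T x = x" if "x \<notin> space M" for x using that ZM by (auto simp: T_def)
    show "A i \<in> sets M" for i using Z(1) B t by (auto simp: A_def split: option.split)
    show "g i \<in> FG" for i using t FG_id by (auto simp: g_def split: option.split)
    show "\<exists>i\<in>UNIV. x \<in> A i" if "x \<in> space M" for x
    proof (cases "x \<in> Z")
      case True
      then obtain n where "t n x \<notin> B n" using exT by blast
      then have "x \<in> A (Some n)" using True by (simp add: A_def)
      then show ?thesis by blast
    next
      case False
      then have "x \<in> A None" using that by (simp add: A_def)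
      then show ?thesis by blast
    qed
    show "T x = g i x" if "x \<in> A i" for i x
      using that Tt by (cases i) (auto simp: A_def g_def T_def)
  qed auto
  then show thesis using that[of T Z] Z(1,2) tZ(1) Tt by blast
qed

text \<open>Shrinking the base changes the map only over \<open>C - D\<close>, on each level at most
  by the measure of that set.\<close>

lemma blk_mono_close:
  assumes t: "tower \<theta> (\<lambda>_. C) J" and J: "finite J" and D: "D \<in> sets M" "D \<subseteq> C" and C: "C \<in> sets M" and p: "p permutes J"
  shows "tower \<theta> (\<lambda>_. D) J" "udist (blk \<theta> (\<lambda>_. C) J p) (blk \<theta> (\<lambda>_. D) J p) \<le> real (card J) * measure M (C - D)"
proof -
  show t': "tower \<theta> (\<lambda>_. D) J"
    using t D unfolding tower_def by blast
  have "{x \<in> space M. blk \<theta> (\<lambda>_. C) J p x \<noteq> blk \<theta> (\<lambda>_. D) J p x} \<subseteq> (\<Union>l\<in>J. \<theta> l ` (C - D))"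
  proof
    fix x assume x: "x \<in> {x \<in> space M. blk \<theta> (\<lambda>_. C) J p x \<noteq> blk \<theta> (\<lambda>_. D) J p x}"
    show "x \<in> (\<Union>l\<in>J. \<theta> l ` (C - D))"
    proof (cases "\<exists>l\<in>J. x \<in> \<theta> l ` C")
      case True
      then obtain l z where l: "l \<in> J" "z \<in> C" "x = \<theta> l z" by blast
      have "z \<notin> D" using x l blk_app[OF t l(1), of z p] blk_app[OF t' l(1), of z p] by auto
      then show ?thesis using l by blast
    next
      case False
      then have "blk \<theta> (\<lambda>_. C) J p x = x" "blk \<theta> (\<lambda>_. D) J p x = x"
        using D(2) by (auto intro!: blk_out)
      then show ?thesis using x by simp
    qed
  qed
  moreover have "\<theta> l ` (C - D) \<in> sets M" "measure M (\<theta> l ` (C - D)) = measure M (C - D)" if "l \<in> J" for l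
    using towerD(2)[OF t that] C D FG_measure by auto
  ultimately have "udist (blk \<theta> (\<lambda>_. C) J p) (blk \<theta> (\<lambda>_. D) J p) \<le> measure M (\<Union>l\<in>J. \<theta> l ` (C - D))"
    unfolding udist_def using J by (intro finite_measure_mono) auto
  also have "\<dots> \<le> real (card J) * measure M (C - D)"
    by (rule measure_UN_le[OF J]) (use towerD(2)[OF t] C D FG_measure in auto)
  finally show "udist (blk \<theta> (\<lambda>_. C) J p) (blk \<theta> (\<lambda>_. D) J p) \<le> real (card J) * measure M (C - D)" .
qed

lemma measurable_FG: "f \<in> FG \<Longrightarrow> f \<in> measurable M M"
  by (rule FG_D(2))

lemma blk_perm_FG: "tower \<theta> (\<lambda>_. Z) J \<Longrightarrow> p permutes J \<Longrightarrow> blk \<theta> (\<lambda>_. Z) J p \<in> FG"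
  by (rule blk_FG) (auto simp: permutes_imp_bij)

text \<open>Below the top level, the stage automorphism \<open>t (Suc n)\<close> sends a level of
  its tower outside the base \<open>B (Suc n)\<close>, where it already agrees with the limit. Hence
  the towers of all stages, restricted to a conull set, are towers of the one automorphism
  \<open>T\<close>. The lower bound on \<open>L\<close> makes the measures of the bases tend to
  zero.\<close>

lemma odometer:
  fixes f :: "nat \<Rightarrow> 'a \<Rightarrow> 'a" and L :: "nat \<Rightarrow> nat \<Rightarrow> nat"
  assumes f: "\<And>n. f n \<in> ae_full" and L: "\<And>n k. 2 ^ Suc n \<le> L n k"
  obtains T :: "'a \<Rightarrow> 'a" and C :: "nat \<Rightarrow> 'a set" and h :: "nat \<Rightarrow> nat" and p :: "nat \<Rightarrow> nat \<Rightarrow> nat"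
  where "T \<in> FG" "\<And>n. C n \<in> sets M" "\<And>n. measure M (C n) = 1 / real (h n)"
    "\<And>n. tower (\<lambda>i. T ^^ i) (\<lambda>_. C n) {..<h n}" "\<And>n. p n permutes {..<h n}"
    "\<And>n. L (Suc n) (h n) \<le> h (Suc n)" "\<exists>k. L 0 k \<le> h 0"
    "\<And>n. udist (f n) (blk (\<lambda>i. T ^^ i) (\<lambda>_. C n) {..<h n} (p n)) < 1 / 2 ^ n"
proof -
  obtain t s :: "nat \<Rightarrow> 'a \<Rightarrow> 'a" and B :: "nat \<Rightarrow> 'a set" and k :: "nat \<Rightarrow> nat" and p :: "nat \<Rightarrow> nat \<Rightarrow> nat"
    where t: "\<And>n. t n \<in> FG" and B: "\<And>n. B n \<in> sets M" and k0: "\<And>n. 0 < k n" and mB: "\<And>n. measure M (B n) = 1 / real (k n)"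
    and tw: "\<And>n. tower (\<lambda>i. t n ^^ i) (\<lambda>_. B n) {..<k n}" and dec: "\<And>n. B (Suc n) \<subseteq> B n"
    and s: "\<And>n x. x \<notin> B n \<Longrightarrow> s n x = x" and ts: "\<And>n. t (Suc n) = s n \<circ> t n" and kL: "\<And>n. L n (k n) \<le> k (Suc n)"
    and p: "\<And>n. p n permutes {..<k (Suc n)}"
    and ap: "\<And>n. udist (f n) (blk (\<lambda>i. t (Suc n) ^^ i) (\<lambda>_. B (Suc n)) {..<k (Suc n)} (p n)) < 1 / 2 ^ n"
    by (rule stage_sequence[of f L, OF f]) blast
  have k2: "2 ^ n \<le> k n" for n
  proof (cases n)
    case 0 then show ?thesis using k0[of 0] by simp
  next
    case (Suc m) then show ?thesis using L[of m "k m"] kL[of m] by simp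
  qed
  have lim: "(\<lambda>n. measure M (B n)) \<longlonglongrightarrow> 0"
  proof (rule Lim_null_comparison)
    have "real (2 ^ n) \<le> real (k n)" for n using k2[of n] by (rule of_nat_mono)
    then show "\<forall>\<^sub>F n in sequentially. norm (measure M (B n)) \<le> (1 / 2) ^ n"
      by (auto simp: mB power_divide intro!: always_eventually frac_le)
    show "(\<lambda>n. (1 / 2 :: real) ^ n) \<longlonglongrightarrow> 0" by (rule LIMSEQ_realpow_zero) auto
  qed
  obtain T Z where T: "T \<in> FG" and Z: "Z \<in> sets M" "space M - Z \<in> null_sets M" and tZ: "\<And>n x. x \<in> Z \<Longrightarrow> t n x \<in> Z"
    and Tt: "\<And>n x. x \<in> Z \<Longrightarrow> t n x \<notin> B n \<Longrightarrow> T x = t n x"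
    by (rule limit_automorphism[of t B s, OF t B lim dec _ ts]) (erule s, (rule that; (assumption | blast)))
  \<comment> \<open>The index is shifted by one because the tower approximating \<open>f n\<close>
    belongs to stage \<open>Suc n\<close>.\<close>
  define C h where "C n = B (Suc n) \<inter> Z" and "h n = k (Suc n)" for n
  have powZ: "(t n ^^ i) x \<in> Z" if "x \<in> Z" for n i x by (induction i) (use that tZ in auto)
  have pow: "(T ^^ i) x = (t (Suc n) ^^ i) x" if x: "x \<in> C n" and i: "i < h n" for n i x
    using i
  proof (induction i)
    case (Suc i)
    have "(t (Suc n) ^^ Suc i) x \<notin> B (Suc n)"
    proof
      assume "(t (Suc n) ^^ Suc i) x \<in> B (Suc n)"
      then have "Suc i = 0"
        using towerD(4)[OF tw[of "Suc n"], of "Suc i" 0 x "(t (Suc n) ^^ Suc i) x"] x Suc.prems by (auto simp: C_def h_def)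
      then show False by simp
    qed
    then have "T ((t (Suc n) ^^ i) x) = t (Suc n) ((t (Suc n) ^^ i) x)"
      using powZ x by (intro Tt) (auto simp: C_def)
    then show ?case using Suc by simp
  qed simp
  have Cm: "C n \<in> sets M" for n using B Z by (auto simp: C_def)
  have CB: "C n \<subseteq> B (Suc n)" for n by (auto simp: C_def)
  have BC: "measure M (B (Suc n) - C n) = 0" for n
  proof -
    have "B (Suc n) - C n \<subseteq> space M - Z" using sets.sets_into_space[OF B[of "Suc n"]] by (auto simp: C_def)
    then have "measure M (B (Suc n) - C n) \<le> measure M (space M - Z)" using Z by (intro finite_measure_mono) auto
    also have "\<dots> = 0" using Z(2) by (simp add: null_sets_def measure_def)
    finally show ?thesis by (simp add: measure_le_0_iff)
  qed
  have mC: "measure M (C n) = 1 / real (h n)" for n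
    using finite_measure_Diff[OF B[of "Suc n"] Cm[of n] CB] BC[of n] mB[of "Suc n"] by (simp add: h_def)
  have tC: "tower (\<lambda>i. t (Suc n) ^^ i) (\<lambda>_. C n) {..<h n}"
    and cl: "udist (blk (\<lambda>i. t (Suc n) ^^ i) (\<lambda>_. B (Suc n)) {..<h n} (p n)) (blk (\<lambda>i. t (Suc n) ^^ i) (\<lambda>_. C n) {..<h n} (p n)) \<le> 0" for n
    using blk_mono_close[OF tw[of "Suc n"] _ Cm CB B p] BC[of n] by (auto simp: h_def)
  have TC: "tower (\<lambda>i. T ^^ i) (\<lambda>_. C n) {..<h n}" for n
    unfolding tower_def
  proof (intro conjI ballI impI)
    fix l m assume lm: "l \<in> {..<h n}" "m \<in> {..<h n}" "l \<noteq> m"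
    have "(T ^^ i) ` C n = (t (Suc n) ^^ i) ` C n" if "i < h n" for i using pow that by auto
    then show "(T ^^ l) ` C n \<inter> (T ^^ m) ` C n = {}"
      using tC[of n] lm unfolding tower_def by auto
  qed (use Cm FG_pow[OF T] in auto)
  have eq: "blk (\<lambda>i. T ^^ i) (\<lambda>_. C n) {..<h n} (p n) = blk (\<lambda>i. t (Suc n) ^^ i) (\<lambda>_. C n) {..<h n} (p n)" for n
  proof
    fix x
    show "blk (\<lambda>i. T ^^ i) (\<lambda>_. C n) {..<h n} (p n) x = blk (\<lambda>i. t (Suc n) ^^ i) (\<lambda>_. C n) {..<h n} (p n) x"
    proof (cases "\<exists>l\<in>{..<h n}. x \<in> (T ^^ l) ` C n")
      case True
      then obtain l z where l: "l < h n" "z \<in> C n" "x = (T ^^ l) z" by auto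
      have x': "x = (t (Suc n) ^^ l) z" using l pow by simp
      have pl: "p n l < h n" using permutes_in_image[OF p[of n], of l] l by (simp add: h_def)
      have "blk (\<lambda>i. T ^^ i) (\<lambda>_. C n) {..<h n} (p n) x = (T ^^ p n l) z"
        unfolding l(3) using blk_app[OF TC, of l n z] l by simp
      moreover have "blk (\<lambda>i. t (Suc n) ^^ i) (\<lambda>_. C n) {..<h n} (p n) x = (t (Suc n) ^^ p n l) z"
        unfolding x' using blk_app[OF tC, of l n z] l by simp
      ultimately show ?thesis using pow[OF l(2) pl] by simp
    next
      case False
      then have "\<not> (\<exists>l\<in>{..<h n}. x \<in> (t (Suc n) ^^ l) ` C n)" using pow by (auto simp: image_iff)
      then have "blk (\<lambda>i. T ^^ i) (\<lambda>_. C n) {..<h n} (p n) x = x"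
        "blk (\<lambda>i. t (Suc n) ^^ i) (\<lambda>_. C n) {..<h n} (p n) x = x" using False by (auto intro!: blk_out)
      then show ?thesis by simp
    qed
  qed
  have fin: "udist (f n) (blk (\<lambda>i. T ^^ i) (\<lambda>_. C n) {..<h n} (p n)) < 1 / 2 ^ n" for n
  proof -
    have ph: "p n permutes {..<h n}" using p by (simp add: h_def)
    have fm: "f n \<in> measurable M M" using f[of n] mp_autsD(2) by (auto simp: ae_full_def)
    have "udist (f n) (blk (\<lambda>i. t (Suc n) ^^ i) (\<lambda>_. C n) {..<h n} (p n)) \<le>
       udist (f n) (blk (\<lambda>i. t (Suc n) ^^ i) (\<lambda>_. B (Suc n)) {..<h n} (p n)) +
       udist (blk (\<lambda>i. t (Suc n) ^^ i) (\<lambda>_. B (Suc n)) {..<h n} (p n)) (blk (\<lambda>i. t (Suc n) ^^ i) (\<lambda>_. C n) {..<h n} (p n))"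
      using blk_perm_FG[OF tC ph] blk_perm_FG[OF tw p[of n]]
      by (intro udist_triangle fm measurable_FG) (auto simp: h_def)
    then show ?thesis unfolding eq using ap[of n] cl[of n] unfolding h_def by linarith
  qed
  show thesis
  proof (rule that[of T C h p])
    show "p n permutes {..<h n}" "L (Suc n) (h n) \<le> h (Suc n)" for n using p kL by (auto simp: h_def)
    show "\<exists>k. L 0 k \<le> h 0" using kL[of 0] by (auto simp: h_def)
  qed (use T Cm mC TC fin in auto)
qed

end

section \<open>Two topological generators\<close>

definition cyc :: "nat \<Rightarrow> nat \<Rightarrow> nat" where
  "cyc p i = (if i < p then Suc i mod p else i)"

text \<open>The effect on levels of conjugation by \<open>T\<close>: what happened at
  \<open>j\<close> now happens at \<open>Suc j\<close>. It permutes the levels of the tower again if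
  the top level was fixed.\<close>

definition shift_perm :: "(nat \<Rightarrow> nat) \<Rightarrow> nat \<Rightarrow> nat" where
  "shift_perm a i = (case i of 0 \<Rightarrow> 0 | Suc j \<Rightarrow> Suc (a j))"

definition tricycle :: "nat \<Rightarrow> nat \<Rightarrow> nat" where
  "tricycle j i = (if i = j then j + 1 else if i = j + 1 then j + 2 else if i = j + 2 then j else i)"

lemma shift_tricycle: "shift_perm (tricycle j) = tricycle (Suc j)"
  by (rule ext) (auto simp: shift_perm_def tricycle_def split: nat.splits)

lemma cyc_alt: "cyc p i = (if i < p then if Suc i = p then 0 else Suc i else i)"
  by (auto simp: cyc_def)

lemma shift_cyc_alt: "shift_perm (cyc p) i = (if i = 0 then 0 else if i < p then Suc i else if i = p then 1 else i)"
  if "0 < p"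
  using that by (auto simp: shift_perm_def cyc_alt split: nat.splits)

lemma cyc_permutes: assumes "p \<le> h" shows "cyc p permutes {..<h}"
proof (rule bij_imp_permutes)
  have inj: "inj_on (cyc p) {..<h}" by (rule inj_onI) (auto simp: cyc_alt split: if_splits)
  moreover have sub: "cyc p ` {..<h} \<subseteq> {..<h}" using assms by (auto simp: cyc_alt)
  ultimately show "bij_betw (cyc p) {..<h} {..<h}"
    by (auto simp: bij_betw_def dest: endo_inj_surj[rotated])
qed (use assms in \<open>auto simp: cyc_alt\<close>)

text \<open>With \<open>c\<close> the cycle of the first \<open>p\<close> points and \<open>c'\<close> its shift, \<open>c' c' c\<inverse> c'\<inverse>\<close> is the cycle of the
  first three points; shifts of it sort all but the last two points.\<close>

lemma sort_by_cycles:
  fixes G :: "(nat \<Rightarrow> nat) set"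
  assumes comp: "\<And>a b. a \<in> G \<Longrightarrow> b \<in> G \<Longrightarrow> a \<circ> b \<in> G" and inv: "\<And>a. a \<in> G \<Longrightarrow> inv_fun a \<in> G"
    and perm: "\<And>a. a \<in> G \<Longrightarrow> a permutes {..<h}" and cyc: "cyc p \<in> G" and p: "3 \<le> p" "p < h"
    and shift: "\<And>a. a \<in> G \<Longrightarrow> a (h - 1) = h - 1 \<Longrightarrow> shift_perm a \<in> G"
    and \<pi>: "\<pi> permutes {..<h}"
  shows "\<exists>g\<in>G. \<forall>i<h - 2. g i = \<pi> i"
proof -
  have inv1: "inv_fun a (a x) = x" "a (inv_fun a x) = x" if "a \<in> G" for a x
    using permutes_inverses[OF perm[OF that]] by auto
  have idG: "id \<in> G"
  proof -
    have "cyc p \<circ> inv_fun (cyc p) = id" using inv1[OF cyc] by auto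
    then show ?thesis using comp[OF cyc inv[OF cyc]] by simp
  qed
  \<comment> \<open>Here \<open>c\<close> is the shifted cycle, written c' in the comment above, and
    \<open>cyc p\<close> is the original one.\<close>
  define c where "c = shift_perm (cyc p)"
  have cG: "c \<in> G" unfolding c_def by (rule shift[OF cyc]) (use p in \<open>auto simp: cyc_alt\<close>)
  have c: "c i = (if i = 0 then 0 else if i < p then Suc i else if i = p then 1 else i)" for i
    unfolding c_def using p by (intro shift_cyc_alt) auto
  have e: "tricycle 0 (c (cyc p i)) = c (c i)" for i
  proof -
    consider "i = 0" | "0 < i" "Suc i < p" | "0 < i" "Suc i = p" | "i = p" | "p < i" using p by linarith
    then show ?thesis
      by cases (use p in \<open>simp_all add: tricycle_def c cyc_alt\<close>)
  qed
  have t0: "tricycle 0 \<in> G"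
  proof -
    have d: "c \<circ> cyc p \<in> G" by (rule comp[OF cG cyc])
    have "tricycle 0 x = ((c \<circ> c) \<circ> inv_fun (c \<circ> cyc p)) x" for x
      using e[of "inv_fun (c \<circ> cyc p) x"] inv1(2)[OF d, of x] by simp
    then have "tricycle 0 = (c \<circ> c) \<circ> inv_fun (c \<circ> cyc p)" by (rule ext)
    then show ?thesis using comp[OF comp[OF cG cG] inv[OF d]] by simp
  qed
  have tj: "tricycle j \<in> G" if "j + 3 \<le> h" for j
    using that
  proof (induction j)
    case (Suc j)
    then have "tricycle j (h - 1) = h - 1" by (auto simp: tricycle_def)
    then show ?case using shift[of "tricycle j"] Suc by (simp add: shift_tricycle)
  qed (use t0 in simp)
  \<comment> \<open>A three-cycle on \<open>a - 2\<close>, \<open>a - 1\<close>, \<open>a\<close>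
    brings \<open>a\<close> down by two; a last step by one uses an inverse three-cycle on
    \<open>m\<close>, \<open>m + 1\<close>, \<open>m + 2\<close>. None of these touches positions
    below \<open>m\<close>. The need for \<open>m + 2 < h\<close> is why the last two positions stay
    unsorted.\<close>
  have move: "\<exists>g\<in>G. g a = m \<and> (\<forall>i<m. g i = i)" if "m \<le> a" "a < h" "m < h - 2" for m a
    using that
  proof (induction a rule: less_induct)
    case (less a)
    consider "a = m" | "a = Suc m" | "m + 2 \<le> a" using less.prems by linarith
    then show ?case
    proof cases
      case 1 then show ?thesis using idG by (intro bexI[of _ id]) auto
    next
      case 2
      have tG: "tricycle m \<in> G" using less.prems by (intro tj) auto
      have "inv_fun (tricycle m) (tricycle m m) = m" "\<And>i. inv_fun (tricycle m) (tricycle m i) = i"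
        using inv1(1)[OF tG] by auto
      moreover have "tricycle m m = a" "\<And>i. i < m \<Longrightarrow> tricycle m i = i" using 2 by (auto simp: tricycle_def)
      ultimately show ?thesis using inv[OF tG] by (intro bexI[of _ "inv_fun (tricycle m)"]) (auto, metis)
    next
      case 3
      have tG: "tricycle (a - 2) \<in> G" using less.prems 3 by (intro tj) auto
      have "\<exists>g\<in>G. g (a - 2) = m \<and> (\<forall>i<m. g i = i)"
        by (rule less.IH) (use less.prems 3 in auto)
      then obtain g where g: "g \<in> G" "g (a - 2) = m" "\<And>i. i < m \<Longrightarrow> g i = i" by blast
      have "tricycle (a - 2) a = a - 2" "\<And>i. i < m \<Longrightarrow> tricycle (a - 2) i = i"
        using 3 by (auto simp: tricycle_def)
      then show ?thesis using g comp[OF g(1) tG] by (intro bexI[of _ "g \<circ> tricycle (a - 2)"]) auto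
    qed
  qed
  \<comment> \<open>Selection sort of \<open>\<pi>\<close>: positions already settled are kept
    because \<open>move\<close> fixes everything below \<open>m\<close>. The inverse of the sorting
    element agrees with \<open>\<pi>\<close>.\<close>
  have "\<exists>g\<in>G. \<forall>i<m. g (\<pi> i) = i" if "m \<le> h - 2" for m
    using that
  proof (induction m)
    case (Suc m)
    then obtain g where g: "g \<in> G" "\<And>i. i < m \<Longrightarrow> g (\<pi> i) = i" by auto
    have r: "(g \<circ> \<pi>) permutes {..<h}" by (rule permutes_compose[OF \<pi> perm[OF g(1)]])
    define a where "a = g (\<pi> m)"
    have ah: "a < h" using permutes_in_image[OF r, of m] Suc.prems by (auto simp: a_def)
    have am: "m \<le> a"
    proof (rule ccontr)
      assume "\<not> m \<le> a"
      then have "(g \<circ> \<pi>) a = (g \<circ> \<pi>) m" using g(2)[of a] by (simp add: a_def)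
      then have "a = m" by (rule injD[OF permutes_inj[OF r]])
      then show False using \<open>\<not> m \<le> a\<close> by simp
    qed
    obtain g' where g': "g' \<in> G" "g' a = m" "\<And>i. i < m \<Longrightarrow> g' i = i" using move[OF am ah] Suc.prems by auto
    have "(g' \<circ> g) (\<pi> i) = i" if "i < Suc m" for i
      using that g(2) g'(2,3) by (auto simp: less_Suc_eq a_def)
    then show ?case using comp[OF g'(1) g(1)] by blast
  qed (use idG in auto)
  then obtain g where g: "g \<in> G" "\<And>i. i < h - 2 \<Longrightarrow> g (\<pi> i) = i" by blast
  have "inv_fun g i = \<pi> i" if "i < h - 2" for i
    using g(2)[OF that] inv1(1)[OF g(1), of "\<pi> i"] by simp
  then show ?thesis using inv[OF g(1)] by blast
qed

lemma prime_sequence: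
  obtains q :: "nat \<Rightarrow> nat" where "strict_mono q" "\<And>n. 3 \<le> q n" "\<And>m n. m \<noteq> n \<Longrightarrow> coprime (q m) (q n)"
proof -
  let ?S = "{p::nat. prime p} - {..<3}"
  have inf: "infinite ?S" using primes_infinite by (intro Diff_infinite_finite) auto
  have S: "enumerate ?S n \<in> ?S" for n by (rule enumerate_in_set[OF inf])
  have sm: "strict_mono (enumerate ?S)" by (rule strict_mono_enumerate[OF inf])
  show thesis
  proof (rule that[OF sm])
    show "3 \<le> enumerate ?S n" for n using S[of n] by auto
    fix m n :: nat assume "m \<noteq> n"
    then have "enumerate ?S m \<noteq> enumerate ?S n" using sm by (simp add: strict_mono_eq)
    then show "coprime (enumerate ?S m) (enumerate ?S n)" using S by (intro primes_coprime) auto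
  qed
qed

section \<open>The closure of the generated group\<close>

context hyperfinite_setting
begin

text \<open>The inner map preserves the measure, so composing with it on the right does not change
  the size of the set where \<open>f\<close> and \<open>f'\<close> differ.\<close>

lemma udist_comp:
  assumes "f \<in> mp_auts M" "f' \<in> mp_auts M" "g \<in> mp_auts M" "g' \<in> mp_auts M"
  shows "udist (f \<circ> g) (f' \<circ> g') \<le> udist f f' + udist g g'"
proof -
  note meas = assms[THEN mp_autsD(2)]
  let ?A = "{x \<in> space M. f x \<noteq> f' x}"
  have A: "?A \<in> sets M" by (rule neq_sets[OF meas(1,2)])
  have "{x \<in> space M. (f \<circ> g) x \<noteq> (f' \<circ> g') x} \<subseteq> (g -` ?A \<inter> space M) \<union> {x \<in> space M. g x \<noteq> g' x}"
    using measurable_space[OF meas(3)] by auto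
  then have "udist (f \<circ> g) (f' \<circ> g') \<le> measure M ((g -` ?A \<inter> space M) \<union> {x \<in> space M. g x \<noteq> g' x})"
    unfolding udist_def by (rule finite_measure_mono) (intro sets.Un measurable_sets[OF meas(3) A] neq_sets meas)
  also have "\<dots> \<le> measure M (g -` ?A \<inter> space M) + udist g g'"
    unfolding udist_def by (intro measure_Un_le measurable_sets[OF meas(3) A] neq_sets meas)
  also have "measure M (g -` ?A \<inter> space M) = measure (distr M M g) ?A"
    by (rule measure_distr[OF meas(3) A, symmetric])
  finally show ?thesis using mp_autsD(3)[OF assms(3)] by (simp add: udist_def)
qed

text \<open>The set where the inverses differ is the image under \<open>f\<close> of the set where
  the maps differ.\<close>

lemma udist_inv: assumes "f \<in> FG" "g \<in> FG" shows "udist (inv_fun f) (inv_fun g) = udist f g"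
proof -
  have s: "{x \<in> space M. f x \<noteq> g x} \<in> sets M" using assms by (auto intro!: neq_sets measurable_FG)
  have "{x \<in> space M. inv_fun f x \<noteq> inv_fun g x} = f ` {x \<in> space M. f x \<noteq> g x}"
  proof (intro equalityI subsetI)
    fix x assume x: "x \<in> {x \<in> space M. inv_fun f x \<noteq> inv_fun g x}"
    have "f (inv_fun f x) = x" using assms by simp
    moreover have "g (inv_fun f x) \<noteq> x"
    proof
      assume "g (inv_fun f x) = x"
      then have "inv_fun g x = inv_fun g (g (inv_fun f x))" by simp
      then show False using x assms by simp
    qed
    moreover have "inv_fun f x \<in> space M" using x FG_space[OF FG_inv[OF assms(1)]] by simp
    ultimately show "x \<in> f ` {x \<in> space M. f x \<noteq> g x}" by (intro image_eqI[of _ f "inv_fun f x"]) auto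
  next
    fix x assume "x \<in> f ` {x \<in> space M. f x \<noteq> g x}"
    then obtain y where y: "y \<in> space M" "f y \<noteq> g y" "x = f y" by blast
    have "inv_fun g x \<noteq> y" using y assms by (metis FG_f_inv)
    then show "x \<in> {x \<in> space M. inv_fun f x \<noteq> inv_fun g x}" using y assms by simp
  qed
  then show ?thesis using FG_measure[OF assms(1) s] by (simp add: udist_def)
qed

text \<open>The generated group at the level of maps; \<open>words_generate\<close> later transfers
  it to classes.\<close>

inductive_set words :: "('a \<Rightarrow> 'a) set \<Rightarrow> ('a \<Rightarrow> 'a) set" for S where
  base: "f \<in> S \<Longrightarrow> f \<in> words S"
| one: "id \<in> words S"
| comp: "f \<in> words S \<Longrightarrow> g \<in> words S \<Longrightarrow> f \<circ> g \<in> words S"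
| inv: "f \<in> words S \<Longrightarrow> inv_fun f \<in> words S"

lemma words_FG: assumes "S \<subseteq> FG" "f \<in> words S" shows "f \<in> FG"
  using assms(2)
proof induction
  case (comp f g)
  show ?case by (rule FG_comp[OF comp.IH])
qed (use assms(1) FG_id FG_inv in blast)+

lemma words_pow: "f \<in> words S \<Longrightarrow> f ^^ n \<in> words S"
  by (induction n) (auto intro: words.intros simp: id_def[symmetric])

definition cl :: "('a \<Rightarrow> 'a) set \<Rightarrow> ('a \<Rightarrow> 'a) set" where
  "cl S = {f \<in> FG. \<forall>e>0. \<exists>w\<in>words S. udist f w < e}"

lemma udist_self [simp]: "udist f f = 0"
  by (simp add: udist_def)

lemma cl_base: "S \<subseteq> FG \<Longrightarrow> f \<in> words S \<Longrightarrow> f \<in> cl S"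
  unfolding cl_def using words_FG by (auto intro!: bexI[of _ f])

lemma cl_comp: assumes S: "S \<subseteq> FG" and f: "f \<in> cl S" and g: "g \<in> cl S" shows "f \<circ> g \<in> cl S"
proof -
  have FGs: "f \<in> FG" "g \<in> FG" using f g by (auto simp: cl_def)
  have "\<exists>w\<in>words S. udist (f \<circ> g) w < e" if e: "0 < e" for e
  proof -
    have e2: "0 < e / 2" using e by simp
    obtain v where v: "v \<in> words S" "udist f v < e / 2" using f e2 unfolding cl_def by blast
    obtain w where w: "w \<in> words S" "udist g w < e / 2" using g e2 unfolding cl_def by blast
    have "udist (f \<circ> g) (v \<circ> w) \<le> udist f v + udist g w"
      by (intro udist_comp FG_mp FGs words_FG[OF S] v(1) w(1))
    then show ?thesis using v w words.comp[OF v(1) w(1)] by (intro bexI[of _ "v \<circ> w"]) auto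
  qed
  then show ?thesis using FG_comp[OF FGs] by (auto simp: cl_def)
qed

lemma cl_inv: assumes S: "S \<subseteq> FG" and f: "f \<in> cl S" shows "inv_fun f \<in> cl S"
proof -
  have FGf: "f \<in> FG" using f by (auto simp: cl_def)
  have "\<exists>w\<in>words S. udist (inv_fun f) w < e" if e: "0 < e" for e
  proof -
    obtain v where v: "v \<in> words S" "udist f v < e" using f e unfolding cl_def by blast
    then have "udist (inv_fun f) (inv_fun v) < e" using udist_inv[OF FGf words_FG[OF S v(1)]] by simp
    then show ?thesis using words.inv[OF v(1)] by blast
  qed
  then show ?thesis using FG_inv[OF FGf] by (auto simp: cl_def)
qed

text \<open>The closure of the words contains each cycle of \<open>q n\<close> levels as a limit of
  powers of \<open>U\<close>, and with it enough permutations of the levels of tower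
  \<open>n\<close>. A given element is close to some \<open>f n\<close>, hence to a permutation of
  these levels.\<close>

lemma two_generators:
  "\<exists>T U. T \<in> FG \<and> U \<in> FG \<and> (\<forall>f\<in>ae_full. \<forall>e>0. \<exists>w\<in>words {T, U}. udist f w < e)"
proof -
  obtain q :: "nat \<Rightarrow> nat" where q: "strict_mono q" "\<And>n. 3 \<le> q n" "\<And>m n. m \<noteq> n \<Longrightarrow> coprime (q m) (q n)"
    by (rule prime_sequence) blast
  obtain f :: "nat \<Rightarrow> 'a \<Rightarrow> 'a" where f: "\<And>n. f n \<in> ae_full"
    "\<And>g e n0. g \<in> ae_full \<Longrightarrow> 0 < e \<Longrightarrow> \<exists>n\<ge>n0. udist g (f n) < e"
    by (rule separable_ae_full) blast
  \<comment> \<open>Over a tower of height \<open>k\<close>, the product keeps the support of the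
    new cycle, of measure \<open>q n / h n\<close>, below
    \<open>1 / (2 ^ Suc n * q (n - 1) * k)\<close>. The summand \<open>q n + 2 ^ Suc n\<close>
    leaves the top level out of the cycle and makes single levels small.\<close>
  define L where "L n k = 2 ^ Suc n * q n * q (n - 1) * k + q n + 2 ^ Suc n" for n k
  have L2: "2 ^ Suc n \<le> L n k" for n k by (simp add: L_def)
  obtain T :: "'a \<Rightarrow> 'a" and C :: "nat \<Rightarrow> 'a set" and h :: "nat \<Rightarrow> nat" and p :: "nat \<Rightarrow> nat \<Rightarrow> nat"
    where T: "T \<in> FG" and C: "\<And>n. C n \<in> sets M" and mC: "\<And>n. measure M (C n) = 1 / real (h n)"
    and tC: "\<And>n. tower (\<lambda>i. T ^^ i) (\<lambda>_. C n) {..<h n}" and p: "\<And>n. p n permutes {..<h n}"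
    and hL: "\<And>n. L (Suc n) (h n) \<le> h (Suc n)" and h0: "\<exists>k. L 0 k \<le> h 0"
    and ap: "\<And>n. udist (f n) (blk (\<lambda>i. T ^^ i) (\<lambda>_. C n) {..<h n} (p n)) < 1 / 2 ^ n"
    by (rule odometer[of f L, OF f(1) L2]) blast
  have "\<exists>k. L n k \<le> h n" for n using hL h0 by (cases n) auto
  then have hn: "q n < h n" "2 ^ Suc n \<le> h n" for n
  proof -
    obtain k where "L n k \<le> h n" using \<open>\<And>n. \<exists>k. L n k \<le> h n\<close> by blast
    moreover have "q n + 2 ^ Suc n \<le> L n k" by (simp add: L_def)
    moreover have "(0::nat) < 2 ^ Suc n" by simp
    ultimately show "q n < h n" "2 ^ Suc n \<le> h n" by linarith+
  qed
  have q0: "0 < q n" for n using q(2)[of n] by simp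
  have hpos: "0 < h n" for n using hn(1)[of n] by simp
  have grow: "2 ^ Suc n * q (Suc n) * q n * h n \<le> h (Suc n)" for n
  proof -
    have "2 ^ Suc n * q (Suc n) * q n * h n \<le> L (Suc n) (h n)" by (simp add: L_def)
    then show ?thesis using hL[of n] by linarith
  qed
  have hmono: "h n \<le> h m" if "n \<le> m" for n m
  proof (rule lift_Suc_mono_le[OF _ that])
    fix n
    have "1 \<le> 2 ^ Suc n * q (Suc n) * q n" using q0 by (metis One_nat_def Suc_leI mult_pos_pos nat_zero_less_power_iff pos2)
    then have "1 * h n \<le> 2 ^ Suc n * q (Suc n) * q n * h n" by (rule mult_le_mono1)
    then show "h n \<le> h (Suc n)" unfolding nat_mult_1 by (rule le_trans[OF _ grow])
  qed
  have Tp: "T ^^ i \<in> FG" for i by (rule FG_pow[OF T])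
  \<comment> \<open>The intended support of the \<open>n\<close>-th factor of \<open>U\<close>,
    before trimming; \<open>V n\<close> below collects the supports of all later factors.\<close>
  define S where "S n = (\<Union>i<q n. (T ^^ i) ` C n)" for n
  have Sm: "S n \<in> sets M" for n using C Tp by (auto simp: S_def)
  have mS: "measure M (S (Suc n + j)) \<le> (1/2) ^ j * ((1/2) ^ Suc n / (real (q n) * real (h n)))" for n j
  proof -
    let ?m = "n + j"
    have "measure M (S (Suc ?m)) \<le> real (card {..<q (Suc ?m)}) * (1 / real (h (Suc ?m)))"
      unfolding S_def by (rule measure_UN_le) (use C Tp mC FG_measure in auto)
    also have "\<dots> = real (q (Suc ?m)) / real (h (Suc ?m))" by simp
    also have "\<dots> \<le> real (q (Suc ?m)) / (2 ^ Suc ?m * real (q (Suc ?m)) * real (q n) * real (h n))"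
    proof (rule divide_left_mono)
      have "2 ^ Suc ?m * q (Suc ?m) * q n * h n \<le> 2 ^ Suc ?m * q (Suc ?m) * q ?m * h ?m"
        using hmono[of n ?m] strict_mono_mono[OF q(1), THEN monoD, of n ?m] by (intro mult_le_mono) auto
      also have "\<dots> \<le> h (Suc ?m)" by (rule grow)
      finally have "real (2 ^ Suc ?m * q (Suc ?m) * q n * h n) \<le> real (h (Suc ?m))" by (rule of_nat_mono)
      then show "2 ^ Suc ?m * real (q (Suc ?m)) * real (q n) * real (h n) \<le> real (h (Suc ?m))" by simp
    qed (use q0 hpos in auto)
    also have "\<dots> = (1/2) ^ j * ((1/2) ^ Suc n / (real (q n) * real (h n)))"
      using q0[of "Suc ?m"] by (simp add: field_simps power_add)
    finally show ?thesis by simp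
  qed
  define V where "V n = (\<Union>j. S (Suc n + j))" for n
  have Vm: "V n \<in> sets M" for n unfolding V_def using Sm by auto
  have mV: "measure M (V n) \<le> (1/2) ^ n / (real (q n) * real (h n))" for n
  proof -
    let ?c = "(1/2) ^ Suc n / (real (q n) * real (h n))"
    have sm: "summable (\<lambda>j. (1/2) ^ j * ?c)" by (intro summable_mult2) (simp add: summable_geometric)
    have sm': "summable (\<lambda>j. measure M (S (Suc n + j)))"
      by (rule summable_comparison_test'[OF sm, of 0]) (use mS in auto)
    have "measure M (V n) \<le> (\<Sum>j. measure M (S (Suc n + j)))"
      unfolding V_def by (rule finite_measure_subadditive_countably) (use Sm sm' in auto)
    also have "\<dots> \<le> (\<Sum>j. (1/2) ^ j * ?c)" by (rule suminf_le[OF mS sm' sm])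
    also have "\<dots> = 2 * ?c" by (subst suminf_mult2[symmetric]) (simp_all add: suminf_geometric summable_geometric)
    finally show ?thesis by simp
  qed
  have SV: "S m \<subseteq> V n" if "n < m" for n m
  proof -
    have "m = Suc n + (m - Suc n)" using that by simp
    then show ?thesis unfolding V_def by (metis UNIV_I UN_upper)
  qed
  \<comment> \<open>A base point is discarded if one of its first \<open>q n\<close> levels meets a
    later support. Later factors take precedence because their supports are smaller; summed over all
    \<open>h n\<close> levels the loss is at most \<open>(1/2) ^ n\<close>.\<close>
  define D where "D n = C n - (\<Union>i<q n. (T ^^ i) -` V n)" for n
  have Dm: "D n \<in> sets M" for n unfolding D_def by (intro sets.Diff C sets.finite_UN FG_vimage_sets Tp Vm) auto
  have DC: "D n \<subseteq> C n" for n by (auto simp: D_def)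
  have mCD: "real (h n) * measure M (C n - D n) \<le> (1/2) ^ n" for n
  proof -
    have "measure M (C n - D n) \<le> measure M (\<Union>i<q n. (T ^^ i) -` V n)"
      using Vm Tp by (intro finite_measure_mono) (auto simp: D_def)
    also have "\<dots> \<le> real (card {..<q n}) * measure M (V n)"
      by (rule measure_UN_le) (use Vm Tp FG_measure_vimage in auto)
    also have "\<dots> \<le> real (q n) * ((1/2) ^ n / (real (q n) * real (h n)))" 
      unfolding card_lessThan by (rule mult_left_mono[OF mV]) simp
    also have "\<dots> = (1/2) ^ n / real (h n)" using q0[of n] by simp
    finally show ?thesis using hpos[of n] by (simp add: field_simps)
  qed
  have tD: "tower (\<lambda>i. T ^^ i) (\<lambda>_. D n) {..<h n}"
    and cD: "udist (blk (\<lambda>i. T ^^ i) (\<lambda>_. C n) {..<h n} (p n)) (blk (\<lambda>i. T ^^ i) (\<lambda>_. D n) {..<h n} (p n)) \<le> (1/2) ^ n" for n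
    using blk_mono_close[OF tC[of n] _ Dm DC C p] mCD[of n] by (auto intro: order_trans)
  \<comment> \<open>\<open>J\<close> indexes the levels of all factors together, so that
    \<open>U\<close> is a single block map over one infinite family of disjoint sets.\<close>
  define J where "J = (SIGMA n:UNIV. {..<q n})"
  define \<theta> where "\<theta> = (\<lambda>(n::nat, i). T ^^ i)"
  define ZZ where "ZZ = (\<lambda>(n, i::nat). D n)"
  have J: "(n, i) \<in> J \<longleftrightarrow> i < q n" for n i by (auto simp: J_def)
  have th: "\<theta> (n, i) = T ^^ i" "ZZ (n, i) = D n" for n i by (auto simp: \<theta>_def ZZ_def)
  have cross: "(T ^^ i) y \<noteq> (T ^^ j) z" if "n < m" "i < q n" "j < q m" "y \<in> D n" "z \<in> D m" for n m i j y z
  proof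
    assume e: "(T ^^ i) y = (T ^^ j) z"
    have "(T ^^ j) z \<in> S m" using that DC unfolding S_def by blast
    then have "(T ^^ i) y \<in> V n" using SV[OF that(1)] e by auto
    then show False using that by (auto simp: D_def)
  qed
  have tw: "tower \<theta> ZZ J"
    unfolding tower_def
  proof (intro conjI ballI impI)
    show "countable J" unfolding J_def by auto
    show "\<theta> l \<in> FG" "ZZ l \<in> sets M" for l using Tp Dm by (auto simp: \<theta>_def ZZ_def split: prod.split)
    fix l m assume lm: "l \<in> J" "m \<in> J" "l \<noteq> m"
    obtain n i n' i' where e: "l = (n, i)" "m = (n', i')" by (cases l, cases m)
    have i: "i < q n" "i' < q n'" using lm by (auto simp: e J)
    show "\<theta> l ` ZZ l \<inter> \<theta> m ` ZZ m = {}"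
    proof (rule ccontr)
      assume "\<theta> l ` ZZ l \<inter> \<theta> m ` ZZ m \<noteq> {}"
      then obtain y z where y: "y \<in> D n" "z \<in> D n'" "(T ^^ i) y = (T ^^ i') z" by (auto simp: e th)
      have "n = n'" using cross[of n n' i i' y z] cross[of n' n i' i z y] y i by (metis linorder_neqE_nat)
      moreover have "i = i'" using towerD(4)[OF tD[of n], of i i' y z] y i hn(1)[of n] \<open>n = n'\<close> by auto
      ultimately show False using lm e by simp
    qed
  qed
  define pU where "pU = (\<lambda>(n, i). (n, Suc i mod q n))"
  define U where "U = blk \<theta> ZZ J pU"
  have bij: "bij_betw pU J J"
  proof (rule bij_betw_imageI)
    show "inj_on pU J" by (rule inj_onI) (auto simp: pU_def J mod_Suc split: if_splits prod.splits)
    show "pU ` J = J"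
    proof (intro equalityI subsetI)
      fix l assume l: "l \<in> J"
      obtain n i where e: "l = (n, i)" by (cases l)
      have "l = pU (n, if i = 0 then q n - 1 else i - 1)" "(n, if i = 0 then q n - 1 else i - 1) \<in> J"
        using l q0[of n] by (auto simp: e J pU_def)
      then show "l \<in> pU ` J" by blast
    qed (use q0 in \<open>auto simp: pU_def J\<close>)
  qed
  have UFG: "U \<in> FG" unfolding U_def by (rule blk_FG[OF tw bij]) (auto simp: pU_def ZZ_def)
  have pUJ: "pU l \<in> J" "ZZ (pU l) = ZZ l" if "l \<in> J" for l using that q0 by (auto simp: pU_def J ZZ_def split: prod.splits)
  have Upow: "U ^^ m = blk \<theta> ZZ J (pU ^^ m)" for m
  proof (induction m)
    case 0
    show ?case by (simp add: blk_id[OF tw] id_def[symmetric])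
  next
    case (Suc m)
    have "(pU ^^ m) l \<in> J \<and> ZZ ((pU ^^ m) l) = ZZ l" if "l \<in> J" for l
      by (induction m) (use that pUJ in auto)
    then show ?case using blk_comp[OF tw, of "pU ^^ m" pU] Suc by (simp add: U_def o_def)
  qed
  have pUpow: "(pU ^^ m) (n, i) = (n, (i + m) mod q n)" if "i < q n" for m n i
    by (induction m) (use that in \<open>auto simp: pU_def mod_Suc_eq\<close>)
  let ?TU = "{T, U}"
  have TU: "?TU \<subseteq> FG" using T UFG by auto
  define BT where "BT n = blk (\<lambda>i. T ^^ i) (\<lambda>_. D n) {..<h n}" for n
  have BTFG: "BT n a \<in> FG" if "a permutes {..<h n}" for n a unfolding BT_def by (rule blk_perm_FG[OF tD that])
  have BTapp: "BT n a ((T ^^ i) z) = (T ^^ a i) z" if "i < h n" "z \<in> D n" for n a i z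
    unfolding BT_def using blk_app[OF tD, of i n z a] that by simp
  have BTout: "BT n a x = x" if "\<And>i z. i < h n \<Longrightarrow> z \<in> D n \<Longrightarrow> x \<noteq> (T ^^ i) z" for n a x
    unfolding BT_def by (rule blk_out) (use that in auto)
  have u_cl: "BT n (cyc (q n)) \<in> cl ?TU" for n
  proof -
    let ?u = "BT n (cyc (q n))"
    have uFG: "?u \<in> FG" by (rule BTFG, rule cyc_permutes) (use hn(1)[of n] in simp)
    have ufix: "?u x = x" if x: "\<And>i z. i < q n \<Longrightarrow> z \<in> D n \<Longrightarrow> x \<noteq> (T ^^ i) z" for x
    proof (cases "\<exists>i z. i < h n \<and> z \<in> D n \<and> x = (T ^^ i) z")
      case True
      then obtain i z where iz: "i < h n" "z \<in> D n" "x = (T ^^ i) z" by blast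
      then have "\<not> i < q n" using x by blast
      then show ?thesis using BTapp[OF iz(1,2)] iz(3) by (simp add: cyc_def)
    qed (auto intro: BTout)
    have "\<exists>w\<in>words ?TU. udist ?u w < e" if e: "0 < e" for e
    proof -
      obtain K0 where K0: "(1/2::real) ^ K0 < e" using real_arch_pow_inv[OF e, of "1/2"] by auto
      define K where "K = max K0 n"
      \<comment> \<open>The exponent \<open>m\<close>, a multiple of \<open>Q\<close>, is 1 modulo
        \<open>q n\<close> and 0 modulo every other \<open>q j\<close> with
        \<open>j \<le> K\<close>; so among the first factors only the \<open>n\<close>-th one
        survives in the power of \<open>U\<close>.\<close>
      define Q where "Q = (\<Prod>j\<in>{..K} - {n}. q j)"
      have "coprime (q n) Q" unfolding Q_def by (rule prod_coprime_right) (use q(3) in auto)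
      then obtain y where y: "[Q * y = 1] (mod q n)" using cong_solve_coprime_nat[of Q "q n"] by (auto simp: coprime_commute)
      define m where "m = Q * y"
      have m0: "q j dvd m" if "j \<le> K" "j \<noteq> n" for j
        unfolding m_def Q_def using that by (intro dvd_mult2 dvd_prodI) auto
      have m1: "(i + m) mod q n = Suc i mod q n" for i
      proof -
        have "[i + m = i + 1] (mod q n)" unfolding m_def using y by (intro cong_add) auto
        then show ?thesis by (simp add: cong_def)
      qed
      \<comment> \<open>Off \<open>V K\<close> only factors with index at most \<open>K\<close> act,
        and the exponent controls all of them.\<close>
      have agree: "?u x = (U ^^ m) x" if x: "x \<notin> V K" for x
      proof (cases "\<exists>l\<in>J. x \<in> \<theta> l ` ZZ l")
        case True
        then obtain l where lJ: "l \<in> J" "x \<in> \<theta> l ` ZZ l" by blast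
        obtain j i where l: "l = (j, i)" by (cases l)
        have ij: "i < q j" using lJ by (simp add: l J)
        obtain z where z: "z \<in> D j" "x = (T ^^ i) z" using lJ(2) by (auto simp: l th)
        have "\<not> K < j"
        proof
          assume "K < j"
          then have "x \<in> V K" using SV[of K j] z ij DC unfolding S_def by blast
          then show False using x by blast
        qed
        have Um: "(U ^^ m) x = (T ^^ ((i + m) mod q j)) z"
          unfolding Upow using blk_app[OF tw lJ(1), of z "pU ^^ m"] z pUpow[OF ij, of m] by (simp add: l th)
        show ?thesis
        proof (cases "j = n")
          case True
          then show ?thesis using Um BTapp[of i n z "cyc (q n)"] z ij hn(1)[of n] m1[of i] by (simp add: cyc_def)
        next
          case False
          have "(i + m) mod q j = i" using m0[of j] False \<open>\<not> K < j\<close> ij by (auto simp: mod_add_right_eq[symmetric, of i m] dvd_eq_mod_eq_0)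
          then have "(U ^^ m) x = x" using Um z by simp
          moreover have "?u x = x"
          proof (rule ufix)
            fix i' z' assume "i' < q n" "z' \<in> D n"
            then show "x \<noteq> (T ^^ i') z'"
              using cross[of n j i' i z' z] cross[of j n i i' z z'] False ij z by (metis linorder_neqE_nat)
          qed
          ultimately show ?thesis by simp
        qed
      next
        case False
        then have "(U ^^ m) x = x" unfolding Upow by (intro blk_out) auto
        moreover have "?u x = x"
        proof (rule ufix)
          fix i z assume "i < q n" "z \<in> D n"
          then have "(n, i) \<in> J" "(T ^^ i) z \<in> \<theta> (n, i) ` ZZ (n, i)" by (simp_all add: J th)
          then show "x \<noteq> (T ^^ i) z" using False by metis
        qed
        ultimately show ?thesis by simp
      qed
      have "{x \<in> space M. ?u x \<noteq> (U ^^ m) x} \<subseteq> V K" using agree by blast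
      then have "udist ?u (U ^^ m) \<le> measure M (V K)"
        unfolding udist_def using Vm by (intro finite_measure_mono) auto
      also have "\<dots> \<le> (1/2) ^ K / (real (q K) * real (h K))" by (rule mV)
      also have "\<dots> \<le> (1/2) ^ K / 1"
      proof (rule divide_left_mono)
        have "1 \<le> q K * h K" using q0[of K] hpos[of K] by (simp add: Suc_leI)
        then have "real 1 \<le> real (q K * h K)" by (rule of_nat_mono)
        then show "1 \<le> real (q K) * real (h K)" by simp
      qed (use q0[of K] hpos[of K] in auto)
      also have "\<dots> \<le> (1/2) ^ K0" unfolding div_by_1 by (rule power_decreasing) (auto simp: K_def)
      finally have "udist ?u (U ^^ m) < e" using K0 by simp
      moreover have "U ^^ m \<in> words ?TU" by (intro words_pow words.base) simp
      ultimately show ?thesis by blast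
    qed
    then show ?thesis using uFG by (auto simp: cl_def)
  qed
  have perm_cl: "\<exists>a. a permutes {..<h n} \<and> BT n a \<in> cl ?TU \<and> (\<forall>i<h n - 2. a i = b i)" if b: "b permutes {..<h n}" for n b
  proof -
    \<comment> \<open>Those permutations of the levels which are realised in the closure;
      \<open>sort_by_cycles\<close> is applied to this group.\<close>
    define G where "G = {a. a permutes {..<h n} \<and> BT n a \<in> cl ?TU}"
    have BTcomp: "BT n a \<circ> BT n c = BT n (a \<circ> c)" if "c permutes {..<h n}" for a c
      unfolding BT_def by (rule blk_comp[OF tD]) (use permutes_in_image[OF that] in auto)
    have BTid: "BT n a = id" if "\<And>i. i < h n \<Longrightarrow> a i = i" for a unfolding BT_def by (rule blk_id[OF tD]) (use that in auto)
    have "\<exists>g\<in>G. \<forall>i<h n - 2. g i = b i"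
    proof (rule sort_by_cycles[where p = "q n"])
      show "a \<circ> c \<in> G" if "a \<in> G" "c \<in> G" for a c
        using that permutes_compose cl_comp[OF TU] BTcomp unfolding G_def by (metis (no_types, lifting) mem_Collect_eq)
      show "inv_fun a \<in> G" if "a \<in> G" for a
      proof -
        have a: "a permutes {..<h n}" "BT n a \<in> cl ?TU" using that by (auto simp: G_def)
        have ai: "inv_fun a permutes {..<h n}" by (rule permutes_inv[OF a(1)])
        have "BT n a \<circ> BT n (inv_fun a) = id"
          using BTcomp[OF ai, of a] BTid[of "a \<circ> inv_fun a"] permutes_inverses[OF a(1)] by simp
        then have "BT n (inv_fun a) = inv_fun (BT n a)"
          using BTFG[OF a(1)] by (metis (no_types, lifting) FG_inv_f comp_apply ext id_apply)
        then show ?thesis using cl_inv[OF TU a(2)] ai by (simp add: G_def)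
      qed
      show "a permutes {..<h n}" if "a \<in> G" for a using that by (simp add: G_def)
      show "cyc (q n) \<in> G" unfolding G_def using u_cl[of n] hn(1)[of n] by (simp add: cyc_permutes)
      show "3 \<le> q n" "q n < h n" by (rule q, rule hn)
      show "b permutes {..<h n}" by (rule b)
      show "shift_perm a \<in> G" if aG: "a \<in> G" "a (h n - 1) = h n - 1" for a
      proof -
        have a: "a permutes {..<h n}" "BT n a \<in> cl ?TU" using aG by (auto simp: G_def)
        have sh: "shift_perm a permutes {..<h n}"
        proof (rule bij_imp_permutes)
          have inj: "inj_on (shift_perm a) {..<h n}"
            by (rule inj_onI) (use permutes_inj[OF a(1)] in \<open>auto simp: shift_perm_def inj_eq split: nat.splits\<close>)
          have out: "shift_perm a i < h n" if "i < h n" for i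
          proof (cases i)
            case (Suc j)
            have "a j < h n" using permutes_in_image[OF a(1), of j] that Suc by simp
            moreover have "a j \<noteq> h n - 1" using permutes_inj[OF a(1)] aG(2) that Suc by (metis Suc_diff_1 hpos injD lessI less_irrefl)
            ultimately show ?thesis using Suc by (simp add: shift_perm_def)
          qed (use hpos in \<open>simp add: shift_perm_def\<close>)
          then have "shift_perm a ` {..<h n} \<subseteq> {..<h n}" by auto
          then show "bij_betw (shift_perm a) {..<h n} {..<h n}"
            using inj by (auto simp: bij_betw_def dest: endo_inj_surj[rotated])
          fix i assume i: "i \<notin> {..<h n}"
          then obtain j where j: "i = Suc j" using hpos[of n] by (cases i) auto
          have "a j = j"
          proof (cases "j = h n - 1")
            case False
            then have "j \<notin> {..<h n}" using i j by auto
            then show ?thesis by (rule permutes_not_in[OF a(1)])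
          qed (use aG(2) in simp)
          then show "shift_perm a i = i" using j by (simp add: shift_perm_def)
        qed
        \<comment> \<open>The boundary is the only delicate point: a preimage under \<open>T\<close>
          of a point of level 0, or of a point off the tower, can lie in the tower only on its top
          level. There \<open>a\<close> acts trivially, so the conjugate fixes the point.\<close>
        have key: "(T \<circ> BT n a \<circ> inv_fun T) x = BT n (shift_perm a) x" for x
        proof (cases "\<exists>i z. i < h n \<and> z \<in> D n \<and> x = (T ^^ i) z")
          case True
          then obtain i z where iz: "i < h n" "z \<in> D n" "x = (T ^^ i) z" by blast
          show ?thesis
          proof (cases i)
            case 0
            have "BT n a (inv_fun T x) = inv_fun T x"
            proof (cases "\<exists>j w. j < h n \<and> w \<in> D n \<and> inv_fun T x = (T ^^ j) w")
              case True
              then obtain j w where jw: "j < h n" "w \<in> D n" "inv_fun T x = (T ^^ j) w" by blast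
              have xe: "x = (T ^^ Suc j) w" using jw(3) T by (metis FG_f_inv funpow.simps(2) o_apply)
              have "j = h n - 1"
              proof (rule ccontr)
                assume "j \<noteq> h n - 1"
                then have "Suc j < h n" using jw(1) by simp
                then have "Suc j = i" using towerD(4)[OF tD[of n], of "Suc j" i w z] jw iz xe by auto
                then show False using 0 by simp
              qed
              then show ?thesis using BTapp[OF jw(1,2)] jw(3) aG(2) by simp
            qed (auto intro: BTout)
            then show ?thesis using BTapp[OF iz(1,2), of "shift_perm a"] iz(3) 0 T by (simp add: shift_perm_def)
          next
            case (Suc j)
            have "inv_fun T x = (T ^^ j) z" using iz(3) Suc T by simp
            then show ?thesis using BTapp[of j n z a] BTapp[OF iz(1,2), of "shift_perm a"] iz Suc by (simp add: shift_perm_def)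
          qed
        next
          case False
          have "BT n a (inv_fun T x) = inv_fun T x"
          proof (cases "\<exists>j w. j < h n \<and> w \<in> D n \<and> inv_fun T x = (T ^^ j) w")
            case True
            then obtain j w where jw: "j < h n" "w \<in> D n" "inv_fun T x = (T ^^ j) w" by blast
            have xe: "x = (T ^^ Suc j) w" using jw(3) T by (metis FG_f_inv funpow.simps(2) o_apply)
            then have "\<not> Suc j < h n" using False jw(2) by blast
            then have "j = h n - 1" using jw(1) by simp
            then show ?thesis using BTapp[OF jw(1,2)] jw(3) aG(2) by simp
          qed (auto intro: BTout)
          moreover have "BT n (shift_perm a) x = x" using False by (intro BTout) blast
          ultimately show ?thesis using T by simp
        qed
        have "T \<in> cl ?TU" by (rule cl_base[OF TU words.base]) simp
        then have "T \<circ> BT n a \<circ> inv_fun T \<in> cl ?TU" using a(2) by (intro cl_comp[OF TU] cl_inv[OF TU])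
        moreover have "T \<circ> BT n a \<circ> inv_fun T = BT n (shift_perm a)" using key by (rule ext)
        ultimately show ?thesis using sh by (simp add: G_def)
      qed
    qed
    then show ?thesis unfolding G_def by blast
  qed
  have "\<exists>w\<in>words ?TU. udist g w < e" if g: "g \<in> ae_full" and e: "0 < e" for g e
  proof -
    \<comment> \<open>Three errors are at most \<open>(1/2) ^ n < e / 6\<close>: the tower
      approximation of \<open>f n\<close>, the trimming of its base, and the two unsorted levels.
      Two more, the approximation of \<open>g\<close> by \<open>f n\<close> and of the level
      permutation by a word, are below \<open>e / 4\<close>.\<close>
    obtain n0 where n0: "(1/2::real) ^ n0 < e / 6" using real_arch_pow_inv[of "e/6" "1/2"] e by auto
    obtain n where n: "n0 \<le> n" "udist g (f n) < e / 4" using f(2)[OF g, of "e/4" n0] e by auto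
    have pn: "(1/2::real) ^ n \<le> (1/2) ^ n0" by (rule power_decreasing) (use n in auto)
    obtain a where a: "a permutes {..<h n}" "BT n a \<in> cl ?TU" "\<forall>i<h n - 2. a i = p n i" using perm_cl[OF p] by blast
    have e4: "0 < e / 4" using e by simp
    obtain w where w: "w \<in> words ?TU" "udist (BT n a) w < e / 4" using a(2) e4 unfolding cl_def by blast
    have gm: "g \<in> measurable M M" "f n \<in> measurable M M" using g f(1)[of n] mp_autsD(2) by (auto simp: ae_full_def)
    have wm: "w \<in> measurable M M" using words_FG[OF TU w(1)] measurable_FG by blast
    let ?bC = "blk (\<lambda>i. T ^^ i) (\<lambda>_. C n) {..<h n} (p n)"
    have bC: "?bC \<in> measurable M M" "BT n (p n) \<in> measurable M M" "BT n a \<in> measurable M M"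
      using blk_perm_FG[OF tC p] BTFG[OF p] BTFG[OF a(1)] measurable_FG by auto
    have "{x \<in> space M. BT n (p n) x \<noteq> BT n a x} \<subseteq> (\<Union>i\<in>{h n - 2, h n - 1}. (T ^^ i) ` D n)"
    proof
      fix x assume x: "x \<in> {x \<in> space M. BT n (p n) x \<noteq> BT n a x}"
      have "\<exists>i z. i < h n \<and> z \<in> D n \<and> x = (T ^^ i) z"
      proof (rule ccontr)
        assume "\<not> ?thesis"
        then have "BT n (p n) x = x" "BT n a x = x" by (auto intro!: BTout)
        then show False using x by simp
      qed
      then obtain i z where iz: "i < h n" "z \<in> D n" "x = (T ^^ i) z" by blast
      have "\<not> i < h n - 2" using x a(3) iz BTapp[OF iz(1,2)] by auto
      then have "i \<in> {h n - 2, h n - 1}" using iz(1) by auto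
      then show "x \<in> (\<Union>i\<in>{h n - 2, h n - 1}. (T ^^ i) ` D n)" using iz by blast
    qed
    then have "udist (BT n (p n)) (BT n a) \<le> measure M (\<Union>i\<in>{h n - 2, h n - 1}. (T ^^ i) ` D n)"
      unfolding udist_def
      by (rule finite_measure_mono) (intro sets.finite_UN FG_image_sets Tp Dm finite.intros)
    also have "\<dots> \<le> real (card {h n - 2, h n - 1}) * (1 / real (h n))"
    proof (rule measure_UN_le)
      have "measure M (D n) \<le> 1 / real (h n)" using finite_measure_mono[OF DC C] mC by metis
      then show "measure M ((T ^^ i) ` D n) \<le> 1 / real (h n)" for i using FG_measure[OF Tp Dm] by simp
    qed (use Dm Tp in auto)
    also have "\<dots> \<le> 2 * (1 / real (h n))" by (rule mult_right_mono) (auto simp: card_insert_if)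
    also have "\<dots> \<le> (1/2) ^ n"
    proof -
      have "real (2 ^ Suc n) \<le> real (h n)" using hn(2)[of n] by (rule of_nat_mono)
      then show ?thesis using hpos[of n] by (simp add: field_simps power_divide)
    qed
    finally have 4: "udist (BT n (p n)) (BT n a) \<le> (1/2) ^ n" .
    have 3: "udist ?bC (BT n (p n)) \<le> (1/2) ^ n" using cD[of n] by (simp add: BT_def)
    have 2: "udist (f n) ?bC < (1/2) ^ n" using ap[of n] by (simp add: power_divide)
    have "udist g w \<le> udist g (f n) + udist (f n) w" by (rule udist_triangle[OF gm wm])
    moreover have "udist (f n) w \<le> udist (f n) ?bC + udist ?bC w" by (rule udist_triangle[OF gm(2) bC(1) wm])
    moreover have "udist ?bC w \<le> udist ?bC (BT n (p n)) + udist (BT n (p n)) w" by (rule udist_triangle[OF bC(1,2) wm])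
    moreover have "udist (BT n (p n)) w \<le> udist (BT n (p n)) (BT n a) + udist (BT n a) w" by (rule udist_triangle[OF bC(2,3) wm])
    ultimately have "udist g w < e" using 2 3 4 n(2) w(2) n0 pn by linarith
    then show ?thesis using w(1) by blast
  qed
  then show ?thesis using T UFG by blast
qed

section \<open>From maps to classes modulo null sets\<close>

abbreviation aecl :: "('a \<Rightarrow> 'a) \<Rightarrow> ('a \<Rightarrow> 'a) set" where
  "aecl f \<equiv> ae_eq M `` {f}"

lemma carrier_full: "full_group_carrier M E = aecl ` ae_full"
  by (auto simp: full_group_carrier_def ae_full_def)

lemma ae_full_mp: "f \<in> ae_full \<Longrightarrow> f \<in> mp_auts M"
  by (simp add: ae_full_def)

lemma aecl_carrier: "f \<in> mp_auts M \<Longrightarrow> aecl f \<in> carrier (aut_group M)"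
  by (auto simp: carrier_aut_group)

lemma aut_one: "\<one>\<^bsub>aut_group M\<^esub> = aecl id"
  by (simp add: aut_group_def)

lemma aecl_inv:
  assumes f: "f \<in> mp_auts M" and g: "g \<in> mp_auts M" and gf: "\<And>x. x \<in> space M \<Longrightarrow> g (f x) = x"
  shows "inv\<^bsub>aut_group M\<^esub> (aecl f) = aecl g"
proof (rule group.inv_equality[OF group_aut_group])
  have "(g \<circ> f, id) \<in> ae_eq M" using f g gf by (simp add: ae_eq_def comp_in_mp_auts id_in_mp_auts)
  then have "aecl (g \<circ> f) = aecl id" by (rule equiv_class_eq[OF equiv_ae_eq])
  then show "aecl g \<otimes>\<^bsub>aut_group M\<^esub> aecl f = \<one>\<^bsub>aut_group M\<^esub>"
    by (simp only: aut_group_mult[OF g f] aut_one)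
qed (use f g aecl_carrier in auto)

lemma ae_full_comp: assumes f: "f \<in> ae_full" and g: "g \<in> ae_full" shows "f \<circ> g \<in> ae_full"
proof -
  note gm = mp_autsD[OF ae_full_mp[OF g]]
  have "AE x in distr M M g. (x, f x) \<in> E" unfolding gm(3) using f by (simp add: ae_full_def)
  then have "AE x in M. (g x, f (g x)) \<in> E" by (rule AE_distrD[OF gm(2)])
  moreover have "AE x in M. (x, g x) \<in> E" using g by (simp add: ae_full_def)
  ultimately have "AE x in M. (x, f (g x)) \<in> E" by eventually_elim (rule E_trans)
  then show ?thesis using comp_in_mp_auts[OF ae_full_mp[OF f] ae_full_mp[OF g]] by (simp add: ae_full_def)
qed

lemma ae_full_inv:
  assumes f: "f \<in> ae_full"
  shows "the_inv_into (space M) f \<in> ae_full" "x \<in> space M \<Longrightarrow> the_inv_into (space M) f (f x) = x"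
proof -
  let ?i = "the_inv_into (space M) f"
  note fm = mp_autsD[OF ae_full_mp[OF f]]
  have i: "?i \<in> mp_auts M" by (rule inv_in_mp_auts[OF ae_full_mp[OF f]])
  have fi: "f (?i x) = x" if "x \<in> space M" for x
    using fm(1) that by (auto simp: bij_betw_def f_the_inv_into_f)
  have "AE x in distr M M ?i. (x, f x) \<in> E" unfolding mp_autsD(3)[OF i] using f by (simp add: ae_full_def)
  then have "AE x in M. (?i x, f (?i x)) \<in> E" by (rule AE_distrD[OF mp_autsD(2)[OF i]])
  moreover have "AE x in M. f (?i x) = x" using fi by auto
  ultimately have "AE x in M. (x, ?i x) \<in> E" by eventually_elim (use E_sym in auto)
  then show "?i \<in> ae_full" using i by (simp add: ae_full_def)
  show "?i (f x) = x" if "x \<in> space M" using fm(1) that by (auto simp: bij_betw_def the_inv_into_f_f)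
qed

lemma subgroup_full: "subgroup (full_group_carrier M E) (aut_group M)"
proof (rule group.subgroupI[OF group_aut_group])
  show "full_group_carrier M E \<subseteq> carrier (aut_group M)"
    using aecl_carrier ae_full_mp by (auto simp: carrier_full)
  show "full_group_carrier M E \<noteq> {}" using FG_ae_full[OF FG_id] by (auto simp: carrier_full)
  fix a assume "a \<in> full_group_carrier M E"
  then obtain f where f: "f \<in> ae_full" "a = aecl f" by (auto simp: carrier_full)
  show "inv\<^bsub>aut_group M\<^esub> a \<in> full_group_carrier M E"
  proof -
    have "inv\<^bsub>aut_group M\<^esub> (aecl f) = aecl (the_inv_into (space M) f)"
      by (rule aecl_inv[OF ae_full_mp[OF f(1)] ae_full_mp[OF ae_full_inv(1)[OF f(1)]]])
        (rule ae_full_inv(2)[OF f(1)])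
    then show ?thesis using ae_full_inv(1)[OF f(1)] f(2) by (simp add: carrier_full)
  qed
  fix b assume "b \<in> full_group_carrier M E"
  then obtain g where g: "g \<in> ae_full" "b = aecl g" by (auto simp: carrier_full)
  show "a \<otimes>\<^bsub>aut_group M\<^esub> b \<in> full_group_carrier M E"
    unfolding f(2) g(2) aut_group_mult[OF ae_full_mp[OF f(1)] ae_full_mp[OF g(1)]]
    using ae_full_comp[OF f(1) g(1)] by (auto simp: carrier_full)
qed

lemma generate_full:
  assumes "S \<subseteq> full_group_carrier M E"
  shows "generate (full_group M E) S = generate (aut_group M) S"
  unfolding full_group_def by (rule group.generate_consistent[OF group_aut_group assms subgroup_full])

lemma uniform_dist_aecl:
  "f \<in> mp_auts M \<Longrightarrow> g \<in> mp_auts M \<Longrightarrow> uniform_dist M (aecl f) (aecl g) = udist f g"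
  using uniform_dist_class[OF std finite_measure_axioms] by (simp add: udist_def)

text \<open>The full group is a subgroup of the automorphism group, so generated subgroup and
  closure may be computed in the larger group; the closure is then expressed through the
  metric.\<close>

lemma topologically_generates_full_iff:
  "topologically_generates (full_group M E) (full_group_topology M E) S \<longleftrightarrow>
     S \<subseteq> full_group_carrier M E \<and>
     (\<forall>f\<in>ae_full. \<forall>e>0. \<exists>P\<in>generate (aut_group M) S. uniform_dist M (aecl f) P < e)"
proof (cases "S \<subseteq> full_group_carrier M E")
  case True
  interpret U: Metric_space "carrier (aut_group M)" "uniform_dist M"
    by (rule Metric_space_uniform_dist[OF std finite_measure_axioms])
  let ?G = "generate (aut_group M) S" and ?H = "full_group_carrier M E"
  have sub: "?G \<subseteq> ?H" by (rule group.generate_subgroup_incl[OF group_aut_group True subgroup_full])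
  have HC: "?H \<subseteq> carrier (aut_group M)" using subgroup.subset[OF subgroup_full] .
  have "full_group_topology M E closure_of ?G = ?H \<inter> (U.mtopology closure_of ?G)"
    unfolding full_group_topology_def uniform_topology_def closure_of_subtopology
    using sub by (simp add: Int_absorb1)
  also have "\<dots> = {P \<in> ?H. \<forall>e>0. \<exists>Q\<in>?G. uniform_dist M P Q < e}"
  proof -
    have "P \<in> ?H \<inter> (U.mtopology closure_of ?G) \<longleftrightarrow> P \<in> {P \<in> ?H. \<forall>e>0. \<exists>Q\<in>?G. uniform_dist M P Q < e}" for P
    proof (cases "P \<in> ?H")
      case True
      have "Q \<in> U.mball P e \<longleftrightarrow> uniform_dist M P Q < e" if "Q \<in> ?G" for Q e
        using True that sub HC by (auto simp: subset_iff)
      then show ?thesis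
        unfolding U.metric_closure_of using True subsetD[OF HC True] by (simp cong: bex_cong)
    qed simp
    then show ?thesis by blast
  qed
  finally have c: "full_group_topology M E closure_of ?G = {P \<in> ?H. \<forall>e>0. \<exists>Q\<in>?G. uniform_dist M P Q < e}" .
  have "carrier (full_group M E) = ?H" by (simp add: full_group_def)
  moreover have "{P \<in> A. R P} = A \<longleftrightarrow> (\<forall>P\<in>A. R P)" for A :: "('a \<Rightarrow> 'a) set set" and R by blast
  ultimately show ?thesis
    using True unfolding topologically_generates_def generate_full[OF True] c
    by (simp add: carrier_full)
qed (simp add: topologically_generates_def full_group_def)

lemma words_generate:
  assumes S: "S \<subseteq> FG" and w: "w \<in> words S"
  shows "aecl w \<in> generate (aut_group M) (aecl ` S)"
  using w
proof induction
  case (base f)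
  then show ?case by (intro generate.incl) auto
next
  case one
  show ?case unfolding aut_one[symmetric] by (rule generate.one)
next
  case (comp f g)
  have "f \<in> mp_auts M" "g \<in> mp_auts M" using words_FG[OF S] comp.hyps FG_mp by auto
  then show ?case using generate.eng[OF comp.IH] by (simp only: aut_group_mult)
next
  case (inv f)
  have f: "f \<in> FG" by (rule words_FG[OF S inv.hyps])
  have "inv\<^bsub>aut_group M\<^esub> (aecl f) = aecl (inv_fun f)"
    by (rule aecl_inv[OF FG_mp[OF f] FG_mp[OF FG_inv[OF f]]]) (use f in simp)
  moreover have "aecl ` S \<subseteq> carrier (aut_group M)" using S FG_mp aecl_carrier by auto
  ultimately show ?case using group.generate_m_inv_closed[OF group_aut_group _ inv.IH] by simp
qed

text \<open>One step from the trivial tower yields a tower with at least three levels. The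
  transpositions of levels 0, 1 and of levels 1, 2 do not commute: their two products send the base
  to level 1 and to level 2, respectively.\<close>

lemma non_commuting:
  obtains f g where "f \<in> FG" "g \<in> FG" "0 < udist (f \<circ> g) (g \<circ> f)"
proof -
  have "\<exists>s B' n p. s \<in> FG \<and> (\<forall>x. x \<notin> space M \<longrightarrow> s x = x) \<and> B' \<in> sets M \<and> B' \<subseteq> space M \<and> 3 \<le> n \<and> 0 < n \<and>
     measure M B' = 1 / real (1 * n) \<and> tower (\<lambda>i. (s \<circ> id) ^^ i) (\<lambda>_. B') {..<1 * n} \<and>
     (\<forall>x\<in>B'. ((s \<circ> id) ^^ (1 * n)) x = x) \<and> p permutes {..<1 * n} \<and>
     udist id (blk (\<lambda>i. (s \<circ> id) ^^ i) (\<lambda>_. B') {..<1 * n} p) < 1"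
    by (rule dye_step[OF FG_id]) (use FG_ae_full[OF FG_id] prob_space in auto)
  then obtain s B' n where s: "s \<in> FG" "B' \<in> sets M" "3 \<le> n" "measure M B' = 1 / real n"
    and t: "tower (\<lambda>i. (s \<circ> id) ^^ i) (\<lambda>_. B') {..<n}"
    unfolding mult_1 by blast
  let ?b = "\<lambda>i j. blk (\<lambda>i. (s \<circ> id) ^^ i) (\<lambda>_. B') {..<n} (Transposition.transpose i j)"
  have p: "Transposition.transpose 0 1 permutes {..<n}" "Transposition.transpose 1 2 permutes {..<n}"
    using s(3) by (auto intro!: permutes_swap_id)
  have FGb: "?b 0 1 \<in> FG" "?b 1 2 \<in> FG" by (rule blk_perm_FG[OF t p(1)], rule blk_perm_FG[OF t p(2)])
  have app: "?b i j (((s \<circ> id) ^^ l) z) = ((s \<circ> id) ^^ (Transposition.transpose i j l)) z" if "l < n" "z \<in> B'" for i j l z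
    using blk_app[OF t, of l z] that by simp
  have B: "B' \<subseteq> {x \<in> space M. (?b 0 1 \<circ> ?b 1 2) x \<noteq> (?b 1 2 \<circ> ?b 0 1) x}"
  proof
    fix z assume z: "z \<in> B'"
    have z0: "z = ((s \<circ> id) ^^ 0) z" by simp
    have "(?b 0 1 \<circ> ?b 1 2) z = ((s \<circ> id) ^^ 1) z"
      using app[of 0 z 1 2] app[of 0 z 0 1] z s(3) by (simp del: funpow.simps add: transpose_def flip: z0)
    moreover have "(?b 1 2 \<circ> ?b 0 1) z = ((s \<circ> id) ^^ 2) z"
      using app[of 0 z 0 1] app[of 1 z 1 2] z s(3) by (simp del: funpow.simps add: transpose_def flip: z0)
    moreover have "((s \<circ> id) ^^ 1) z \<noteq> ((s \<circ> id) ^^ 2) z"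
      using towerD(4)[OF t, of 1 2 z z] z s(3) by auto
    ultimately show "z \<in> {x \<in> space M. (?b 0 1 \<circ> ?b 1 2) x \<noteq> (?b 1 2 \<circ> ?b 0 1) x}"
      using z sets.sets_into_space[OF s(2)] by auto
  qed
  have "0 < measure M B'" using s by simp
  also have "\<dots> \<le> udist (?b 0 1 \<circ> ?b 1 2) (?b 1 2 \<circ> ?b 0 1)"
    unfolding udist_def
    by (rule finite_measure_mono[OF B]) (intro neq_sets measurable_FG FG_comp FGb)
  finally show thesis by (rule that[OF FGb])
qed

text \<open>At most one generator gives a subgroup of the powers of a single element, hence a
  commutative one. Approximating two non-commuting elements by commuting ones contradicts the
  continuity of multiplication.\<close>

lemma not_single_generator:
  assumes S: "S \<subseteq> full_group_carrier M E" and card: "finite S" "card S \<le> 1"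
    and dense: "\<forall>f\<in>ae_full. \<forall>e>0. \<exists>P\<in>generate (aut_group M) S. uniform_dist M (aecl f) P < e"
  shows False
proof -
  interpret A: group "aut_group M" by (rule group_aut_group)
  obtain a where a: "a \<in> carrier (aut_group M)" "S \<subseteq> {a}"
  proof (cases "S = {}")
    case True
    then show thesis using that[OF A.one_closed] by simp
  next
    case False
    then have "card S = 1" using card by (simp add: card_gt_0_iff le_antisym Suc_leI)
    then obtain a where "S = {a}" by (rule card_1_singletonE)
    then show thesis using that[of a] S subgroup.subset[OF subgroup_full] by auto
  qed
  have com: "P \<otimes>\<^bsub>aut_group M\<^esub> Q = Q \<otimes>\<^bsub>aut_group M\<^esub> P" if "P \<in> generate (aut_group M) S" "Q \<in> generate (aut_group M) S" for P Q
  proof -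
    have "P \<in> generate (aut_group M) {a}" "Q \<in> generate (aut_group M) {a}"
      using that A.mono_generate[OF a(2)] by auto
    then obtain i j :: int where "P = a [^]\<^bsub>aut_group M\<^esub> i" "Q = a [^]\<^bsub>aut_group M\<^esub> j"
      unfolding A.generate_pow[OF a(1)] by auto
    then show ?thesis using a(1) by (simp add: A.int_pow_mult add.commute flip: A.int_pow_mult)
  qed
  obtain f g where fg: "f \<in> FG" "g \<in> FG" and c: "0 < udist (f \<circ> g) (g \<circ> f)" by (rule non_commuting)
  \<comment> \<open>A quarter, because both \<open>f\<close> and \<open>g\<close> are replaced in
    both products.\<close>
  let ?c = "udist (f \<circ> g) (g \<circ> f) / 4"
  have c4: "0 < ?c" using c by simp
  have gen: "P \<in> aecl ` ae_full" if "P \<in> generate (aut_group M) S" for P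
    using A.generate_subgroup_incl[OF S subgroup_full] that carrier_full by auto
  obtain r where r: "r \<in> ae_full" "aecl r \<in> generate (aut_group M) S" "uniform_dist M (aecl f) (aecl r) < ?c"
    using dense FG_ae_full[OF fg(1)] c4 gen by blast
  obtain v where v: "v \<in> ae_full" "aecl v \<in> generate (aut_group M) S" "uniform_dist M (aecl g) (aecl v) < ?c"
    using dense FG_ae_full[OF fg(2)] c4 gen by blast
  note mp = FG_mp[OF fg(1)] FG_mp[OF fg(2)] ae_full_mp[OF r(1)] ae_full_mp[OF v(1)]
  have d: "udist f r < ?c" "udist g v < ?c" using r(3) v(3) by (simp_all add: uniform_dist_aecl mp)
  have "aecl (r \<circ> v) = aecl (v \<circ> r)" using com[OF r(2) v(2)] by (simp only: aut_group_mult mp)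
  then have e: "udist (r \<circ> v) (g \<circ> f) = udist (v \<circ> r) (g \<circ> f)"
    using uniform_dist_aecl[OF comp_in_mp_auts[OF mp(3,4)] comp_in_mp_auts[OF mp(2,1)]]
      uniform_dist_aecl[OF comp_in_mp_auts[OF mp(4,3)] comp_in_mp_auts[OF mp(2,1)]] by simp
  have "udist (f \<circ> g) (g \<circ> f) \<le> udist (f \<circ> g) (r \<circ> v) + udist (r \<circ> v) (g \<circ> f)"
    by (intro udist_triangle mp_autsD(2) comp_in_mp_auts mp)
  also have "\<dots> \<le> (udist f r + udist g v) + (udist v g + udist r f)"
    unfolding e by (intro add_mono udist_comp mp)
  finally show False using d c by (simp add: udist_commute[of v g] udist_commute[of r f])
qed

lemma min_top_generators_eq_2:
  "min_top_generators (full_group M E) (full_group_topology M E) = 2"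
proof -
  let ?N = "{enat (card S) | S. finite S \<and>
      topologically_generates (full_group M E) (full_group_topology M E) S}"
  have ge: "2 \<le> n" if nN: "n \<in> ?N" for n
  proof -
    obtain S where S: "n = enat (card S)" "finite S"
      "topologically_generates (full_group M E) (full_group_topology M E) S" using nN by blast
    have "\<not> card S \<le> 1"
      using not_single_generator[of S] S(2,3) unfolding topologically_generates_full_iff by blast
    then have "enat 2 \<le> enat (card S)" by simp
    then show ?thesis using S(1) by (simp add: numeral_eq_enat)
  qed
  obtain T U where TU: "T \<in> FG" "U \<in> FG" and dense: "\<forall>f\<in>ae_full. \<forall>e>0. \<exists>w\<in>words {T, U}. udist f w < e"
    using two_generators by blast
  have sub: "{T, U} \<subseteq> FG" using TU by simp
  have "topologically_generates (full_group M E) (full_group_topology M E) (aecl ` {T, U})"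
    unfolding topologically_generates_full_iff
  proof (intro conjI ballI allI impI)
    show "aecl ` {T, U} \<subseteq> full_group_carrier M E"
      unfolding carrier_full using TU FG_ae_full by blast
    fix f and e :: real assume f: "f \<in> ae_full" "0 < e"
    then obtain w where w: "w \<in> words {T, U}" "udist f w < e" using dense by blast
    have "uniform_dist M (aecl f) (aecl w) < e"
      using w(2) uniform_dist_aecl[OF ae_full_mp[OF f(1)] FG_mp[OF words_FG[OF sub w(1)]]] by simp
    then show "\<exists>P\<in>generate (aut_group M) (aecl ` {T, U}). uniform_dist M (aecl f) P < e"
      using words_generate[OF sub w(1)] by blast
  qed
  then have mem: "enat (card (aecl ` {T, U})) \<in> ?N" by blast
  \<comment> \<open>An upper bound suffices: that the two classes are different follows from the
    lower bound.\<close>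
  have "enat (card (aecl ` {T, U})) \<le> 2"
    using card_image_le[of "{T, U}" aecl] card_insert_le_m1[of 2 "{U}" T]
    by (simp add: numeral_eq_enat card_insert_if split: if_splits)
  then have "Inf ?N \<le> 2" using Inf_lower[OF mem] by (rule order_trans[rotated])
  moreover have "2 \<le> Inf ?N" by (rule Inf_greatest[OF ge])
  ultimately show ?thesis unfolding min_top_generators_def by (rule antisym)
qed

end

theorem theorem3p2:
  fixes M :: "'a measure" and E :: "'a rel"
  assumes "standard_borel M"
    and "prob_space M"
    and "non_atomic M"
    and "borel_equiv M E"
    and "countable_rel M E"
    and "measure_preserving_rel M E"
    and "ergodic_rel M E"
    and "hyperfinite_rel M E"
  shows "min_top_generators (full_group M E) (full_group_topology M E) = 2"
proof -
  obtain d where "polish_prob M d" using standard_borel_polish[OF assms(1,2)] .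
  then interpret hyperfinite_setting M d E
    using assms by (simp add: hyperfinite_setting_def hyperfinite_setting_axioms_def)
  show ?thesis by (rule min_top_generators_eq_2)
qed

end
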